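(* Let $\mathsf{k}$ be an infinite field and let $P$ be a partition of $n$. Then, in the dominance order on partitions of $n$, $$Q(P)\ \ge\ \lambda_U(\mathcal D_P).$$ In particular, there is an adequate matrix $A\in\mathcal U_B$ over $\mathsf k$ whose Jordan type $P_A$ satisfies $P_A\ge\lambda_U(\mathcal D_P)$.
   Context: **Partitions.** $P=(p_1\ge p_2\ge\dots\ge p_t)$ is a partition of $n$; $n_i$ is the multiplicity of the part $i$ in $P$, and $S_P=\{i: n_i\neq 0\}$. For $i\in S_P$ with $i\ne p_t$ let $i^-=\max\{s\in S_P: s<i\}$. A partition is almost rectangular if its largest and smallest parts differ by at most one; $r_P$ is the minimum number of almost rectangular subpartitions $P_1,\dots,P_r$ in a decomposition $P=P_1\cup\dots\cup P_r$ (union as multisets of parts). Dominance order on partitions of $n$ (parts in weakly decreasing order, padded with zeros): $P\ge P'$ iff $\sum_{k=1}^i p_k\ge\sum_{k=1}^i p'_k$ for all $i$. **The matrix $B$ and $Q(P)$.** $V$ is an $n$-dimensional $\mathsf k$-vector space with basis (also called set of vertices) $\mathsf B=\{(u,i,k): i\in S_P,\ 1\le u\le i,\ 1\le k\le n_i\}$, and $B$ is the nilpotent endomorphism with $B(u,i,k)=(u+1,i,k)$ if $u<i$ and $B(i,i,k)=0$; thus $B$ has Jordan type $P$ (its Jordan block sizes are the parts of $P$). We identify $\mathrm{End}_{\mathsf k}(V)$ with $n\times n$ matrices. $\mathcal N_B$ is the set of nilpotent matrices commuting with $B$; it is an irreducible algebraic variety. For nilpotent $A$, $P_A$ denotes its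 Jordan type, the partition of $n$ formed by its Jordan block sizes. $Q(P)$ is the Jordan type of a generic element of $\mathcal N_B$, i.e. the common value of $P_A$ for $A$ in a suitable Zariski dense open subset of $\mathcal N_B$; it is greater in the dominance order than any other Jordan type occurring in $\mathcal N_B$. $\mathcal U_B$ is the set of $C\in\mathcal N_B$ such that, for all $i\in S_P$ and $1\le k'\le k\le n_i$, the coefficient of $C(1,i,k)$ on the basis vector $(1,i,k')$ is $0$. **Elementary maps.** The following endomorphisms are zero on all basis vectors not listed. - $\beta_i$ ($i\in S_P\setminus\{p_t\}$): $(u,i,n_i)\mapsto(u,i^-,1)$ for $1\le u\le i^-$. - $\alpha_i$ ($i\in S_P\setminus\{p_t\}$): $(u,i^-,n_{i^-})\mapsto(u+i-i^-,i,1)$ for $1\le u\le i^-$. - $e_{i,k}$ ($i\in S_P$, $1\le k<n_i$): $(u,i,k)\mapsto(u,i,k+1)$ for $1\le u\le i$. - $w_\ell$ ($\ell\in S_P$): $(u,\ell,n_\ell)\mapsto(u+1,\ell,1)$ for $1\le u<\ell$. **Adequate.** A maximal consecutive subsequence (MCS) of $S_P$ is a set of consecutive integers in $S_P$ not properly contained in a larger one; $S_P''$ is the set of minimum elements of all MCS of odd cardinality. A matrix $A$ over $\mathsf k$ is adequate if there are nonzero $s_i,t_i,t_{i,k},z_\ell\in\mathsf k$ such that $$A=\sum_{i\in S_P\setminus\{p_t\}}(s_i\beta_i+t_i\alpha_i)+\sum_{i\in S_P,\,1\le k<n_i}t_{i,k}e_{i,k}+\sum_{\ell\in S_P''}z_\ell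 w_\ell .$$ Such $A$ lie in $\mathcal U_B$. **$s$-$U$-chains and $\lambda_U(\mathcal D_P)$.** $\mathcal D_P$ is the poset on the vertex set $\mathsf B$ determined by $\mathcal U_B$ (for distinct $b,b'$: $b<b'$ iff some $A\in\mathcal U_B$ has nonzero coefficient of $A(b)$ on $b'$); only its vertices are needed below. Let $\mathfrak A=(a_1,\dots,a_s)$ with $a_i\in S_P$ and $a_i\ge a_{i+1}+2$ for $1\le i<s$, and put $\{\mathfrak A\}=\{a_1,a_1-1,\dots,a_s,a_s-1\}$. The $s$-$U$-chain $U_{\mathfrak A}$ covers exactly the following set $\{U_{\mathfrak A}\}$ of vertices: all $(u,\ell,k)$ with $\ell\in\{\mathfrak A\}\cap S_P$; and, for each $\ell\in S_P\setminus\{\mathfrak A\}$ with $\ell>a_s$, all $(u,\ell,k)$, $1\le k\le n_\ell$, with $u\le\#\{i:a_i<\ell\}$ or $u\ge\ell+1-\#\{i:a_i<\ell\}$. Its length $|U_{\mathfrak A}|$ is the number of vertices in $\{U_{\mathfrak A}\}$. Set $u_0=0$ and, for $1\le i\le r_P$, $u_i=\max\{|U_{\mathfrak A}|: U_{\mathfrak A}\text{ is an }i\text{-}U\text{-chain}\}$. Then $\lambda_U(\mathcal D_P)$ is the partition of $n$ whose $i$-th part is $u_i-u_{i-1}$, $1\le i\le r_P$. *)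

theory Defs
  imports
    "Jordan_Normal_Form.Jordan_Normal_Form_Uniqueness"
    "HOL-Library.Multiset"
    "HOL-Analysis.Function_Topology"
begin

section \<open>Partitions\<close>

text \<open>A partition is the weakly decreasing list of its parts.  The set \<open>S\<^sub>P\<close> is \<^term>\<open>set P\<close>, the
  multiplicity of \<open>i\<close> is \<^term>\<open>count_list P i\<close> and the smallest part \<open>p\<^sub>t\<close> is \<^term>\<open>last P\<close>.\<close>

definition is_partition :: "nat \<Rightarrow> nat list \<Rightarrow> bool" where
  "is_partition n P \<longleftrightarrow> sorted_wrt (\<ge>) P \<and> 0 \<notin> set P \<and> sum_list P = n"

text \<open>Padding by zeros is implicit: \<^const>\<open>take\<close> returns the whole list beyond its length.\<close>

definition dominates :: "nat list \<Rightarrow> nat list \<Rightarrow> bool" where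
  "dominates p q \<longleftrightarrow> (\<forall>i. sum_list (take i q) \<le> sum_list (take i p))"

definition prev_part :: "nat list \<Rightarrow> nat \<Rightarrow> nat" where
  "prev_part P i = Max {s \<in> set P. s < i}"

definition almost_rectangular :: "nat multiset \<Rightarrow> bool" where
  "almost_rectangular M \<longleftrightarrow> (\<forall>x \<in># M. \<forall>y \<in># M. x \<le> y + 1)"

definition r_num :: "nat list \<Rightarrow> nat" where
  "r_num P = (LEAST r. \<exists>Ms :: nat multiset list.
     length Ms = r \<and> sum_list Ms = mset P \<and> (\<forall>M \<in> set Ms. almost_rectangular M))"

definition is_mcs :: "nat set \<Rightarrow> nat set \<Rightarrow> bool" where
  "is_mcs S M \<longleftrightarrow> (\<exists>a b. a \<le> b \<and> M = {a..b}) \<and> M \<subseteq> S \<and>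
     (\<forall>a b. M \<subseteq> {a..b} \<and> {a..b} \<subseteq> S \<longrightarrow> {a..b} = M)"

definition odd_mcs_mins :: "nat list \<Rightarrow> nat set" where
  "odd_mcs_mins P = {Min M | M. is_mcs (set P) M \<and> odd (card M)}"

section \<open>Jordan types\<close>

text \<open>Only nilpotent matrices have a Jordan type here: all blocks belong to the eigenvalue 0.
  Positivity of the block sizes is part of \<^const>\<open>jordan_nf\<close>.\<close>

definition has_jordan_type :: "'a :: field mat \<Rightarrow> nat list \<Rightarrow> bool" where
  "has_jordan_type A p \<longleftrightarrow> sorted_wrt (\<ge>) p \<and> jordan_nf A (map (\<lambda>m. (m, 0)) p)"

definition jordan_type :: "'a :: field mat \<Rightarrow> nat list" where
  "jordan_type A = (THE p. has_jordan_type A p)"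

lemma has_jordan_type_unique:
  fixes A :: "'a :: field mat"
  assumes "has_jordan_type A p" "has_jordan_type A q"
  shows "p = q"
proof -
  have cnt: "count (mset r) k = compute_nr_of_jordan_blocks A 0 k"
    if "has_jordan_type A r" "k \<noteq> 0" for r k
  proof -
    have "compute_nr_of_jordan_blocks A 0 k
        = length (filter ((=) (k, 0)) (map (\<lambda>m. (m, 0 :: 'a)) r))"
      using that compute_nr_of_jordan_blocks unfolding has_jordan_type_def by blast
    also have "\<dots> = count (mset r) k"
      by (induction r) auto
    finally show ?thesis by simp
  qed
  have pos: "count (mset r) 0 = 0" if "has_jordan_type A r" for r
    using that unfolding has_jordan_type_def jordan_nf_def by (force simp: count_eq_zero_iff)
  have "mset p = mset q"
    by (rule multiset_eqI) (metis assms cnt pos)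
  then have "mset (rev p) = mset (rev q)" by simp
  moreover have "sorted (rev p)" "sorted (rev q)"
    using assms unfolding has_jordan_type_def by (auto simp: sorted_wrt_rev)
  ultimately have "rev p = rev q" by (metis properties_for_sort)
  then show ?thesis by simp
qed

lemma jordan_type_eqI: "has_jordan_type A p \<Longrightarrow> jordan_type A = p"
  unfolding jordan_type_def using has_jordan_type_unique by blast

section \<open>The basis and the matrix \<open>B\<close>\<close>

type_synonym vertex = "nat \<times> nat \<times> nat"

definition vertices :: "nat list \<Rightarrow> vertex set" where
  "vertices P = {(u, i, k). i \<in> set P \<and> 1 \<le> u \<and> u \<le> i \<and> 1 \<le> k \<and> k \<le> count_list P i}"

text \<open>The enumeration of the basis through which endomorphisms are identified with matrices.\<close>

definition vertex_list :: "nat list \<Rightarrow> vertex list" where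
  "vertex_list P = [(u, i, k). i \<leftarrow> remdups P, k \<leftarrow> [1..<Suc (count_list P i)], u \<leftarrow> [1..<Suc i]]"

lemma set_vertex_list: "set (vertex_list P) = vertices P"
  unfolding vertex_list_def vertices_def by (auto simp: image_iff less_Suc_eq_le)

lemma length_vertex_list: "length (vertex_list P) = sum_list P"
proof -
  have "length (vertex_list P) = (\<Sum>i\<leftarrow>remdups P. count_list P i * i)"
    unfolding vertex_list_def by (simp add: length_concat comp_def sum_list_triv del: upt_Suc)
  also have "\<dots> = (\<Sum>i\<in>set P. count_list P i * i)"
    by (simp add: sum_list_distinct_conv_sum_set)
  also have "\<dots> = sum_list P"
    using sum_list_map_eq_sum_count[of "\<lambda>i. i" P] by simp
  finally show ?thesis .
qed

lemma card_vertices: "card (vertices P) = sum_list P"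
proof -
  let ?V = "\<lambda>i. (\<lambda>(u, k). (u, i, k)) ` ({1..i} \<times> {1..count_list P i})"
  have "vertices P = (\<Union>i\<in>set P. ?V i)"
    unfolding vertices_def by (auto simp: image_iff)
  also have "card \<dots> = (\<Sum>i\<in>set P. card (?V i))"
    by (rule card_UN_disjoint) auto
  also have "\<dots> = (\<Sum>i\<in>set P. count_list P i * i)"
    by (intro sum.cong refl, subst card_image) (auto simp: inj_on_def)
  also have "\<dots> = sum_list P"
    using sum_list_map_eq_sum_count[of "\<lambda>i. i" P] by simp
  finally show ?thesis .
qed

lemma distinct_vertex_list: "distinct (vertex_list P)"
  by (rule card_distinct) (simp add: set_vertex_list length_vertex_list card_vertices)

text \<open>The matrix (acting on column vectors) of the endomorphism \<open>b \<mapsto> (\<Sum>b'. f b b' b')\<close>.\<close>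

definition endo_mat :: "nat list \<Rightarrow> (vertex \<Rightarrow> vertex \<Rightarrow> 'a) \<Rightarrow> 'a mat" where
  "endo_mat P f = mat (sum_list P) (sum_list P) (\<lambda>(r, c). f (vertex_list P ! c) (vertex_list P ! r))"

text \<open>Coefficients of the endomorphism sending \<open>b\<close> to \<open>b'\<close> if \<open>g b = Some b'\<close>, and to zero if
  \<open>g b = None\<close>.\<close>

definition elem_coeff :: "(vertex \<Rightarrow> vertex option) \<Rightarrow> vertex \<Rightarrow> vertex \<Rightarrow> 'a :: field" where
  "elem_coeff g b b' = (if g b = Some b' then 1 else 0)"

definition B_map :: "vertex \<Rightarrow> vertex option" where
  "B_map = (\<lambda>(u, i, k). if u < i then Some (u + 1, i, k) else None)"

definition B_mat :: "nat list \<Rightarrow> 'a :: field mat" where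
  "B_mat P = endo_mat P (elem_coeff B_map)"

definition N_B :: "nat list \<Rightarrow> 'a :: field mat set" where
  "N_B P = {A \<in> carrier_mat (sum_list P) (sum_list P).
     A * B_mat P = B_mat P * A \<and> (\<exists>m. A ^\<^sub>m m = 0\<^sub>m (sum_list P) (sum_list P))}"

definition U_B :: "nat list \<Rightarrow> 'a :: field mat set" where
  "U_B P = {C \<in> N_B P. \<forall>r < sum_list P. \<forall>c < sum_list P. \<forall>i k k'.
     vertex_list P ! c = (1, i, k) \<and> vertex_list P ! r = (1, i, k') \<and> k' \<le> k \<longrightarrow> C $$ (r, c) = 0}"

section \<open>The generic Jordan type \<open>Q(P)\<close>\<close>

text \<open>Polynomial functions in the entries of an \<open>n \<times> n\<close> matrix.\<close>

inductive_set poly_funs :: "nat \<Rightarrow> ('a :: field mat \<Rightarrow> 'a) set" for n :: nat where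
  const: "(\<lambda>_. c) \<in> poly_funs n"
| entry: "i < n \<Longrightarrow> j < n \<Longrightarrow> (\<lambda>A. A $$ (i, j)) \<in> poly_funs n"
| add: "f \<in> poly_funs n \<Longrightarrow> g \<in> poly_funs n \<Longrightarrow> (\<lambda>A. f A + g A) \<in> poly_funs n"
| mult: "f \<in> poly_funs n \<Longrightarrow> g \<in> poly_funs n \<Longrightarrow> (\<lambda>A. f A * g A) \<in> poly_funs n"

text \<open>The Zariski topology on the \<open>n \<times> n\<close> matrices, generated by the basic open sets
  \<open>{A. f A \<noteq> 0}\<close>; subsets carry the subspace topology.\<close>

definition zariski :: "nat \<Rightarrow> 'a :: field mat topology" where
  "zariski n = topology_generated_by {{A \<in> carrier_mat n n. f A \<noteq> 0} | f. f \<in> poly_funs n}"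

lemma topspace_zariski: "topspace (zariski n :: 'a :: field mat topology) = carrier_mat n n"
proof -
  have "carrier_mat n n \<in> {{A \<in> carrier_mat n n. f A \<noteq> 0} | f. f \<in> (poly_funs n :: ('a mat \<Rightarrow> 'a) set)}"
    by (rule CollectI, rule exI[of _ "\<lambda>_. 1"]) (auto intro: poly_funs.const)
  then show ?thesis
    unfolding zariski_def topology_generated_by_topspace by blast
qed

definition is_generic_type :: "'a :: field itself \<Rightarrow> nat list \<Rightarrow> nat list \<Rightarrow> bool" where
  "is_generic_type _ P q \<longleftrightarrow>
     (\<exists>W :: 'a mat set.
        openin (subtopology (zariski (sum_list P)) (N_B P)) W \<and>
        subtopology (zariski (sum_list P)) (N_B P) closure_of W = N_B P \<and>
        (\<forall>A \<in> W. has_jordan_type A q))"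

definition Q :: "'a :: field itself \<Rightarrow> nat list \<Rightarrow> nat list" where
  "Q k P = (THE q. is_generic_type k P q)"

section \<open>Adequate matrices\<close>

definition beta_map :: "nat list \<Rightarrow> nat \<Rightarrow> vertex \<Rightarrow> vertex option" where
  "beta_map P i = (\<lambda>(u, j, k). if j = i \<and> k = count_list P i \<and> u \<le> prev_part P i
     then Some (u, prev_part P i, 1) else None)"

definition alpha_map :: "nat list \<Rightarrow> nat \<Rightarrow> vertex \<Rightarrow> vertex option" where
  "alpha_map P i = (\<lambda>(u, j, k). if j = prev_part P i \<and> k = count_list P (prev_part P i)
     then Some (u + i - prev_part P i, i, 1) else None)"

definition e_map :: "nat \<Rightarrow> nat \<Rightarrow> vertex \<Rightarrow> vertex option" where
  "e_map i l = (\<lambda>(u, j, k). if j = i \<and> k = l then Some (u, i, l + 1) else None)"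

definition w_map :: "nat list \<Rightarrow> nat \<Rightarrow> vertex \<Rightarrow> vertex option" where
  "w_map P l = (\<lambda>(u, j, k). if j = l \<and> k = count_list P l \<and> u < l then Some (u + 1, l, 1) else None)"

definition adequate :: "nat list \<Rightarrow> 'a :: field mat \<Rightarrow> bool" where
  "adequate P A \<longleftrightarrow>
     (\<exists>(s :: nat \<Rightarrow> 'a) (t :: nat \<Rightarrow> 'a) (t' :: nat \<Rightarrow> nat \<Rightarrow> 'a) (z :: nat \<Rightarrow> 'a).
        (\<forall>i \<in> set P - {last P}. s i \<noteq> 0 \<and> t i \<noteq> 0) \<and>
        (\<forall>i \<in> set P. \<forall>k \<in> {1..<count_list P i}. t' i k \<noteq> 0) \<and>
        (\<forall>l \<in> odd_mcs_mins P. z l \<noteq> 0) \<and>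
        A = endo_mat P (\<lambda>b b'.
          (\<Sum>i \<in> set P - {last P}.
             s i * elem_coeff (beta_map P i) b b' + t i * elem_coeff (alpha_map P i) b b') +
          (\<Sum>i \<in> set P. \<Sum>k \<in> {1..<count_list P i}. t' i k * elem_coeff (e_map i k) b b') +
          (\<Sum>l \<in> odd_mcs_mins P. z l * elem_coeff (w_map P l) b b')))"

section \<open>\<open>U\<close>-chains\<close>

text \<open>Only the vertices of the poset \<open>\<D>\<^sub>P\<close> enter below, so its order relation is not defined.\<close>

definition chain_index :: "nat list \<Rightarrow> nat list \<Rightarrow> bool" where
  "chain_index P a \<longleftrightarrow> set a \<subseteq> set P \<and> successively (\<lambda>x y. x \<ge> y + 2) a"

definition braces :: "nat list \<Rightarrow> nat set" where
  "braces a = (\<Union>x \<in> set a. {x, x - 1})"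

definition num_below :: "nat list \<Rightarrow> nat \<Rightarrow> nat" where
  "num_below a l = card {i. i < length a \<and> a ! i < l}"

text \<open>The bound \<open>u \<ge> l + 1 - num_below a l\<close> is written without subtraction on \<^typ>\<open>nat\<close>.\<close>

definition U_chain :: "nat list \<Rightarrow> nat list \<Rightarrow> vertex set" where
  "U_chain P a =
     {(u, l, k) \<in> vertices P. l \<in> braces a} \<union>
     {(u, l, k) \<in> vertices P. l \<notin> braces a \<and> l > last a \<and>
        (u \<le> num_below a l \<or> u + num_below a l \<ge> l + 1)}"

definition u_max :: "nat list \<Rightarrow> nat \<Rightarrow> nat" where
  "u_max P i = (if i = 0 then 0 else
     Max {card (U_chain P a) | a. chain_index P a \<and> length a = i})"

text \<open>The subtraction is not truncated for the indices used, since \<^term>\<open>u_max P\<close> is increasing on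
  \<open>{0..r_num P}\<close>.\<close>

definition lambda_U :: "nat list \<Rightarrow> nat list" where
  "lambda_U P = map (\<lambda>i. u_max P i - u_max P (i - 1)) [1..<Suc (r_num P)]"

end

theory Submission
  imports Defs "Jordan_Normal_Form.Jordan_Normal_Form_Existence" "HOL-Computational_Algebra.Formal_Laurent_Series"
begin

text \<open>
  Both assertions follow from one adequate matrix \<open>A\<close> in \<open>U\<^sub>B\<close> whose Jordan type dominates
  \<open>\<lambda>\<^sub>U\<close>, because the generic type \<open>Q(P)\<close> dominates every Jordan type that occurs in \<open>N\<^sub>B\<close>
  (\<open>generic_type_dominates\<close>).

  Jordan types are measured by poles. For a nilpotent \<open>A\<close> the resolvent \<open>(y - A)\<^sup>-\<^sup>1\<close> is a matrix of
  Laurent polynomials in \<open>y\<close>. If \<open>C\<close> and \<open>D\<close> have power series entries, then the pole at \<open>y = 0\<close> of the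
  \<open>s \<times> s\<close> determinant \<open>det (C (y - A)\<^sup>-\<^sup>1 D)\<close> has order at most the sum of the \<open>s\<close> largest Jordan
  blocks, since the resolvent of a block of size \<open>m\<close> is \<open>y\<^bsup>-m\<^esup>\<close> times a matrix of rank one plus an integral
  matrix (\<open>pole_le_det_sandwich_resolvent\<close>); and this bound is attained (\<open>exists_sandwich_with_pole\<close>).
  So a pole of large order is a certificate for a large Jordan type. Moreover the coefficients of such
  determinants are polynomials in the entries of \<open>A\<close>, hence partial sums of Jordan types are lower
  semicontinuous (\<open>jordan_type_semicontinuous\<close>). As \<open>k\<close> is infinite, finitely many nonvanishing conditions,
  each of which holds somewhere on a given line, hold together at some point of the line.

  For the generic type, \<open>U\<^sub>B\<close> is a linear space of nilpotent matrices (\<open>U_B_line\<close>), and every element of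
  \<open>N\<^sub>B\<close> is conjugate to an element of \<open>U\<^sub>B\<close> under an automorphism that commutes with \<open>B\<close>
  (\<open>N_B_conjugate_U_B\<close>). Lines in \<open>U\<^sub>B\<close> and their conjugates therefore suffice to produce an element whose
  type dominates all others and to show that its type occurs on a dense open set.

  For the chains, consider the linear family of all combinations of the elementary maps, zero coefficients
  allowed. If all \<open>s\<^sub>i\<close> and \<open>t\<^bsub>i,k\<^esub>\<close> are 1, the equation \<open>(y - A) \<psi> = d\<close> can be solved from the top
  level downwards, and the solution is governed by a continued fraction in an auxiliary variable \<open>x\<close>, in
  which \<open>x\<^bsup>u-1\<^esup>\<close> stands for the position \<open>u\<close> in a row:
  \<open>\<phi>\<^sub>l = 1 / (y\<^bsup>n(l)\<^esup> - z\<^sub>l x - t\<^sub>l x\<^bsup>l-l'\<^esup> \<phi>\<^sub>l\<^sub>')\<close> where \<open>l' = l\<^sup>-\<close> (\<open>flow_solution\<close>).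
  A determinant of the resolvent as above becomes the Gram determinant of polynomials \<open>f\<^sub>1, \<dots>, f\<^sub>s\<close> for
  the bilinear form \<open>\<langle>f, g\<rangle> = [x\<^bsup>l-1\<^esup>] f g \<phi>\<^sub>l\<close> (\<open>gram_pole_jordan_type\<close>). Choosing the parameters along
  a given chain, one descends through the levels: a level outside the braces contributes a pole of
  order \<open>2 n\<^sub>l s\<close> where \<open>s\<close> chain elements lie below it (\<open>gram_pole_pass_level\<close>), a brace \<open>{l, l - 1}\<close> or
  \<open>{l}\<close> contributes all its vertices (\<open>gram_pole_pass_pair\<close>, \<open>gram_pole_pass_single\<close>). In total this is at
  least the length of the chain. A brace with only one part needs the loop \<open>w\<^sub>l\<close>, thus \<open>l\<close> should be the
  minimum of an odd maximal consecutive subsequence; every chain can be replaced by one with this property that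
  covers at least as much (\<open>normalize_chain\<close>).

  So for each \<open>i \<le> r\<^sub>P\<close> some member of the family has its first \<open>i\<close> blocks of total size at least \<open>u\<^sub>i\<close>.
  On lines in the parameter space one reaches a member with nonzero parameters that works for
  all \<open>i\<close> (\<open>exists_adequate_u_max\<close>). Since \<open>u\<^sub>i\<close> increases with \<open>i\<close> (\<open>u_max_mono\<close>), the partial sums of
  \<open>\<lambda>\<^sub>U\<close> are the numbers \<open>u\<^sub>i\<close>, and the dominance follows.
\<close>

text \<open>The infix notations for coefficients of series clash with the indexing of vectors and matrices.\<close>

no_notation fps_nth (infixl "$" 75)
no_notation fls_nth (infixl "$$" 75)


section \<open>Nilpotent matrices over a field\<close>

lemma invertible_with_first_column:
  fixes v :: "'a :: field vec"
  assumes v: "v \<in> carrier_vec n" "v \<noteq> 0\<^sub>v n"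
  obtains P Q where "P \<in> carrier_mat n n" "Q \<in> carrier_mat n n" "P * Q = 1\<^sub>m n" "Q * P = 1\<^sub>m n"
    "0 < n" "col P 0 = v"
proof -
  from v obtain j where j: "j < n" "v $ j \<noteq> 0"
    by (metis carrier_vecD eq_vecI index_zero_vec(1) index_zero_vec(2))
  define P where "P = mat n n (\<lambda>(r, c). if c = 0 then v $ r else if c = j then (if r = 0 then 1 else 0)
    else if r = c then 1 else 0)"
  have P: "P \<in> carrier_mat n n" unfolding P_def by simp
  have "det P \<noteq> 0"
  proof
    assume "det P = 0"
    then obtain w where w: "w \<in> carrier_vec n" "w \<noteq> 0\<^sub>v n" "P *\<^sub>v w = 0\<^sub>v n"
      using det_0_iff_vec_prod_zero_field[OF P] by blast
    have eq: "(\<Sum>c\<in>{0..<n}. P $$ (r, c) * w $ c) = 0" if "r < n" for r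
    proof -
      have "(P *\<^sub>v w) $ r = 0" using w(3) that by simp
      then show ?thesis using that w(1) P
        by (simp add: mult_mat_vec_def scalar_prod_def)
    qed
    have nz: "0 < n" using j by simp
    have split: "(\<Sum>c\<in>{0..<n}. P $$ (r, c) * w $ c) = v $ r * w $ 0 + (\<Sum>c\<in>{0..<n}-{0}. P $$ (r, c) * w $ c)"
      if "r < n" for r
      using that nz by (subst sum.remove[of _ 0]) (auto simp: P_def)
    have row: "(\<Sum>c\<in>{0..<n}-{0}. P $$ (r, c) * w $ c) =
      (\<Sum>c\<in>{0..<n}-{0}. if c = (if r = 0 then j else r) \<and> (r = 0 \<or> r \<noteq> j) then w $ c else 0)"
      if "r < n" for r
      using that by (intro sum.cong) (auto simp: P_def)
    have w0: "w $ 0 = 0"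
    proof (cases "j = 0")
      case True
      have "(\<Sum>c\<in>{0..<n}-{0}. P $$ (0, c) * w $ c) = 0"
        unfolding row[OF nz] using True by (intro sum.neutral) auto
      then show ?thesis using eq[OF nz] split[OF nz] j True by simp
    next
      case False
      have "(\<Sum>c\<in>{0..<n}-{0}. P $$ (j, c) * w $ c) = 0"
        unfolding row[OF j(1)] using False by (intro sum.neutral) auto
      then show ?thesis using eq[OF j(1)] split[OF j(1)] j by simp
    qed
    have "w $ r = 0" if r: "r < n" for r
    proof -
      consider "r = 0" | "r \<noteq> 0" "r = j" | "r \<noteq> 0" "r \<noteq> j" by blast
      then show ?thesis
      proof cases
        case 1 then show ?thesis using w0 by simp
      next
        case 2
        have "(\<Sum>c\<in>{0..<n}-{0}. P $$ (0, c) * w $ c) = w $ j"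
          unfolding row[OF nz] using 2 r by simp
        then show ?thesis using eq[OF nz] split[OF nz] w0 2 by simp
      next
        case 3
        have "(\<Sum>c\<in>{0..<n}-{0}. P $$ (r, c) * w $ c) = w $ r"
          unfolding row[OF r] using 3 r by simp
        then show ?thesis using eq[OF r] split[OF r] w0 by simp
      qed
    qed
    then have "w = 0\<^sub>v n" using w(1) by (intro eq_vecI) auto
    with w(2) show False by simp
  qed
  from det_non_zero_imp_unit[OF P this, of "()"]
  obtain Q where Q: "Q * P = 1\<^sub>m n" "Q \<in> carrier_mat n n"
    unfolding Units_def ring_mat_def by auto
  have "P * Q = 1\<^sub>m n" using mat_mult_left_right_inverse[OF Q(2) P Q(1)] .
  moreover have "col P 0 = v" using v j by (intro eq_vecI) (auto simp: P_def)
  ultimately show thesis using that P Q j by auto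
qed

text \<open>A kernel vector, completed to a basis, splits off a zero column; the complementary block is
  again nilpotent, so the construction can be repeated.\<close>

lemma nilpotent_similar_strictly_upper:
  fixes M :: "'a :: field mat"
  assumes "M \<in> carrier_mat n n" "M ^\<^sub>m m = 0\<^sub>m n n"
  shows "\<exists>T P Q. similar_mat_wit M T P Q \<and> T \<in> carrier_mat n n \<and> (\<forall>i<n. \<forall>j\<le>i. T $$ (i, j) = 0)"
  using assms
proof (induction n arbitrary: M)
  case 0
  have "similar_mat_wit M M (1\<^sub>m 0) (1\<^sub>m 0)" using 0 by (intro similar_mat_wit_refl)
  then show ?case using 0 by blast
next
  case (Suc k)
  note M = Suc.prems(1)
  have "det M = 0"
  proof -
    have "det (M ^\<^sub>m r) = det M ^ r" for r
      using M by (induct r) (auto simp: det_mult[of _ "Suc k"])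
    then have "det M ^ m = det (0\<^sub>m (Suc k) (Suc k) :: 'a mat)" using Suc.prems(2) by metis
    also have "\<dots> = 0" by simp
    finally show ?thesis by simp
  qed
  then obtain v where v: "v \<in> carrier_vec (Suc k)" "v \<noteq> 0\<^sub>v (Suc k)" "M *\<^sub>v v = 0\<^sub>v (Suc k)"
    using det_0_iff_vec_prod_zero_field[OF M] by blast
  obtain P Q where P: "P \<in> carrier_mat (Suc k) (Suc k)" and Q: "Q \<in> carrier_mat (Suc k) (Suc k)"
    and PQ: "P * Q = 1\<^sub>m (Suc k)" and QP: "Q * P = 1\<^sub>m (Suc k)" and c0: "col P 0 = v"
    using invertible_with_first_column[OF v(1,2)] by blast
  define M' where "M' = Q * M * P"
  have M': "M' \<in> carrier_mat (Suc k) (Suc k)" unfolding M'_def using M P Q by simp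
  have wit: "similar_mat_wit M' M Q P"
    by (rule similar_mat_witI[OF QP PQ M'_def M' M Q P])
  have "M' ^\<^sub>m m = Q * M ^\<^sub>m m * P"
    by (rule similar_mat_wit_pow_id[OF wit])
  also have "\<dots> = 0\<^sub>m (Suc k) (Suc k)" using Suc.prems(2) P Q by simp
  finally have M'm: "M' ^\<^sub>m m = 0\<^sub>m (Suc k) (Suc k)" .
  have "col M' 0 = 0\<^sub>v (Suc k)"
  proof -
    have "col M' 0 = (Q * M) *\<^sub>v col P 0" unfolding M'_def
      using P Q M by (subst col_mult2[of _ "Suc k" "Suc k" _ "Suc k"]) auto
    also have "\<dots> = Q *\<^sub>v (M *\<^sub>v v)" unfolding c0
      using Q M v by (intro assoc_mult_mat_vec) auto
    also have "\<dots> = 0\<^sub>v (Suc k)" unfolding v(3) using Q by auto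
    finally show ?thesis .
  qed
  then have col0: "M' $$ (i, 0) = 0" if "i < Suc k" for i
    using that M' by (metis carrier_matD(1) carrier_matD(2) index_col index_zero_vec(1) zero_less_Suc)
  define N where "N = mat k k (\<lambda>(i, j). M' $$ (Suc i, Suc j))"
  define R where "R = mat 1 k (\<lambda>(i, j). M' $$ (0, Suc j))"
  have N: "N \<in> carrier_mat k k" and R: "R \<in> carrier_mat 1 k" by (auto simp: N_def R_def)
  have M'_block: "M' = four_block_mat (0\<^sub>m 1 1) R (0\<^sub>m k 1) N"
    using M' col0 by (intro eq_matI) (auto simp: four_block_mat_def N_def R_def)
  have pow: "(\<forall>i<k. (M' ^\<^sub>m r) $$ (Suc i, 0) = 0) \<and>
     (\<forall>i<k. \<forall>j<k. (N ^\<^sub>m r) $$ (i, j) = (M' ^\<^sub>m r) $$ (Suc i, Suc j))" for r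
  proof (induction r)
    case 0 then show ?case using M' N by auto
  next
    case (Suc r)
    have Mr: "M' ^\<^sub>m r \<in> carrier_mat (Suc k) (Suc k)" and Nr: "N ^\<^sub>m r \<in> carrier_mat k k"
      using M' N by auto
    have 1: "(M' ^\<^sub>m Suc r) $$ (i, j) = (\<Sum>l\<in>{0..<Suc k}. (M' ^\<^sub>m r) $$ (i, l) * M' $$ (l, j))"
      if "i < Suc k" "j < Suc k" for i j
      using that Mr M' by (simp add: scalar_prod_def)
    have 2: "(N ^\<^sub>m Suc r) $$ (i, j) = (\<Sum>l\<in>{0..<k}. (N ^\<^sub>m r) $$ (i, l) * N $$ (l, j))"
      if "i < k" "j < k" for i j
      using that Nr N by (simp add: scalar_prod_def)
    have 3: "(M' ^\<^sub>m Suc r) $$ (Suc i, 0) = 0" if "i < k" for i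
      unfolding 1[OF Suc_mono[OF that] zero_less_Suc] by (intro sum.neutral) (auto simp: col0)
    have 4: "(N ^\<^sub>m Suc r) $$ (i, j) = (M' ^\<^sub>m Suc r) $$ (Suc i, Suc j)" if ij: "i < k" "j < k" for i j
      unfolding 2[OF ij] 1[OF Suc_mono[OF ij(1)] Suc_mono[OF ij(2)]] sum.atLeast0_lessThan_Suc_shift
      using Suc.IH ij by (auto simp: N_def intro!: sum.cong)
    show ?case using 3 4 by blast
  qed
  have "N ^\<^sub>m m = 0\<^sub>m k k"
    using pow[of m] M'm N by (intro eq_matI) auto
  from Suc.IH[OF N this] obtain T' P' Q' where w': "similar_mat_wit N T' P' Q'"
    and T': "T' \<in> carrier_mat k k" "\<forall>i<k. \<forall>j\<le>i. T' $$ (i, j) = 0" by blast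
  from similar_mat_witD2[OF N w'] have P': "P' \<in> carrier_mat k k" and Q': "Q' \<in> carrier_mat k k"
    and PQ': "P' * Q' = 1\<^sub>m k" and QP': "Q' * P' = 1\<^sub>m k" and NT: "N = P' * T' * Q'" by blast+
  define T where "T = four_block_mat (0\<^sub>m 1 1) (R * P') (0\<^sub>m k 1) T'"
  define P2 where "P2 = four_block_mat (1\<^sub>m 1) (0\<^sub>m 1 k) (0\<^sub>m k 1) P'"
  define Q2 where "Q2 = four_block_mat (1\<^sub>m 1) (0\<^sub>m 1 k) (0\<^sub>m k 1) Q'"
  have RP: "R * P' \<in> carrier_mat 1 k" and PT': "P' * T' \<in> carrier_mat k k"
    using R P' T' by simp_all
  note z = zero_carrier_mat and o = one_carrier_mat
  have T: "T \<in> carrier_mat (1 + k) (1 + k)" and P2: "P2 \<in> carrier_mat (1 + k) (1 + k)"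
    and Q2: "Q2 \<in> carrier_mat (1 + k) (1 + k)"
    unfolding T_def P2_def Q2_def
    by (rule four_block_carrier_mat[OF z T'(1)] four_block_carrier_mat[OF o P']
      four_block_carrier_mat[OF o Q'])+
  have PT: "P2 * T = four_block_mat (0\<^sub>m 1 1) (R * P') (0\<^sub>m k 1) (P' * T')"
    unfolding P2_def T_def mult_four_block_mat[OF o z z P' z RP z T'(1)]
      left_mult_one_mat[OF RP] left_mult_zero_mat[OF RP] left_mult_zero_mat[OF T'(1)] right_add_zero_mat[OF RP]
      left_add_zero_mat[OF PT']
    using P' by simp
  have "P2 * T * Q2 = four_block_mat (0\<^sub>m 1 1) (R * P' * Q') (0\<^sub>m k 1) (P' * T' * Q')"
    unfolding PT Q2_def mult_four_block_mat[OF z RP z PT' o z z Q']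
      right_mult_zero_mat[OF RP] right_mult_zero_mat[OF PT'] left_add_zero_mat[OF mult_carrier_mat[OF RP Q']]
      left_add_zero_mat[OF mult_carrier_mat[OF PT' Q']] left_mult_zero_mat[OF Q']
    using RP PT' Q' by (simp del: One_nat_def)
  moreover have "R * P' * Q' = R"
    using assoc_mult_mat[OF R P' Q'] R unfolding PQ' by simp
  ultimately have MT: "M' = P2 * T * Q2" unfolding M'_block NT by simp
  have P2Q2: "P2 * Q2 = 1\<^sub>m (1 + k)" unfolding P2_def Q2_def mult_four_block_mat[OF o z z P' o z z Q']
    using P' Q' PQ' by simp
  have Q2P2: "Q2 * P2 = 1\<^sub>m (1 + k)" unfolding P2_def Q2_def mult_four_block_mat[OF o z z Q' o z z P']
    using P' Q' QP' by simp
  have "similar_mat_wit M' T P2 Q2"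
    using P2Q2 Q2P2 M' T P2 Q2 by (intro similar_mat_witI[OF _ _ MT, of "Suc k"]) simp_all
  with similar_mat_wit_sym[OF wit] have "similar_mat_wit M T (P * P2) (Q2 * Q)"
    by (rule similar_mat_wit_trans)
  moreover have "T $$ (i, j) = 0" if "i < Suc k" "j \<le> i" for i j
    using that T' unfolding T_def by (auto simp: four_block_mat_def)
  ultimately show ?case using T by auto
qed

lemma similar_mat_swap_blocks:
  fixes A B :: "'a :: comm_ring_1 mat"
  assumes A: "A \<in> carrier_mat n n" and B: "B \<in> carrier_mat m m"
  shows "similar_mat (four_block_mat A (0\<^sub>m n m) (0\<^sub>m m n) B) (four_block_mat B (0\<^sub>m m n) (0\<^sub>m n m) A)"
proof -
  define P :: "'a mat" where "P = four_block_mat (0\<^sub>m n m) (1\<^sub>m n) (1\<^sub>m m) (0\<^sub>m m n)"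
  define Q :: "'a mat" where "Q = four_block_mat (0\<^sub>m m n) (1\<^sub>m m) (1\<^sub>m n) (0\<^sub>m n m)"
  note z = zero_carrier_mat and o = one_carrier_mat
  have PQ: "P * Q = 1\<^sub>m (n + m)" unfolding P_def Q_def
    by (subst mult_four_block_mat[OF z o o z z o o z]) auto
  have QP: "Q * P = 1\<^sub>m (n + m)" unfolding P_def Q_def
    by (subst mult_four_block_mat[OF z o o z z o o z]) (auto simp: add.commute)
  have 1: "P * four_block_mat B (0\<^sub>m m n) (0\<^sub>m n m) A = four_block_mat (0\<^sub>m n m) A B (0\<^sub>m m n)"
    unfolding P_def by (subst mult_four_block_mat[OF z o o z B z z A]) (use A B in auto)
  have "P * four_block_mat B (0\<^sub>m m n) (0\<^sub>m n m) A * Q = four_block_mat A (0\<^sub>m n m) (0\<^sub>m m n) B"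
    unfolding 1 Q_def by (subst mult_four_block_mat[OF z A B z z o o z]) (use A B in auto)
  then have "similar_mat_wit (four_block_mat A (0\<^sub>m n m) (0\<^sub>m m n) B)
      (four_block_mat B (0\<^sub>m m n) (0\<^sub>m n m) A) P Q"
    using A B by (intro similar_mat_witI[OF PQ QP]) (auto simp: P_def Q_def)
  then show ?thesis unfolding similar_mat_def by blast
qed

lemma similar_jordan_matrix_append:
  fixes xs ys :: "(nat \<times> 'a :: comm_ring_1) list"
  shows "similar_mat (jordan_matrix (xs @ ys)) (jordan_matrix (ys @ xs))"
    and "similar_mat (jordan_matrix xs) (jordan_matrix xs') \<Longrightarrow>
      similar_mat (jordan_matrix (xs @ ys)) (jordan_matrix (xs' @ ys))"
    and "similar_mat (jordan_matrix xs) (jordan_matrix xs') \<Longrightarrow>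
      similar_mat (jordan_matrix (ys @ xs)) (jordan_matrix (ys @ xs'))"
proof -
  have app: "jordan_matrix (us @ vs) = four_block_mat (jordan_matrix us)
      (0\<^sub>m (sum_list (map fst us)) (sum_list (map fst vs)))
      (0\<^sub>m (sum_list (map fst vs)) (sum_list (map fst us))) (jordan_matrix vs)"
    for us vs :: "(nat \<times> 'a) list"
    unfolding jordan_matrix_def map_append diag_block_mat_append Let_def
    unfolding jordan_matrix_def[symmetric] jordan_matrix_dim ..
  show "similar_mat (jordan_matrix (xs @ ys)) (jordan_matrix (ys @ xs))"
    unfolding app by (rule similar_mat_swap_blocks) simp_all
  have refl: "similar_mat (jordan_matrix ys) (jordan_matrix ys)"
    by (rule similar_mat_refl[OF jordan_matrix_carrier])
  assume sim: "similar_mat (jordan_matrix xs) (jordan_matrix xs')"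
  then have dim: "sum_list (map fst xs) = sum_list (map fst xs')"
  proof -
    obtain n where "jordan_matrix xs \<in> carrier_mat n n" "jordan_matrix xs' \<in> carrier_mat n n"
      using similar_matD[OF sim] by auto
    then show ?thesis unfolding carrier_mat_def jordan_matrix_dim mem_Collect_eq by linarith
  qed
  show "similar_mat (jordan_matrix (xs @ ys)) (jordan_matrix (xs' @ ys))"
    unfolding app dim[symmetric] by (rule similar_mat_four_block_0_0[OF sim refl]) simp_all
  show "similar_mat (jordan_matrix (ys @ xs)) (jordan_matrix (ys @ xs'))"
    unfolding app dim[symmetric] by (rule similar_mat_four_block_0_0[OF refl sim]) simp_all
qed

text \<open>A Jordan type lists its blocks in decreasing order, whereas a triangular matrix yields the blocks of its
  normal form in some order.\<close>

lemma similar_jordan_matrix_mset: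
  fixes xs ys :: "(nat \<times> 'a :: comm_ring_1) list"
  assumes "mset xs = mset ys"
  shows "similar_mat (jordan_matrix xs) (jordan_matrix ys)"
  using assms
proof (induction xs arbitrary: ys)
  case Nil
  then show ?case using similar_mat_refl[OF jordan_matrix_carrier] by simp
next
  case (Cons x xs)
  then have "x \<in> set ys" by (metis list.set_intros(1) set_mset_mset)
  then obtain us vs where ys: "ys = us @ x # vs" by (meson split_list)
  with Cons.prems have "mset xs = mset (us @ vs)" by simp
  from similar_jordan_matrix_append(3)[OF Cons.IH[OF this], of "[x]"]
  have 1: "similar_mat (jordan_matrix (x # xs)) (jordan_matrix (([x] @ us) @ vs))" by simp
  have "similar_mat (jordan_matrix (([x] @ us) @ vs)) (jordan_matrix ((us @ [x]) @ vs))"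
    by (rule similar_jordan_matrix_append(2)[OF similar_jordan_matrix_append(1)])
  from similar_mat_trans[OF 1 this] show ?case unfolding ys by simp
qed

lemma poly_prod_list_eq_0_iff:
  "poly (\<Prod>x\<leftarrow>xs. f x) (a :: 'a :: idom) = 0 \<longleftrightarrow> (\<exists>x\<in>set xs. poly (f x) a = 0)"
  by (induction xs) auto

lemma nilpotent_has_jordan_type:
  fixes A :: "'a :: field mat"
  assumes A: "A \<in> carrier_mat n n" and m: "A ^\<^sub>m m = 0\<^sub>m n n"
  shows "\<exists>p. has_jordan_type A p"
proof -
  obtain T P Q where wit: "similar_mat_wit A T P Q" and T: "T \<in> carrier_mat n n"
    and T0: "\<forall>i<n. \<forall>j\<le>i. T $$ (i, j) = 0"
    using nilpotent_similar_strictly_upper[OF assms] by blast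
  have sim: "similar_mat A T" using wit unfolding similar_mat_def by blast
  have ut: "upper_triangular T" using T T0 by (auto simp: upper_triangular_def)
  define js where "js = triangular_to_jnf_vector T"
  have jT: "jordan_nf T js" unfolding js_def by (rule triangular_to_jnf_vector[OF T ut])
  have jA: "jordan_nf A js"
    using jT similar_mat_trans[OF sim, of "jordan_matrix js"] unfolding jordan_nf_def by simp
  have ev0: "a = 0" if "(k, a) \<in> set js" for k a
  proof -
    have "char_poly T = (\<Prod>(n, a)\<leftarrow>js. [:- a, 1:] ^ n)"
      using jT char_poly_similar[of T "jordan_matrix js"] jordan_matrix_char_poly[of js]
      unfolding jordan_nf_def by simp
    moreover have "char_poly T = (\<Prod>a\<leftarrow>diag_mat T. [:- a, 1:])"
      by (rule char_poly_upper_triangular[OF T ut])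
    moreover have "poly (\<Prod>(n, a)\<leftarrow>js. [:- a, 1:] ^ n) a = 0"
    proof -
      have "k \<noteq> 0" using jT that unfolding jordan_nf_def by force
      then have "poly ((\<lambda>(n, a). [:- a, 1:] ^ n) (k, a)) a = 0" by simp
      then show ?thesis using that unfolding poly_prod_list_eq_0_iff by blast
    qed
    ultimately have "poly (\<Prod>a\<leftarrow>diag_mat T. [:- a, 1:]) a = 0" by simp
    then have "\<exists>b\<in>set (diag_mat T). a = b"
      unfolding poly_prod_list_eq_0_iff by auto
    then show ?thesis using T T0 by (auto simp: diag_mat_def)
  qed
  \<comment> \<open>All eigenvalues are 0, so the normal form is determined by the sizes of its blocks.\<close>
  define p where "p = rev (sort (map fst js))"
  have "mset (map (\<lambda>m. (m, 0 :: 'a)) p) = image_mset (\<lambda>m. (m, 0)) (image_mset fst (mset js))"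
    unfolding p_def by simp
  also have "\<dots> = image_mset id (mset js)"
    unfolding multiset.map_comp using ev0 by (intro image_mset_cong) auto
  finally have ms: "mset (map (\<lambda>m. (m, 0 :: 'a)) p) = mset js" by simp
  have "similar_mat (jordan_matrix js) (jordan_matrix (map (\<lambda>m. (m, 0)) p))"
    by (rule similar_mat_sym[OF similar_jordan_matrix_mset[OF ms]])
  then have "jordan_nf A (map (\<lambda>m. (m, 0)) p)"
    using jA similar_mat_trans[of A "jordan_matrix js" "jordan_matrix (map (\<lambda>m. (m, 0)) p)"]
      mset_eq_setD[OF ms] unfolding jordan_nf_def by metis
  moreover have "sorted_wrt (\<ge>) p" 
    unfolding p_def sorted_wrt_rev by simp
  ultimately have "has_jordan_type A p" unfolding has_jordan_type_def by simp
  then show ?thesis by (rule exI[of _ p])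
qed

section \<open>Pole orders and determinants over Laurent series\<close>

text \<open>The valuation bound; \<open>pole_le 0\<close> says that the series is integral, i.e. a power series in \<open>y\<close>.\<close>

definition pole_le :: "nat \<Rightarrow> 'a :: zero fls \<Rightarrow> bool" where
  "pole_le d f \<longleftrightarrow> (\<forall>m < - int d. fls_nth f m = 0)"

lemma pole_le_mono: "pole_le d f \<Longrightarrow> d \<le> e \<Longrightarrow> pole_le e f"
  unfolding pole_le_def by auto

lemma pole_le_0 [simp]: "pole_le d 0"
  unfolding pole_le_def by simp

lemma pole_le_const [simp]: "pole_le d (fls_const c)"
  unfolding pole_le_def by auto

lemma pole_le_1 [simp]: "pole_le d (1 :: 'a :: zero_neq_one fls)"
  unfolding pole_le_def by auto

lemma pole_le_X_power [simp]: "pole_le d (fls_X ^ k :: 'a :: field fls)"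
  unfolding pole_le_def by auto

lemma pole_le_X_inv_power: "k \<le> d \<Longrightarrow> pole_le d (fls_X_inv ^ k :: 'a :: field fls)"
  unfolding pole_le_def by auto

lemma pole_le_add: "pole_le d f \<Longrightarrow> pole_le d g \<Longrightarrow> pole_le d (f + g :: 'a :: field fls)"
  unfolding pole_le_def by simp

lemma pole_le_diff: "pole_le d f \<Longrightarrow> pole_le d g \<Longrightarrow> pole_le d (f - g :: 'a :: field fls)"
  unfolding pole_le_def by simp

lemma pole_le_uminus: "pole_le d f \<Longrightarrow> pole_le d (- f :: 'a :: field fls)"
  unfolding pole_le_def by simp

lemma pole_le_sum: "(\<And>x. x \<in> S \<Longrightarrow> pole_le d (f x)) \<Longrightarrow> pole_le d (\<Sum>x\<in>S. f x :: 'a :: field fls)"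
  by (induction S rule: infinite_finite_induct) (auto intro: pole_le_add)

lemma pole_le_mult:
  fixes f g :: "'a :: field fls"
  assumes "pole_le d f" "pole_le e g"
  shows "pole_le (d + e) (f * g)"
proof (cases "f = 0 \<or> g = 0")
  case False
  then have "- int d \<le> fls_subdegree f" "- int e \<le> fls_subdegree g"
    using assms unfolding pole_le_def by (auto intro!: fls_subdegree_geI)
  then show ?thesis unfolding pole_le_def by (auto intro!: fls_times_nth_eq0)
qed auto

lemma pole_le_mult_integral:
  "pole_le 0 f \<Longrightarrow> pole_le d g \<Longrightarrow> pole_le d (f * g :: 'a :: field fls)"
  "pole_le d f \<Longrightarrow> pole_le 0 g \<Longrightarrow> pole_le d (f * g :: 'a :: field fls)"
  using pole_le_mult[of 0 f d g] pole_le_mult[of d f 0 g] by simp_all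

lemma pole_le_prod:
  "(\<And>x. x \<in> S \<Longrightarrow> pole_le (d x) (f x)) \<Longrightarrow> pole_le (sum d S) (\<Prod>x\<in>S. f x :: 'a :: field fls)"
  by (induction S rule: infinite_finite_induct) (auto intro: pole_le_mult)

lemma pole_le_det:
  fixes M :: "'a :: field fls mat"
  assumes "M \<in> carrier_mat s s" "\<And>i j. i < s \<Longrightarrow> j < s \<Longrightarrow> pole_le 0 (M $$ (i, j))"
  shows "pole_le 0 (det M)"
  unfolding det_def'[OF assms(1)]
proof (intro pole_le_sum)
  fix p assume p: "p \<in> {p. p permutes {0..<s}}"
  have "pole_le (\<Sum>i\<in>{0..<s}. 0) (\<Prod>i = 0..<s. M $$ (i, p i))"
    using p by (intro pole_le_prod assms(2)) (auto simp: permutes_in_image[of p "{0..<s}", simplified])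
  moreover have "pole_le 0 (signof p :: 'a fls)"
    by (auto simp: sign_def intro: pole_le_uminus)
  ultimately show "pole_le 0 (signof p * (\<Prod>i = 0..<s. M $$ (i, p i)))"
    by (intro pole_le_mult_integral) auto
qed

text \<open>Expanding the determinant in every row, only choices of distinct rank-one summands survive
  (two equal choices give proportional rows), so each summand contributes its pole at most once.\<close>

lemma pole_le_det_rank_one_sum:
  fixes a b :: "nat \<Rightarrow> nat \<Rightarrow> 'a :: field fls" and d :: "nat \<Rightarrow> nat"
  assumes a: "\<And>i k. pole_le 0 (a i k)" and b: "\<And>k j. pole_le 0 (b k j)"
    and q: "\<And>I. I \<subseteq> {..<T} \<Longrightarrow> card I = s \<Longrightarrow> sum d I \<le> q"
  shows "pole_le q (det (mat s s (\<lambda>(i, j). \<Sum>k<T. fls_X_inv ^ d k * a i k * b k j)))"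
proof -
  let ?c = "\<lambda>i k. fls_X_inv ^ d k * a i k"
  let ?F = "{f. (\<forall>i\<in>{0..<s}. f i \<in> {..<T}) \<and> (\<forall>i. i \<notin> {0..<s} \<longrightarrow> f i = i)}"
  define v where "v = (\<lambda>i k. ?c i k \<cdot>\<^sub>v vec s (b k))"
  have v: "v \<in> {0..<s} \<rightarrow> {..<T} \<rightarrow> carrier_vec s" unfolding v_def by simp
  have vs: "finsum_vec TYPE('a fls) s (v i) {..<T} = vec s (\<lambda>j. \<Sum>k<T. ?c i k * b k j)" for i
  proof (rule eq_vecI)
    fix j assume "j < dim_vec (vec s (\<lambda>j. \<Sum>k<T. ?c i k * b k j))"
    then have j: "j < s" by simp
    have "v i \<in> {..<T} \<rightarrow> carrier_vec s" unfolding v_def by simp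
    from index_finsum_vec[OF _ j this]
    show "finsum_vec TYPE('a fls) s (v i) {..<T} $ j = vec s (\<lambda>j. \<Sum>k<T. ?c i k * b k j) $ j"
      using j by (simp add: v_def)
  next
    have "finsum_vec TYPE('a fls) s (v i) {..<T} \<in> carrier_vec s"
      by (rule finsum_vec_closed) (simp add: v_def)
    then show "dim_vec (finsum_vec TYPE('a fls) s (v i) {..<T}) =
      dim_vec (vec s (\<lambda>j. \<Sum>k<T. ?c i k * b k j))" by simp
  qed
  \<comment> \<open>Every function \<open>f\<close> chooses one of the \<open>T\<close> summands in each row.\<close>
  have "mat s s (\<lambda>(i, j). \<Sum>k<T. ?c i k * b k j) =
      mat\<^sub>r s s (\<lambda>i. finsum_vec TYPE('a fls) s (v i) {..<T})"
    unfolding vs by (intro eq_matI) auto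
  also have "det \<dots> = (\<Sum>f\<in>?F. det (mat\<^sub>r s s (\<lambda>i. ?c i (f i) \<cdot>\<^sub>v vec s (b (f i)))))"
    using det_linear_rows_sum[OF finite_lessThan v] unfolding v_def .
  also have "pole_le q \<dots>"
  proof (intro pole_le_sum)
    fix f assume f: "f \<in> ?F"
    let ?M = "mat\<^sub>r s s (\<lambda>i. vec s (b (f i)))"
    have M: "?M \<in> carrier_mat s s" by simp
    have eq: "det (mat\<^sub>r s s (\<lambda>i. ?c i (f i) \<cdot>\<^sub>v vec s (b (f i)))) = (\<Prod>i\<in>{0..<s}. ?c i (f i)) * det ?M"
      by (rule det_rows_mul) auto
    show "pole_le q (det (mat\<^sub>r s s (\<lambda>i. ?c i (f i) \<cdot>\<^sub>v vec s (b (f i)))))"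
    proof (cases "inj_on f {0..<s}")
      case True
      have "pole_le 0 (det ?M)" by (rule pole_le_det[OF M]) (simp add: b)
      moreover have "pole_le q (\<Prod>i\<in>{0..<s}. ?c i (f i))"
      proof (rule pole_le_mono)
        show "pole_le (\<Sum>i\<in>{0..<s}. d (f i)) (\<Prod>i\<in>{0..<s}. ?c i (f i))"
          by (intro pole_le_prod pole_le_mult_integral(2) a pole_le_X_inv_power order.refl)
        have "(\<Sum>i\<in>{0..<s}. d (f i)) = sum d (f ` {0..<s})"
          by (simp add: sum.reindex[OF True])
        also have "\<dots> \<le> q"
          using f True by (intro q) (auto simp: card_image)
        finally show "(\<Sum>i\<in>{0..<s}. d (f i)) \<le> q" .
      qed
      ultimately show ?thesis unfolding eq by (intro pole_le_mult_integral(2))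
    next
      case False
      then obtain i j where "i < s" "j < s" "i \<noteq> j" "f i = f j"
        unfolding inj_on_def by auto
      then have "det ?M = 0"
        by (intro det_identical_rows[OF M, of i j]) auto
      then show ?thesis unfolding eq by simp
    qed
  qed
  finally show ?thesis .
qed

text \<open>Any \<open>s\<close> parts have at most the sum of the \<open>s\<close> largest ones.\<close>

lemma sum_nth_le_sum_list_take:
  fixes p :: "nat list"
  assumes "sorted_wrt (\<ge>) p" "J \<subseteq> {..<length p}" "card J \<le> s"
  shows "(\<Sum>k\<in>J. p ! k) \<le> sum_list (take s p)"
  using assms
proof (induction p arbitrary: J s)
  case Nil
  then show ?case by simp
next
  case (Cons x p)
  define J' where "J' = {k. Suc k \<in> J}"
  have fin: "finite J" using Cons.prems(2) finite_subset by blast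
  have J'sub: "J' \<subseteq> {..<length p}" using Cons.prems(2) unfolding J'_def by auto
  have JS: "J - {0} = Suc ` J'" unfolding J'_def by (auto simp: image_iff) (metis not0_implies_Suc)
  have card': "card (J - {0}) = card J'" unfolding JS by (simp add: card_image)
  have sum': "(\<Sum>k\<in>J - {0}. (x # p) ! k) = (\<Sum>k\<in>J'. p ! k)"
    unfolding JS by (simp add: sum.reindex)
  have srt: "sorted_wrt (\<ge>) p" and x: "\<forall>y\<in>set p. y \<le> x" using Cons.prems(1) by auto
  show ?case
  proof (cases "0 \<in> J")
    case True
    then have "card J = Suc (card J')" using fin card' by (metis card_Suc_Diff1)
    with Cons.prems(3) obtain s' where s': "s = Suc s'" "card J' \<le> s'" by (cases s) auto
    have "(\<Sum>k\<in>J. (x # p) ! k) = x + (\<Sum>k\<in>J'. p ! k)"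
      using sum.remove[OF fin True, of "\<lambda>k. (x # p) ! k"] sum' by simp
    then show ?thesis using Cons.IH[OF srt J'sub s'(2)] s' by simp
  next
    case False
    then have J: "J - {0} = J" by blast
    have le: "(\<Sum>k\<in>J'. p ! k) \<le> sum_list (take s p)"
      using Cons.IH[OF srt J'sub] Cons.prems(3) card' J by simp
    have "sum_list (take s p) \<le> sum_list (take s (x # p))"
    proof (cases s)
      case (Suc s')
      show ?thesis
      proof (cases "s' < length p")
        case True
        then show ?thesis using x Suc by (simp add: take_Suc_conv_app_nth)
      next
        case False
        then show ?thesis using Suc by simp
      qed
    qed simp
    with le sum' J show ?thesis by simp
  qed
qed

section \<open>The resolvent of a nilpotent matrix\<close>

text \<open>Matrix powers written out in the entries, so that they are polynomial functions on all
  matrices regardless of their formal dimensions.\<close>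

fun mpow :: "nat \<Rightarrow> 'a :: semiring_1 mat \<Rightarrow> nat \<Rightarrow> nat \<Rightarrow> nat \<Rightarrow> 'a" where
  "mpow n A 0 r c = (if r = c then 1 else 0)"
| "mpow n A (Suc N) r c = (\<Sum>l<n. mpow n A N r l * A $$ (l, c))"

lemma mpow_eq:
  assumes "A \<in> carrier_mat n n" "r < n" "c < n"
  shows "mpow n A N r c = (A ^\<^sub>m N) $$ (r, c)"
  using assms(2,3)
proof (induction N arbitrary: c)
  case (Suc N)
  have "A ^\<^sub>m N \<in> carrier_mat n n" using assms(1) by simp
  then show ?case using Suc assms(1)
    by (auto simp: scalar_prod_def lessThan_atLeast0 intro!: sum.cong)
qed (use assms(1) in auto)

text \<open>The geometric series for \<open>(y - A)\<^sup>-\<^sup>1\<close>; it stops before \<open>A\<^sup>n\<close>, so it is the inverse only for nilpotent \<open>A\<close>.\<close>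

definition resolvent :: "nat \<Rightarrow> 'a :: field mat \<Rightarrow> nat \<Rightarrow> nat \<Rightarrow> 'a fls" where
  "resolvent n A r c = (\<Sum>N<n. fls_X_inv ^ Suc N * fls_const (mpow n A N r c))"

definition sandwich :: "nat \<Rightarrow> nat \<Rightarrow> (nat \<Rightarrow> nat \<Rightarrow> 'a) \<Rightarrow> (nat \<Rightarrow> nat \<Rightarrow> 'a) \<Rightarrow> (nat \<Rightarrow> nat \<Rightarrow> 'a)
    \<Rightarrow> 'a :: comm_ring_1 mat" where
  "sandwich n s C R D = mat s s (\<lambda>(i, j). \<Sum>r<n. \<Sum>c<n. C i r * R r c * D c j)"

abbreviation jordan_nil :: "nat list \<Rightarrow> 'a :: field mat" where
  "jordan_nil p \<equiv> jordan_matrix (map (\<lambda>m. (m, 0)) p)"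

lemma jordan_nil_carrier: "jordan_nil p \<in> carrier_mat (sum_list p) (sum_list p)"
proof -
  have "map fst (map (\<lambda>m. (m, 0 :: 'a)) p) = p" by (simp add: comp_def)
  then show ?thesis using jordan_matrix_carrier[of "map (\<lambda>m. (m, 0 :: 'a)) p"] by simp
qed

lemma jordan_nil_pow_Cons:
  assumes "r < m + sum_list p" "c < m + sum_list p"
  shows "((jordan_nil (m # p) :: 'a :: field mat) ^\<^sub>m N) $$ (r, c) =
    (if r < m then if c < m \<and> r \<le> c \<and> c - r = N then 1 else 0
     else if c < m then 0 else (jordan_nil p ^\<^sub>m N) $$ (r - m, c - m))"
proof -
  let ?D = "diag_block_mat (map (\<lambda>(n, a). jordan_block n a ^\<^sub>m N) (map (\<lambda>m. (m, 0)) p))"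
  have D: "?D = (jordan_nil p :: 'a mat) ^\<^sub>m N" unfolding jordan_matrix_pow ..
  define K where "K = (jordan_nil p :: 'a mat) ^\<^sub>m N"
  have K: "K \<in> carrier_mat (sum_list p) (sum_list p)" unfolding K_def by (rule pow_carrier_mat[OF jordan_nil_carrier])
  have "(jordan_nil (m # p) :: 'a mat) ^\<^sub>m N = four_block_mat (jordan_block m 0 ^\<^sub>m N)
     (0\<^sub>m m (sum_list p)) (0\<^sub>m (sum_list p) m) K"
    unfolding jordan_matrix_pow list.map diag_block_mat.simps Let_def prod.case
    unfolding D K_def[symmetric] using K by simp
  then show ?thesis unfolding K_def[symmetric] jordan_block_zero_pow using assms K by auto
qed

lemma fls_X_inv_power_mult_X_power:
  "b \<le> a \<Longrightarrow> fls_X_inv ^ a * fls_X ^ b = (fls_X_inv ^ (a - b) :: 'a :: field fls)"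
  "a \<le> b \<Longrightarrow> fls_X_inv ^ a * fls_X ^ b = (fls_X ^ (b - a) :: 'a :: field fls)"
proof -
  have inv: "fls_X_inv * fls_X = (1 :: 'a fls)"
    by (intro fls_eqI) (simp add: fls_X_times_conv_shift)
  have cancel: "fls_X_inv ^ k * fls_X ^ k = (1 :: 'a fls)" for k
    unfolding power_mult_distrib[symmetric] inv by simp
  show "fls_X_inv ^ a * fls_X ^ b = (fls_X_inv ^ (a - b) :: 'a fls)" if "b \<le> a"
  proof -
    have "fls_X_inv ^ a * fls_X ^ b = fls_X_inv ^ (a - b) * (fls_X_inv ^ b * fls_X ^ b :: 'a fls)"
      using that by (simp add: mult.assoc flip: power_add)
    then show ?thesis unfolding cancel by simp
  qed
  show "fls_X_inv ^ a * fls_X ^ b = (fls_X ^ (b - a) :: 'a fls)" if "a \<le> b"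
  proof -
    have "fls_X_inv ^ a * fls_X ^ b = (fls_X_inv ^ a * fls_X ^ a :: 'a fls) * fls_X ^ (b - a)"
      using that by (simp add: mult.assoc flip: power_add)
    then show ?thesis unfolding cancel by simp
  qed
qed

text \<open>The first part is used for upper bounds, the second for exhibiting the poles.

  For one block of size \<open>m\<close> the entry \<open>y ^ (r - c - 1)\<close> of the resolvent on and above the diagonal
  extends to the rank-one matrix \<open>y ^ (r + (m - 1 - c) - m)\<close>, whose part below the diagonal is integral.\<close>

lemma resolvent_jordan_nil:
  assumes n: "\<And>m. m \<in> set p \<Longrightarrow> m \<le> n"
  defines "R \<equiv> \<lambda>r c. \<Sum>N<n. fls_X_inv ^ Suc N * fls_const (((jordan_nil p :: 'a :: field mat) ^\<^sub>m N) $$ (r, c))"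
  shows "\<exists>x w z. (\<forall>i j. pole_le 0 (x i j) \<and> pole_le 0 (w i j) \<and> pole_le 0 (z i j)) \<and>
     (\<forall>r<sum_list p. \<forall>c<sum_list p.
        R r c = (\<Sum>k<length p. fls_X_inv ^ (p ! k) * x r k * w k c) + z r c)" (is ?A)
    and "0 \<notin> set p \<Longrightarrow> \<exists>st en. (\<forall>i<length p. st i < sum_list p \<and> en i < sum_list p) \<and>
     (\<forall>i<length p. \<forall>j<length p. R (st i) (en j) = (if i = j then fls_X_inv ^ (p ! i) else 0))" (is "_ \<Longrightarrow> ?B")
proof -
  have "?A \<and> (0 \<notin> set p \<longrightarrow> ?B)"
    using n unfolding R_def
  proof (induction p)
    case Nil
    show ?case by (auto intro!: exI[of _ "\<lambda>_ _. 0"])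
  next
    case (Cons m p)
    define R where "R = (\<lambda>r c. \<Sum>N<n. fls_X_inv ^ Suc N * fls_const (((jordan_nil p :: 'a mat) ^\<^sub>m N) $$ (r, c)))"
    define R' where "R' = (\<lambda>r c. \<Sum>N<n. fls_X_inv ^ Suc N * fls_const (((jordan_nil (m # p) :: 'a mat) ^\<^sub>m N) $$ (r, c)))"
    have mn: "m \<le> n" using Cons.prems by simp
    have R': "R' r c = (if r < m then if c < m \<and> r \<le> c then fls_X_inv ^ Suc (c - r) else 0
        else if c < m then 0 else R (r - m) (c - m))"
      if rc: "r < m + sum_list p" "c < m + sum_list p" for r c
    proof -
      consider "r < m" | "\<not> r < m" "c < m" | "\<not> r < m" "\<not> c < m" by blast
      then show ?thesis
      proof cases
        case 1
        have "R' r c = (\<Sum>N<n. if c - r = N then if c < m \<and> r \<le> c then fls_X_inv ^ Suc (c - r) else 0 else 0)"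
          unfolding R'_def jordan_nil_pow_Cons[OF rc] using 1 by (intro sum.cong) auto
        also have "\<dots> = (if c < m \<and> r \<le> c then fls_X_inv ^ Suc (c - r) else 0)"
          using mn by (subst sum.delta') auto
        finally show ?thesis using 1 by simp
      next
        case 2
        then show ?thesis unfolding R'_def jordan_nil_pow_Cons[OF rc] by simp
      next
        case 3
        then show ?thesis unfolding R'_def R_def jordan_nil_pow_Cons[OF rc] by simp
      qed
    qed
    have prm: "m' \<le> n" if "m' \<in> set p" for m' using Cons.prems that by simp
    have IH: "(\<exists>x w z. (\<forall>i j. pole_le 0 (x i j) \<and> pole_le 0 (w i j) \<and> pole_le 0 (z i j)) \<and>
     (\<forall>r<sum_list p. \<forall>c<sum_list p.
        R r c = (\<Sum>k<length p. fls_X_inv ^ (p ! k) * x r k * w k c) + z r c)) \<and>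
      (0 \<notin> set p \<longrightarrow> (\<exists>st en. (\<forall>i<length p. st i < sum_list p \<and> en i < sum_list p) \<and>
       (\<forall>i<length p. \<forall>j<length p. R (st i) (en j) = (if i = j then fls_X_inv ^ (p ! i) else 0))))"
      unfolding R_def by (rule Cons.IH[OF prm])
    from conjunct1[OF IH] obtain x w z where xwz: "\<And>i j. pole_le 0 (x i j)" "\<And>i j. pole_le 0 (w i j)" "\<And>i j. pole_le 0 (z i j)"
      and R: "\<And>r c. r < sum_list p \<Longrightarrow> c < sum_list p \<Longrightarrow>
         R r c = (\<Sum>k<length p. fls_X_inv ^ (p ! k) * x r k * w k c) + z r c"
      by blast
    \<comment> \<open>\<open>x'\<close> and \<open>w'\<close> carry the rank-one part of the new block in the index \<open>k = 0\<close>; \<open>z'\<close> cancels its entries below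
      the diagonal.\<close>
    define x' where "x' = (\<lambda>r k. if k = 0 then (if r < m then fls_X ^ r else 0) else if r < m then 0 else x (r - m) (k - 1))"
    define w' where "w' = (\<lambda>k c. if k = 0 then (if c < m then fls_X ^ (m - 1 - c) else 0) else if c < m then 0 else w (k - 1) (c - m))"
    define z' where "z' = (\<lambda>r c. if r < m then if c < r then - (fls_X ^ (r - 1 - c)) else 0 else if c < m then 0 else z (r - m) (c - m))"
    have "R' r c = (\<Sum>k<length (m # p). fls_X_inv ^ ((m # p) ! k) * x' r k * w' k c) + z' r c"
      if rc: "r < sum_list (m # p)" "c < sum_list (m # p)" for r c
    proof -
      have split: "(\<Sum>k<length (m # p). fls_X_inv ^ ((m # p) ! k) * x' r k * w' k c) =
        fls_X_inv ^ m * x' r 0 * w' 0 c + (\<Sum>k<length p. fls_X_inv ^ (p ! k) * x' r (Suc k) * w' (Suc k) c)"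
        unfolding length_Cons sum.lessThan_Suc_shift by simp
      have 0: "fls_X_inv ^ m * x' r 0 * w' 0 c + (if r < m then z' r c else 0) =
         (if r < m \<and> c < m \<and> r \<le> c then fls_X_inv ^ Suc (c - r) else 0)"
      proof (cases "r < m \<and> c < m")
        case True
        have e: "fls_X_inv ^ m * x' r 0 * w' 0 c = fls_X_inv ^ m * (fls_X ^ (r + (m - 1 - c)) :: 'a fls)"
          using True unfolding x'_def w'_def power_add by simp
        show ?thesis
        proof (cases "r \<le> c")
          case rc: True
          then have "m - (r + (m - 1 - c)) = Suc (c - r)" "r + (m - 1 - c) \<le> m" using True by auto
          then show ?thesis using True rc unfolding e z'_def by (simp add: fls_X_inv_power_mult_X_power)
        next
          case rc: False
          then have "r + (m - 1 - c) - m = r - 1 - c" "m \<le> r + (m - 1 - c)" using True by auto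
          then show ?thesis using True rc unfolding e z'_def by (simp add: fls_X_inv_power_mult_X_power)
        qed
      qed (auto simp: x'_def w'_def z'_def)
      show ?thesis
      proof (cases "r < m")
        case True
        then have "(\<Sum>k<length p. fls_X_inv ^ (p ! k) * x' r (Suc k) * w' (Suc k) c) = 0"
          by (intro sum.neutral) (simp add: x'_def)
        then show ?thesis using True 0 R'[of r c] rc unfolding split by simp
      next
        case r: False
        then have z0: "fls_X_inv ^ m * x' r 0 * w' 0 c = 0" by (simp add: x'_def)
        show ?thesis
        proof (cases "c < m")
          case True
          then have "(\<Sum>k<length p. fls_X_inv ^ (p ! k) * x' r (Suc k) * w' (Suc k) c) = 0"
            by (intro sum.neutral) (simp add: w'_def)
          then show ?thesis using r True R'[of r c] rc z0 unfolding split by (simp add: z'_def)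
        next
          case False
          then show ?thesis using r R'[of r c] R[of "r - m" "c - m"] rc z0 unfolding split
            by (simp add: x'_def w'_def z'_def)
        qed
      qed
    qed
    moreover have "\<forall>i j. pole_le 0 (x' i j) \<and> pole_le 0 (w' i j) \<and> pole_le 0 (z' i j)"
      using xwz by (auto simp: x'_def w'_def z'_def intro: pole_le_uminus)
    moreover have "\<exists>st en. (\<forall>i<length (m # p). st i < sum_list (m # p) \<and> en i < sum_list (m # p)) \<and>
       (\<forall>i<length (m # p). \<forall>j<length (m # p). R' (st i) (en j) = (if i = j then fls_X_inv ^ ((m # p) ! i) else 0))"
      if "0 \<notin> set (m # p)"
    proof -
      have m0: "0 < m" using that by simp
      from conjunct2[OF IH] that obtain st en where
        se0: "\<forall>i<length p. st i < sum_list p \<and> en i < sum_list p" and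
        se1: "\<forall>i<length p. \<forall>j<length p. R (st i) (en j) = (if i = j then fls_X_inv ^ (p ! i) else 0)"
        by auto
      define st' where "st' = (\<lambda>i. case i of 0 \<Rightarrow> 0 | Suc i \<Rightarrow> m + st i)"
      define en' where "en' = (\<lambda>i. case i of 0 \<Rightarrow> m - 1 | Suc i \<Rightarrow> m + en i)"
      have lt: "st' i < m + sum_list p" "en' i < m + sum_list p" if "i < Suc (length p)" for i
        using that se0 m0 by (auto simp: st'_def en'_def split: nat.split)
      have "R' (st' i) (en' j) = (if i = j then fls_X_inv ^ ((m # p) ! i) else 0)"
        if ij: "i < Suc (length p)" "j < Suc (length p)" for i j
        unfolding R'[OF lt(1)[OF ij(1)] lt(2)[OF ij(2)]]
        using ij m0 se0 se1 by (cases i; cases j) (auto simp: st'_def en'_def simp flip: power_Suc)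
      then show ?thesis using lt by (intro exI[of _ st'] exI[of _ en']) auto
    qed
    ultimately show ?case unfolding R'_def by blast
  qed
  then show ?A and "0 \<notin> set p \<Longrightarrow> ?B" by auto
qed

lemma has_jordan_typeE:
  fixes A :: "'a :: field mat"
  assumes "A \<in> carrier_mat n n" "has_jordan_type A q"
  obtains P Q where "n = sum_list q" "sorted_wrt (\<ge>) q" "0 \<notin> set q"
    "P \<in> carrier_mat n n" "Q \<in> carrier_mat n n" "P * Q = 1\<^sub>m n" "Q * P = 1\<^sub>m n"
    "\<And>N. A ^\<^sub>m N = P * jordan_nil q ^\<^sub>m N * Q"
proof -
  from assms(2) have srt: "sorted_wrt (\<ge>) q" and sim: "similar_mat A (jordan_nil q)"
    and z: "0 \<notin> fst ` set (map (\<lambda>m. (m, 0 :: 'a)) q)"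
    unfolding has_jordan_type_def jordan_nf_def by blast+
  from z have z': "0 \<notin> set q" by (simp add: image_image)
  from sim obtain P Q where w: "similar_mat_wit A (jordan_nil q) P Q" unfolding similar_mat_def by blast
  note W = similar_mat_witD2[OF assms(1) w]
  have "n = sum_list q" using W(5) jordan_nil_carrier[of q, where ?'a = 'a] by (metis carrier_matD(1))
  then show thesis using that srt z' W similar_mat_wit_pow_id[OF w] by blast
qed

lemma index_mult_three:
  fixes P M Q :: "'a :: semiring_1 mat"
  assumes "P \<in> carrier_mat n n" "M \<in> carrier_mat n n" "Q \<in> carrier_mat n n" "r < n" "c < n"
  shows "(P * M * Q) $$ (r, c) = (\<Sum>a<n. \<Sum>b<n. P $$ (r, a) * M $$ (a, b) * Q $$ (b, c))"
proof -
  have "(P * M * Q) $$ (r, c) = (\<Sum>a<n. P $$ (r, a) * (\<Sum>b<n. M $$ (a, b) * Q $$ (b, c)))"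
    using assms by (simp add: scalar_prod_def lessThan_atLeast0)
  then show ?thesis by (simp add: sum_distrib_left mult.assoc)
qed

lemma fls_const_sum: "fls_const (\<Sum>x\<in>S. f x) = (\<Sum>x\<in>S. fls_const (f x :: 'a :: field))"
  by (induction S rule: infinite_finite_induct) (simp_all flip: fls_plus_const)

definition jordan_resolvent :: "nat \<Rightarrow> nat list \<Rightarrow> nat \<Rightarrow> nat \<Rightarrow> 'a :: field fls" where
  "jordan_resolvent n q r c = (\<Sum>N<n. fls_X_inv ^ Suc N * fls_const (((jordan_nil q :: 'a mat) ^\<^sub>m N) $$ (r, c)))"

lemma sandwich_resolvent_similar:
  fixes A P Q :: "'a :: field mat"
  assumes A: "A \<in> carrier_mat n n" and n: "n = sum_list q"
    and P: "P \<in> carrier_mat n n" and Q: "Q \<in> carrier_mat n n"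
    and pow: "\<And>N. A ^\<^sub>m N = P * jordan_nil q ^\<^sub>m N * Q"
  shows "sandwich n s C (resolvent n A) D = sandwich n s (\<lambda>i a. \<Sum>r<n. C i r * fls_const (P $$ (r, a)))
     (jordan_resolvent n q) (\<lambda>b j. \<Sum>c<n. fls_const (Q $$ (b, c)) * D c j)"
proof -
  have J: "(jordan_nil q :: 'a mat) ^\<^sub>m N \<in> carrier_mat n n" for N
    unfolding n by (rule pow_carrier_mat[OF jordan_nil_carrier])
  have res: "resolvent n A r c = (\<Sum>a<n. \<Sum>b<n. fls_const (P $$ (r, a)) * jordan_resolvent n q a b * fls_const (Q $$ (b, c)))"
    if rc: "r < n" "c < n" for r c
  proof -
    have "resolvent n A r c = (\<Sum>N<n. fls_X_inv ^ Suc N * (\<Sum>a<n. \<Sum>b<n.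
       fls_const (P $$ (r, a)) * fls_const (((jordan_nil q :: 'a mat) ^\<^sub>m N) $$ (a, b)) * fls_const (Q $$ (b, c))))"
      unfolding resolvent_def mpow_eq[OF A rc] pow index_mult_three[OF P J Q rc]
        fls_const_sum fls_const_mult_const[symmetric] ..
    also have "\<dots> = (\<Sum>N<n. \<Sum>a<n. \<Sum>b<n. fls_const (P $$ (r, a)) *
       (fls_X_inv ^ Suc N * fls_const (((jordan_nil q :: 'a mat) ^\<^sub>m N) $$ (a, b))) * fls_const (Q $$ (b, c)))"
      unfolding sum_distrib_left by (intro sum.cong refl) (simp only: mult_ac)
    also have "\<dots> = (\<Sum>a<n. \<Sum>N<n. \<Sum>b<n. fls_const (P $$ (r, a)) *
       (fls_X_inv ^ Suc N * fls_const (((jordan_nil q :: 'a mat) ^\<^sub>m N) $$ (a, b))) * fls_const (Q $$ (b, c)))"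
      by (rule sum.swap)
    also have "\<dots> = (\<Sum>a<n. \<Sum>b<n. \<Sum>N<n. fls_const (P $$ (r, a)) *
       (fls_X_inv ^ Suc N * fls_const (((jordan_nil q :: 'a mat) ^\<^sub>m N) $$ (a, b))) * fls_const (Q $$ (b, c)))"
      by (intro sum.cong refl sum.swap)
    finally show ?thesis unfolding jordan_resolvent_def sum_distrib_left sum_distrib_right .
  qed
  have "(\<Sum>r<n. \<Sum>c<n. C i r * resolvent n A r c * D c j) =
     (\<Sum>a<n. \<Sum>b<n. (\<Sum>r<n. C i r * fls_const (P $$ (r, a))) * jordan_resolvent n q a b *
        (\<Sum>c<n. fls_const (Q $$ (b, c)) * D c j))" for i j
  proof -
    let ?t = "\<lambda>a b r c. C i r * fls_const (P $$ (r, a)) * jordan_resolvent n q a b * (fls_const (Q $$ (b, c)) * D c j)"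
    have "(\<Sum>r<n. \<Sum>c<n. C i r * resolvent n A r c * D c j) = (\<Sum>r<n. \<Sum>c<n. \<Sum>a<n. \<Sum>b<n. ?t a b r c)"
      by (intro sum.cong refl) (simp add: res sum_distrib_left sum_distrib_right mult_ac)
    also have "\<dots> = (\<Sum>r<n. \<Sum>a<n. \<Sum>c<n. \<Sum>b<n. ?t a b r c)"
      by (intro sum.cong refl sum.swap)
    also have "\<dots> = (\<Sum>a<n. \<Sum>r<n. \<Sum>c<n. \<Sum>b<n. ?t a b r c)"
      by (rule sum.swap)
    also have "\<dots> = (\<Sum>a<n. \<Sum>r<n. \<Sum>b<n. \<Sum>c<n. ?t a b r c)"
      by (intro sum.cong refl sum.swap)
    also have "\<dots> = (\<Sum>a<n. \<Sum>b<n. \<Sum>r<n. \<Sum>c<n. ?t a b r c)"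
      by (intro sum.cong refl sum.swap)
    also have "\<dots> = (\<Sum>a<n. \<Sum>b<n. \<Sum>c<n. \<Sum>r<n. ?t a b r c)"
      by (intro sum.cong refl sum.swap)
    also have "\<dots> = (\<Sum>a<n. \<Sum>b<n. (\<Sum>r<n. C i r * fls_const (P $$ (r, a))) * jordan_resolvent n q a b *
        (\<Sum>c<n. fls_const (Q $$ (b, c)) * D c j))"
      by (simp only: sum_distrib_left sum_distrib_right)
    finally show ?thesis .
  qed
  then show ?thesis unfolding sandwich_def by simp
qed

text \<open>The integral remainder of the resolvent contributes an integral \<open>s \<times> s\<close> matrix, which is a sum of \<open>s\<close>
  rank-one matrices without poles. So the sandwich is a sum of rank-one matrices, one of pole order \<open>q ! k\<close> for
  each block and \<open>s\<close> further integral ones.\<close>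

lemma pole_le_det_sandwich_jordan_resolvent:
  fixes C D :: "nat \<Rightarrow> nat \<Rightarrow> 'a :: field fls"
  assumes n: "n = sum_list q" and srt: "sorted_wrt (\<ge>) q"
    and C: "\<And>i r. pole_le 0 (C i r)" and D: "\<And>c j. pole_le 0 (D c j)"
  shows "pole_le (sum_list (take s q)) (det (sandwich n s C (jordan_resolvent n q) D))"
proof -
  have "\<And>m. m \<in> set q \<Longrightarrow> m \<le> n" unfolding n by (rule member_le_sum_list) simp_all
  then have "\<exists>x w z. (\<forall>i j. pole_le 0 (x i j) \<and> pole_le 0 (w i j) \<and> pole_le 0 (z i j)) \<and>
     (\<forall>r<sum_list q. \<forall>c<sum_list q. (jordan_resolvent n q r c :: 'a fls) =
       (\<Sum>k<length q. fls_X_inv ^ (q ! k) * x r k * w k c) + z r c)"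
    unfolding jordan_resolvent_def by (rule resolvent_jordan_nil(1))
  then obtain x w z where
    int: "\<forall>i j. pole_le 0 (x i j) \<and> pole_le 0 (w i j) \<and> pole_le 0 (z i j)"
    and R0: "\<forall>r<sum_list q. \<forall>c<sum_list q. (jordan_resolvent n q r c :: 'a fls) =
       (\<Sum>k<length q. fls_X_inv ^ (q ! k) * x r k * w k c) + z r c"
    by (elim exE conjE)
  have R: "(jordan_resolvent n q r c :: 'a fls) =
       (\<Sum>k<length q. fls_X_inv ^ (q ! k) * x r k * w k c) + z r c" if "r < n" "c < n" for r c
    using R0 that n by simp
  let ?t = "length q"
  define d where "d = (\<lambda>k. if k < ?t then q ! k else 0)"
  define a where "a = (\<lambda>i k. if k < ?t then \<Sum>r<n. C i r * x r k
      else \<Sum>r<n. \<Sum>c<n. C i r * z r c * D c (k - ?t))"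
  define b where "b = (\<lambda>k j. if k < ?t then \<Sum>c<n. w k c * D c j else if k - ?t = j then 1 else 0)"
  have split: "(\<Sum>k<?t + s. f k) = (\<Sum>k<?t. f k) + (\<Sum>l<s. f (?t + l))" for f :: "nat \<Rightarrow> 'a fls"
    by (induction s) (simp_all add: algebra_simps)
  have entry: "(\<Sum>r<n. \<Sum>c<n. C i r * jordan_resolvent n q r c * D c j) =
     (\<Sum>k<?t + s. fls_X_inv ^ d k * a i k * b k j)" if "j < s" for i j
  proof -
    have 1: "(\<Sum>k<?t. fls_X_inv ^ d k * a i k * b k j) =
        (\<Sum>r<n. \<Sum>c<n. \<Sum>k<?t. C i r * (fls_X_inv ^ (q ! k) * x r k * w k c) * D c j)"
    proof -
      have "(\<Sum>k<?t. fls_X_inv ^ d k * a i k * b k j) =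
         (\<Sum>k<?t. \<Sum>r<n. \<Sum>c<n. C i r * (fls_X_inv ^ (q ! k) * x r k * w k c) * D c j)"
        by (intro sum.cong refl)
          (simp add: d_def a_def b_def sum_distrib_left sum_distrib_right mult_ac)
      also have "\<dots> = (\<Sum>r<n. \<Sum>k<?t. \<Sum>c<n. C i r * (fls_X_inv ^ (q ! k) * x r k * w k c) * D c j)"
        by (rule sum.swap)
      also have "\<dots> = (\<Sum>r<n. \<Sum>c<n. \<Sum>k<?t. C i r * (fls_X_inv ^ (q ! k) * x r k * w k c) * D c j)"
        by (intro sum.cong refl sum.swap)
      finally show ?thesis .
    qed
    have "(\<Sum>l<s. fls_X_inv ^ d (?t + l) * a i (?t + l) * b (?t + l) j) =
        (\<Sum>l<s. if j = l then \<Sum>r<n. \<Sum>c<n. C i r * z r c * D c l else 0)"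
      by (intro sum.cong) (auto simp: d_def a_def b_def)
    also have "\<dots> = (\<Sum>r<n. \<Sum>c<n. C i r * z r c * D c j)" using that by simp
    finally have 2: "(\<Sum>l<s. fls_X_inv ^ d (?t + l) * a i (?t + l) * b (?t + l) j) =
      (\<Sum>r<n. \<Sum>c<n. C i r * z r c * D c j)" .
    show ?thesis unfolding split 1 2 sum.distrib[symmetric]
      by (intro sum.cong refl) (simp add: R distrib_left distrib_right sum_distrib_left sum_distrib_right)
  qed
  have M: "sandwich n s C (jordan_resolvent n q) D =
      mat s s (\<lambda>(i, j). \<Sum>k<?t + s. fls_X_inv ^ d k * a i k * b k j)"
    unfolding sandwich_def by (intro eq_matI) (auto simp: entry)
  show ?thesis unfolding M
  proof (rule pole_le_det_rank_one_sum)
    show "pole_le 0 (a i k)" for i k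
      unfolding a_def using int C D by (auto intro!: pole_le_sum pole_le_mult_integral(1))
    show "pole_le 0 (b k j)" for k j
      unfolding b_def using int C D by (auto intro!: pole_le_sum pole_le_mult_integral(1))
    fix I assume I: "I \<subseteq> {..<?t + s}" "card I = s"
    have fin: "finite I" using I finite_subset by blast
    have "sum d I = sum d (I \<inter> {..<?t})"
      by (intro sum.mono_neutral_right fin) (auto simp: d_def)
    also have "\<dots> = (\<Sum>k\<in>I \<inter> {..<?t}. q ! k)" by (intro sum.cong) (auto simp: d_def)
    also have "\<dots> \<le> sum_list (take s q)"
    proof (rule sum_nth_le_sum_list_take[OF srt])
      show "card (I \<inter> {..<?t}) \<le> s" using I(2) fin card_mono[OF fin, of "I \<inter> {..<?t}"] by simp
    qed auto
    finally show "sum d I \<le> sum_list (take s q)" .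
  qed
qed

text \<open>A change of basis is absorbed in the integral matrices \<open>C\<close> and \<open>D\<close>.\<close>

lemma pole_le_det_sandwich_resolvent:
  fixes A :: "'a :: field mat"
  assumes A: "A \<in> carrier_mat n n" and q: "has_jordan_type A q"
    and C: "\<And>i r. pole_le 0 (C i r)" and D: "\<And>c j. pole_le 0 (D c j)"
  shows "pole_le (sum_list (take s q)) (det (sandwich n s C (resolvent n A) D))"
proof -
  obtain P Q where n: "n = sum_list q" and srt: "sorted_wrt (\<ge>) q"
    and PQ: "P \<in> carrier_mat n n" "Q \<in> carrier_mat n n" and pow: "\<And>N. A ^\<^sub>m N = P * jordan_nil q ^\<^sub>m N * Q"
    using has_jordan_typeE[OF A q] by metis
  show ?thesis unfolding sandwich_resolvent_similar[OF A n PQ pow]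
    by (rule pole_le_det_sandwich_jordan_resolvent[OF n srt])
       (auto intro!: pole_le_sum pole_le_mult_integral(1) C D)
qed

text \<open>The bound is attained by pairing the first with the last vectors of the largest blocks.\<close>

lemma exists_sandwich_with_pole:
  fixes A :: "'a :: field mat"
  assumes A: "A \<in> carrier_mat n n" and q: "has_jordan_type A q" and s: "s \<le> length q"
  shows "\<exists>C D. (\<forall>i j. pole_le 0 (C i j) \<and> pole_le 0 (D i j)) \<and>
    det (sandwich n s C (resolvent n A) D) = fls_X_inv ^ sum_list (take s q)"
proof -
  obtain P Q where n: "n = sum_list q" and z: "0 \<notin> set q"
    and P: "P \<in> carrier_mat n n" and Q: "Q \<in> carrier_mat n n" and QP: "Q * P = 1\<^sub>m n"
    and pow: "\<And>N. A ^\<^sub>m N = P * jordan_nil q ^\<^sub>m N * Q"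
    using has_jordan_typeE[OF A q] by metis
  have "\<And>m. m \<in> set q \<Longrightarrow> m \<le> n" unfolding n by (rule member_le_sum_list) simp_all
  then have "\<exists>st en. (\<forall>i<length q. st i < sum_list q \<and> en i < sum_list q) \<and>
     (\<forall>i<length q. \<forall>j<length q.
      (jordan_resolvent n q (st i) (en j) :: 'a fls) = (if i = j then fls_X_inv ^ (q ! i) else 0))"
    unfolding jordan_resolvent_def by (rule resolvent_jordan_nil(2)[OF _ z])
  then obtain st en where
    se0: "\<forall>i<length q. st i < sum_list q \<and> en i < sum_list q"
    and R: "\<forall>i<length q. \<forall>j<length q.
      (jordan_resolvent n q (st i) (en j) :: 'a fls) = (if i = j then fls_X_inv ^ (q ! i) else 0)"
    by (elim exE conjE)
  have se: "st i < n \<and> en i < n" if "i < length q" for i using se0 that n by simp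
  define C where "C = (\<lambda>i r. fls_const (Q $$ (st i, r)))"
  define D where "D = (\<lambda>c j. fls_const (P $$ (c, en j)))"
  have QPe: "(\<Sum>r<n. Q $$ (a, r) * P $$ (r, b)) = (if a = b then 1 else 0)" if "a < n" "b < n" for a b
  proof -
    have "(Q * P) $$ (a, b) = (\<Sum>r<n. Q $$ (a, r) * P $$ (r, b))"
      using that P Q by (simp add: scalar_prod_def lessThan_atLeast0)
    then show ?thesis using that unfolding QP by simp
  qed
  have C': "(\<Sum>r<n. C i r * fls_const (P $$ (r, a))) = (if st i = a then 1 else 0)"
    if "i < s" "a < n" for i a
  proof -
    have "(\<Sum>r<n. C i r * fls_const (P $$ (r, a))) = fls_const (\<Sum>r<n. Q $$ (st i, r) * P $$ (r, a))"
      unfolding C_def fls_const_sum by simp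
    then show ?thesis using QPe[of "st i" a] se[of i] that s by simp
  qed
  have D': "(\<Sum>c<n. fls_const (Q $$ (b, c)) * D c j) = (if b = en j then 1 else 0)"
    if "j < s" "b < n" for j b
  proof -
    have "(\<Sum>c<n. fls_const (Q $$ (b, c)) * D c j) = fls_const (\<Sum>c<n. Q $$ (b, c) * P $$ (c, en j))"
      unfolding D_def fls_const_sum by simp
    then show ?thesis using QPe[of b "en j"] se[of j] that s by simp
  qed
  let ?M = "mat s s (\<lambda>(i, j). if i = j then fls_X_inv ^ (q ! i) else (0 :: 'a fls))"
  have M: "sandwich n s C (resolvent n A) D = ?M"
    unfolding sandwich_resolvent_similar[OF A n P Q pow]
    unfolding sandwich_def
  proof (rule cong_mat[OF refl refl], unfold prod.case)
    fix i j assume ij: "i < s" "j < s"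
    have "(\<Sum>a<n. \<Sum>b<n. (\<Sum>r<n. C i r * fls_const (P $$ (r, a))) * jordan_resolvent n q a b *
        (\<Sum>c<n. fls_const (Q $$ (b, c)) * D c j)) =
      (\<Sum>a<n. \<Sum>b<n. (if st i = a then 1 else 0) * jordan_resolvent n q a b * (if b = en j then 1 else 0))"
      using ij by (intro sum.cong refl) (simp add: C' D')
    also have "\<dots> = (\<Sum>a<n. if st i = a then (\<Sum>b<n. if b = en j then jordan_resolvent n q a b else 0) else 0)"
    proof (intro sum.cong refl)
      fix a
      have "(\<Sum>b<n. (if st i = a then 1 else 0) * jordan_resolvent n q a b * (if b = en j then 1 else 0)) =
        (if st i = a then 1 else 0) * (\<Sum>b<n. if b = en j then jordan_resolvent n q a b else 0)"
        unfolding sum_distrib_left by (intro sum.cong refl) simp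
      also have "\<dots> = (if st i = a then (\<Sum>b<n. if b = en j then jordan_resolvent n q a b else 0) else 0)"
        by simp
      finally show "(\<Sum>b<n. (if st i = a then 1 else 0) * jordan_resolvent n q a b * (if b = en j then 1 else 0)) =
        (if st i = a then (\<Sum>b<n. if b = en j then jordan_resolvent n q a b else 0) else 0)" .
    qed
    also have "\<dots> = jordan_resolvent n q (st i) (en j)"
      unfolding sum.delta[OF finite_lessThan] sum.delta'[OF finite_lessThan]
      using se[of i] se[of j] ij s by simp
    also have "\<dots> = (if i = j then fls_X_inv ^ (q ! i) else 0)" using R ij s by simp
    finally show "(\<Sum>a<n. \<Sum>b<n. (\<Sum>r<n. C i r * fls_const (P $$ (r, a))) * jordan_resolvent n q a b *
        (\<Sum>c<n. fls_const (Q $$ (b, c)) * D c j)) = (if i = j then fls_X_inv ^ (q ! i) else 0)" .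
  qed
  have "det ?M = prod_list (diag_mat ?M)"
    by (rule det_upper_triangular) auto
  also have "diag_mat ?M = map (\<lambda>m. fls_X_inv ^ m) (take s q)"
    using s by (intro nth_equalityI) (auto simp: diag_mat_def)
  also have "prod_list (map (\<lambda>m. fls_X_inv ^ m) l) = (fls_X_inv :: 'a fls) ^ sum_list l" for l
    by (induction l) (simp_all add: power_add)
  finally have "det (sandwich n s C (resolvent n A) D) = fls_X_inv ^ sum_list (take s q)"
    unfolding M .
  then show ?thesis unfolding C_def D_def by (intro exI conjI) auto
qed

section \<open>Semicontinuity of the Jordan type\<close>

text \<open>The arguments below need the same closure properties for polynomial functions of the entries of a matrix and for
  polynomials in one variable.\<close>

definition function_algebra :: "('b \<Rightarrow> 'a :: field) set \<Rightarrow> bool" where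
  "function_algebra F \<longleftrightarrow> (\<forall>c. (\<lambda>_. c) \<in> F) \<and>
     (\<forall>f\<in>F. \<forall>g\<in>F. (\<lambda>x. f x + g x) \<in> F \<and> (\<lambda>x. f x * g x) \<in> F)"

lemma function_algebraD:
  assumes "function_algebra F"
  shows "(\<lambda>_. c) \<in> F"
    and "f \<in> F \<Longrightarrow> g \<in> F \<Longrightarrow> (\<lambda>x. f x + g x) \<in> F"
    and "f \<in> F \<Longrightarrow> g \<in> F \<Longrightarrow> (\<lambda>x. f x * g x) \<in> F"
  using assms unfolding function_algebra_def by blast+

lemma function_algebra_poly_funs: "function_algebra (poly_funs n)"
  unfolding function_algebra_def by (auto intro: poly_funs.intros)

lemma function_algebra_sum:
  assumes "function_algebra F" "\<And>i. i \<in> S \<Longrightarrow> f i \<in> F"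
  shows "(\<lambda>x. \<Sum>i\<in>S. f i x) \<in> F"
  using assms(2)
  by (induction S rule: infinite_finite_induct) (auto intro: function_algebraD[OF assms(1)])

text \<open>Laurent series valued functions that are finite combinations of functions of the algebra; in
  particular all their Laurent coefficients belong to the algebra.\<close>

inductive_set laurent_funs :: "('b \<Rightarrow> 'a :: field) set \<Rightarrow> ('b \<Rightarrow> 'a fls) set" for F where
  base: "f \<in> F \<Longrightarrow> (\<lambda>x. h * fls_const (f x)) \<in> laurent_funs F"
| add: "u \<in> laurent_funs F \<Longrightarrow> v \<in> laurent_funs F \<Longrightarrow> (\<lambda>x. u x + v x) \<in> laurent_funs F"

lemma laurent_funs_mult:
  assumes F: "function_algebra F" and u: "u \<in> laurent_funs F" and v: "v \<in> laurent_funs F"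
  shows "(\<lambda>x. u x * v x) \<in> laurent_funs F"
  using u
proof induction
  case (base f h)
  from v show ?case
  proof induction
    case (base g k)
    have "(\<lambda>x. h * fls_const (f x) * (k * fls_const (g x))) = (\<lambda>x. h * k * fls_const (f x * g x))"
      unfolding fls_const_mult_const[symmetric] by (simp add: mult_ac)
    then show ?case using laurent_funs.base[OF function_algebraD(3)[OF F \<open>f \<in> F\<close> base]] by simp
  next
    case (add u v)
    from laurent_funs.add[OF add.IH] show ?case unfolding distrib_left .
  qed
next
  case (add u v)
  from laurent_funs.add[OF add.IH] show ?case unfolding distrib_right .
qed

lemma laurent_funs_const:
  assumes "function_algebra F"
  shows "(\<lambda>_. h) \<in> laurent_funs F"
  using laurent_funs.base[OF function_algebraD(1)[OF assms, of 1], of h] by simp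

lemma laurent_funs_sum:
  assumes "function_algebra F" "\<And>i. i \<in> S \<Longrightarrow> u i \<in> laurent_funs F"
  shows "(\<lambda>x. \<Sum>i\<in>S. u i x) \<in> laurent_funs F"
  using assms(2)
  by (induction S rule: infinite_finite_induct)
     (auto intro: laurent_funs.add laurent_funs_const[OF assms(1)])

lemma laurent_funs_prod:
  assumes "function_algebra F" "\<And>i. i \<in> S \<Longrightarrow> u i \<in> laurent_funs F"
  shows "(\<lambda>x. \<Prod>i\<in>S. u i x) \<in> laurent_funs F"
  using assms(2)
  by (induction S rule: infinite_finite_induct)
     (auto intro: laurent_funs_mult[OF assms(1)] laurent_funs_const[OF assms(1)])

lemma laurent_funs_det:
  assumes F: "function_algebra F"
    and u: "\<And>i j. i < s \<Longrightarrow> j < s \<Longrightarrow> u i j \<in> laurent_funs F"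
  shows "(\<lambda>x. det (mat s s (\<lambda>(i, j). u i j x))) \<in> laurent_funs F"
proof -
  have "(\<lambda>x. \<Sum>p\<in>{p. p permutes {0..<s}}. signof p * (\<Prod>i\<in>{0..<s}. if i < s \<and> p i < s then u i (p i) x else 0))
      \<in> laurent_funs F"
    using u laurent_funs_const[OF F, of 0]
    by (intro laurent_funs_sum laurent_funs_mult laurent_funs_prod F laurent_funs_const) auto
  moreover have "det (mat s s (\<lambda>(i, j). u i j x)) =
     (\<Sum>p\<in>{p. p permutes {0..<s}}. signof p * (\<Prod>i\<in>{0..<s}. if i < s \<and> p i < s then u i (p i) x else 0))" for x
    by (subst det_def'[of _ s])
       (auto intro!: sum.cong prod.cong simp: permutes_in_image[of _ "{0..<s}", simplified])
  ultimately show ?thesis by simp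
qed

lemma laurent_funs_nth:
  assumes F: "function_algebra F" and u: "u \<in> laurent_funs F"
  shows "(\<lambda>x. fls_nth (u x) m) \<in> F"
  using u
proof induction
  case (base f h)
  show ?case using function_algebraD(3)[OF F function_algebraD(1)[OF F, of "fls_nth h m"] base] by simp
next
  case (add u v)
  then show ?case by (simp add: function_algebraD(2)[OF F])
qed

lemma mpow_poly_funs:
  assumes "r < n" "c < n"
  shows "(\<lambda>A. mpow n A N r c) \<in> poly_funs n"
  using assms
proof (induction N arbitrary: c)
  case 0 show ?case by (auto intro: poly_funs.const)
next
  case (Suc N)
  then show ?case
    by (auto intro!: function_algebra_sum[OF function_algebra_poly_funs] poly_funs.mult poly_funs.entry)
qed

lemma det_sandwich_resolvent_laurent_funs:
  "(\<lambda>A. det (sandwich n s C (resolvent n A) D)) \<in> laurent_funs (poly_funs n)"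
  unfolding sandwich_def resolvent_def
  by (intro laurent_funs_det laurent_funs_sum laurent_funs_mult laurent_funs_const
      function_algebra_poly_funs laurent_funs.base mpow_poly_funs) auto

text \<open>The polynomial is the leading coefficient of a determinant whose pole at \<open>A\<close> has the maximal order: where it
  does not vanish, the pole is at least as large.\<close>

lemma jordan_type_semicontinuous:
  fixes A :: "'a :: field mat"
  assumes A: "A \<in> carrier_mat n n" and q: "has_jordan_type A q"
  shows "\<exists>f\<in>poly_funs n. f A \<noteq> 0 \<and> (\<forall>A' q'. A' \<in> carrier_mat n n \<longrightarrow> has_jordan_type A' q' \<longrightarrow>
     f A' \<noteq> 0 \<longrightarrow> sum_list (take s q) \<le> sum_list (take s q'))"
proof -
  \<comment> \<open>There may be fewer than \<open>s\<close> blocks; then all of them are used.\<close>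
  define s' where "s' = min s (length q)"
  define d where "d = sum_list (take s q)"
  have d: "d = sum_list (take s' q)" unfolding d_def s'_def by (simp add: min_def)
  obtain C D where CD: "\<And>i j. pole_le 0 (C i j)" "\<And>i j. pole_le 0 (D i j)"
    and det: "det (sandwich n s' C (resolvent n A) D) = fls_X_inv ^ d"
    using exists_sandwich_with_pole[OF A q, of s'] unfolding d s'_def by auto
  let ?f = "\<lambda>A. fls_nth (det (sandwich n s' C (resolvent n A) D)) (- int d)"
  have f1: "?f \<in> poly_funs n"
    by (rule laurent_funs_nth[OF function_algebra_poly_funs det_sandwich_resolvent_laurent_funs])
  have f2: "?f A \<noteq> 0" unfolding det by simp
  have f3: "sum_list (take s q) \<le> sum_list (take s q')"
    if "A' \<in> carrier_mat n n" "has_jordan_type A' q'" "?f A' \<noteq> 0" for A' q'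
  proof -
    have "d \<le> sum_list (take s' q')"
      using pole_le_det_sandwich_resolvent[OF that(1,2) CD, of s'] that(3)
      unfolding pole_le_def by force
    also have "take s' q' = take s' (take s q')" unfolding s'_def by simp
    also have "sum_list \<dots> \<le> sum_list (take s q')"
      using append_take_drop_id[of s' "take s q'"] by (metis le_add1 sum_list_append)
    finally show ?thesis unfolding d_def .
  qed
  show ?thesis by (rule bexI[OF _ f1]) (intro conjI allI impI f2 f3)
qed

section \<open>The commutant of \<open>B\<close>\<close>

definition idx :: "nat list \<Rightarrow> vertex \<Rightarrow> nat" where
  "idx P b = inv_into {..<sum_list P} (nth (vertex_list P)) b"

text \<open>The coefficient of \<open>A(b)\<close> on \<open>b'\<close>.\<close>

definition coef :: "nat list \<Rightarrow> 'a mat \<Rightarrow> vertex \<Rightarrow> vertex \<Rightarrow> 'a" where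
  "coef P A b b' = A $$ (idx P b', idx P b)"

lemma bij_vertex_list: "bij_betw (nth (vertex_list P)) {..<sum_list P} (vertices P)"
  by (rule bij_betw_nth[OF distinct_vertex_list]) (simp_all only: length_vertex_list set_vertex_list)

lemma idx_less: "b \<in> vertices P \<Longrightarrow> idx P b < sum_list P"
  using inv_into_into[of b "nth (vertex_list P)" "{..<sum_list P}"]
  unfolding idx_def bij_betw_imp_surj_on[OF bij_vertex_list] by simp

lemma nth_idx: "b \<in> vertices P \<Longrightarrow> vertex_list P ! idx P b = b"
  using f_inv_into_f[of b "nth (vertex_list P)" "{..<sum_list P}"]
  unfolding idx_def bij_betw_imp_surj_on[OF bij_vertex_list] by simp

lemma idx_nth: "r < sum_list P \<Longrightarrow> idx P (vertex_list P ! r) = r"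
  using inv_into_f_f[OF bij_betw_imp_inj_on[OF bij_vertex_list], of r P]
  unfolding idx_def by simp

lemma nth_in_vertices: "r < sum_list P \<Longrightarrow> vertex_list P ! r \<in> vertices P"
  using bij_betwE[OF bij_vertex_list] by blast

lemma sum_index_vertices: "(\<Sum>r<sum_list P. f r) = (\<Sum>b\<in>vertices P. f (idx P b))"
  by (rule sum.reindex_bij_witness[of _ "idx P" "nth (vertex_list P)"])
     (auto simp: idx_less nth_idx idx_nth nth_in_vertices)

lemma finite_vertices: "finite (vertices P)"
  using bij_betw_finite[OF bij_vertex_list, of P] by simp

lemma coef_nth: "r < sum_list P \<Longrightarrow> c < sum_list P \<Longrightarrow>
    coef P A (vertex_list P ! c) (vertex_list P ! r) = A $$ (r, c)"
  unfolding coef_def by (simp add: idx_nth)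

lemma coef_endo_mat: "b \<in> vertices P \<Longrightarrow> b' \<in> vertices P \<Longrightarrow> coef P (endo_mat P f) b b' = f b b'"
  unfolding coef_def endo_mat_def by (simp add: idx_less nth_idx)

lemma endo_mat_carrier: "endo_mat P f \<in> carrier_mat (sum_list P) (sum_list P)"
  unfolding endo_mat_def by simp

lemma coef_eqI:
  assumes "A \<in> carrier_mat (sum_list P) (sum_list P)" "C \<in> carrier_mat (sum_list P) (sum_list P)"
    and "\<And>b b'. b \<in> vertices P \<Longrightarrow> b' \<in> vertices P \<Longrightarrow> coef P A b b' = coef P C b b'"
  shows "A = C"
proof (rule eq_matI)
  fix r c assume "r < dim_row C" "c < dim_col C"
  then have rc: "r < sum_list P" "c < sum_list P" using assms(2) by auto
  show "A $$ (r, c) = C $$ (r, c)"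
    using assms(3)[OF nth_in_vertices[OF rc(2)] nth_in_vertices[OF rc(1)]]
    unfolding coef_nth[OF rc] .
qed (use assms in auto)

lemma coef_mult:
  assumes "A \<in> carrier_mat (sum_list P) (sum_list P)" "C \<in> carrier_mat (sum_list P) (sum_list P)"
    and "b \<in> vertices P" "b' \<in> vertices P"
  shows "coef P (A * C) b b' = (\<Sum>c\<in>vertices P. coef P C b c * coef P A c b' :: 'a :: comm_semiring_0)"
proof -
  have "coef P (A * C) b b' = (\<Sum>k<sum_list P. A $$ (idx P b', k) * C $$ (k, idx P b))"
    unfolding coef_def using assms idx_less by (simp add: scalar_prod_def lessThan_atLeast0)
  then show ?thesis unfolding sum_index_vertices coef_def by (simp add: mult.commute)
qed

lemma B_mat_carrier: "B_mat P \<in> carrier_mat (sum_list P) (sum_list P)"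
  unfolding B_mat_def by (rule endo_mat_carrier)

lemma coef_mult_B_mat:
  fixes A :: "'a :: field mat"
  assumes A: "A \<in> carrier_mat (sum_list P) (sum_list P)"
    and b: "(u, i, k) \<in> vertices P" and b': "b' \<in> vertices P"
  shows "coef P (A * B_mat P) (u, i, k) b' = (if u < i then coef P A (u + 1, i, k) b' else 0)"
proof -
  have "coef P (A * B_mat P) (u, i, k) b' =
     (\<Sum>c\<in>vertices P. if c = (u + 1, i, k) then if u < i then coef P A c b' else 0 else 0)"
    unfolding coef_mult[OF A B_mat_carrier b b']
    by (intro sum.cong refl) (auto simp: B_mat_def coef_endo_mat b elem_coeff_def B_map_def)
  also have "\<dots> = (if u < i then coef P A (u + 1, i, k) b' else 0)"
  proof -
    have "u < i \<Longrightarrow> (u + 1, i, k) \<in> vertices P" using b by (simp add: vertices_def)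
    then show ?thesis by (simp add: sum.delta[OF finite_vertices])
  qed
  finally show ?thesis .
qed

lemma coef_B_mat_mult:
  fixes A :: "'a :: field mat"
  assumes A: "A \<in> carrier_mat (sum_list P) (sum_list P)"
    and b: "b \<in> vertices P" and b': "(u, i, k) \<in> vertices P"
  shows "coef P (B_mat P * A) b (u, i, k) = (if 1 < u then coef P A b (u - 1, i, k) else 0)"
proof -
  have "coef P (B_mat P * A) b (u, i, k) =
     (\<Sum>c\<in>vertices P. if c = (u - 1, i, k) then if 1 < u then coef P A b c else 0 else 0)"
    unfolding coef_mult[OF B_mat_carrier A b b']
    using b' by (intro sum.cong refl)
      (auto simp: B_mat_def coef_endo_mat b' elem_coeff_def B_map_def vertices_def split: if_splits)
  also have "\<dots> = (if 1 < u then coef P A b (u - 1, i, k) else 0)"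
  proof -
    have "1 < u \<Longrightarrow> (u - 1, i, k) \<in> vertices P" using b' by (auto simp: vertices_def)
    then show ?thesis by (simp add: sum.delta[OF finite_vertices])
  qed
  finally show ?thesis .
qed

lemma commutes_B_iff:
  fixes A :: "'a :: field mat"
  assumes A: "A \<in> carrier_mat (sum_list P) (sum_list P)"
  shows "A * B_mat P = B_mat P * A \<longleftrightarrow>
    (\<forall>u i k u' j k'. (u, i, k) \<in> vertices P \<longrightarrow> (u', j, k') \<in> vertices P \<longrightarrow>
       (if u < i then coef P A (u + 1, i, k) (u', j, k') else 0) =
       (if 1 < u' then coef P A (u, i, k) (u' - 1, j, k') else 0))" (is "_ \<longleftrightarrow> ?R")
proof
  assume "A * B_mat P = B_mat P * A"
  then show ?R using coef_mult_B_mat[OF A] coef_B_mat_mult[OF A] by metis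
next
  assume R: ?R
  show "A * B_mat P = B_mat P * A"
  proof (rule coef_eqI)
    fix b b' assume b: "b \<in> vertices P" "b' \<in> vertices P"
    obtain u i k u' j k' where e: "b = (u, i, k)" "b' = (u', j, k')" by (metis prod_cases3)
    show "coef P (A * B_mat P) b b' = coef P (B_mat P * A) b b'"
      using R b coef_mult_B_mat[OF A] coef_B_mat_mult[OF A] unfolding e by metis
  qed (rule mult_carrier_mat[OF A B_mat_carrier] mult_carrier_mat[OF B_mat_carrier A])+
qed

lemma commutes_B_shift:
  fixes A :: "'a :: field mat"
  assumes A: "A \<in> carrier_mat (sum_list P) (sum_list P)" and c: "A * B_mat P = B_mat P * A"
    and v: "(u, i, k) \<in> vertices P" "(u', j, k') \<in> vertices P" "u < i" "u' < j"
  shows "coef P A (u + 1, i, k) (u' + 1, j, k') = coef P A (u, i, k) (u', j, k')"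
proof -
  have "(u' + 1, j, k') \<in> vertices P" using v by (auto simp: vertices_def)
  from c[unfolded commutes_B_iff[OF A], rule_format, OF v(1) this] v show ?thesis
    by (auto simp: vertices_def)
qed

text \<open>The vertex \<open>(u, i, k)\<close> lies in the image of the power \<open>u - 1\<close> and in the kernel of the power \<open>i - u + 1\<close>
  of \<open>B\<close>, and these subspaces are preserved by an endomorphism that commutes with \<open>B\<close>.\<close>

lemma commutes_B_preserves_images:
  fixes A :: "'a :: field mat"
  assumes A: "A \<in> carrier_mat (sum_list P) (sum_list P)" and c: "A * B_mat P = B_mat P * A"
    and v: "(u, i, k) \<in> vertices P" "(u', j, k') \<in> vertices P" "u' < u"
  shows "coef P A (u, i, k) (u', j, k') = 0"
  using v
proof (induction u' arbitrary: u)
  case 0 then show ?case by (simp add: vertices_def)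
next
  case (Suc w)
  then obtain t where t: "u = Suc t" by (cases u) auto
  have vt: "(t, i, k) \<in> vertices P" "t < i" using Suc.prems t by (auto simp: vertices_def)
  show ?case
  proof (cases "w = 0")
    case True
    from c[unfolded commutes_B_iff[OF A], rule_format, OF vt(1) Suc.prems(2)] vt(2) True t show ?thesis by simp
  next
    case False
    have vw: "(w, j, k') \<in> vertices P" "w < j" using Suc.prems False by (auto simp: vertices_def)
    have "coef P A (t + 1, i, k) (w + 1, j, k') = coef P A (t, i, k) (w, j, k')"
      by (rule commutes_B_shift[OF A c vt(1) vw(1) vt(2) vw(2)])
    also have "\<dots> = 0" using Suc.IH[OF vt(1) vw(1)] Suc.prems(3) t by simp
    finally show ?thesis using t by simp
  qed
qed

lemma commutes_B_preserves_kernels: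
  fixes A :: "'a :: field mat"
  assumes A: "A \<in> carrier_mat (sum_list P) (sum_list P)" and c: "A * B_mat P = B_mat P * A"
    and v: "(u, i, k) \<in> vertices P" "(u', j, k') \<in> vertices P" "i + u' < j + u"
  shows "coef P A (u, i, k) (u', j, k') = 0"
  using v
proof (induction "i - u" arbitrary: u u')
  case 0
  then have ui: "u = i" "u' < j" by (auto simp: vertices_def)
  then have "(u' + 1, j, k') \<in> vertices P" using 0 by (auto simp: vertices_def)
  from c[unfolded commutes_B_iff[OF A], rule_format, OF 0(2) this] ui 0 show ?case by (auto simp: vertices_def)
next
  case (Suc d)
  then have ui: "u < i" "u' < j" by (auto simp: vertices_def)
  have v': "(u + 1, i, k) \<in> vertices P" "(u' + 1, j, k') \<in> vertices P"
    using Suc.prems ui by (auto simp: vertices_def)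
  have "coef P A (u + 1, i, k) (u' + 1, j, k') = 0"
    using Suc.hyps(2) Suc.prems(3) by (intro Suc.hyps(1) v') auto
  then show ?case using commutes_B_shift[OF A c Suc.prems(1,2) ui] by simp
qed

section \<open>The linear space \<open>U\<^sub>B\<close>\<close>

text \<open>The lexicographic order by \<open>2 u - i\<close> and then by \<open>k\<close>, encoded in one natural number. Commuting with \<open>B\<close>
  makes \<open>u\<close> and \<open>u - i\<close> increase weakly, so \<open>2 u - i\<close> stays the same only from \<open>(u, i, k)\<close> to some \<open>(u, i, k')\<close>.\<close>

definition weight :: "nat list \<Rightarrow> vertex \<Rightarrow> nat" where
  "weight P = (\<lambda>(u, i, k). (2 * u + (sum_list P - i)) * (length P + 1) + k)"

text \<open>The condition that singles out \<open>U\<^sub>B\<close> in \<open>N\<^sub>B\<close>, without reference to the enumeration of the basis.\<close>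

definition diagonal_free :: "nat list \<Rightarrow> 'a :: zero mat \<Rightarrow> bool" where
  "diagonal_free P C \<longleftrightarrow> (\<forall>i k k'. (1, i, k) \<in> vertices P \<longrightarrow> (1, i, k') \<in> vertices P \<longrightarrow> k' \<le> k \<longrightarrow>
     coef P C (1, i, k) (1, i, k') = 0)"

lemma vertex_bounds:
  assumes "(u, i, k) \<in> vertices P"
  shows "1 \<le> u" "u \<le> i" "i \<le> sum_list P" "1 \<le> k" "k \<le> length P"
proof -
  from assms have "i \<in> set P" "1 \<le> u" "u \<le> i" "1 \<le> k" "k \<le> count_list P i" by (auto simp: vertices_def)
  then show "1 \<le> u" "u \<le> i" "i \<le> sum_list P" "1 \<le> k" "k \<le> length P"
    using member_le_sum_list[of i P] count_le_length[of P i] by auto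
qed

text \<open>Elements of \<open>U\<^sub>B\<close> are strictly triangular in the order of the weights. By invariance under shifts, an entry
  from \<open>(u, i, k)\<close> to \<open>(u, i, k')\<close> equals the one for \<open>u = 1\<close>, which vanishes for \<open>k' \<le> k\<close>.\<close>

lemma coef_nonzero_weight:
  fixes C :: "'a :: field mat"
  assumes C: "C \<in> carrier_mat (sum_list P) (sum_list P)" and c: "C * B_mat P = B_mat P * C"
    and d: "diagonal_free P C"
    and b: "b \<in> vertices P" "b' \<in> vertices P" and nz: "coef P C b b' \<noteq> 0"
  shows "weight P b < weight P b'"
proof -
  obtain u i k u' j k' where e: "b = (u, i, k)" "b' = (u', j, k')" by (metis prod_cases3)
  note v = b[unfolded e]
  have le: "u \<le> u'" "j + u \<le> i + u'"
    using commutes_B_preserves_images[OF C c v] commutes_B_preserves_kernels[OF C c v] nz[unfolded e] by force+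
  note bd = vertex_bounds[OF v(1)] vertex_bounds[OF v(2)]
  show ?thesis
  proof (cases "u = u' \<and> i = j")
    case True
    have shift: "coef P C (u, i, k) (u, i, k') = coef P C (1, i, k) (1, i, k')"
      if "(u, i, k) \<in> vertices P" "(u, i, k') \<in> vertices P" for u
      using that
    proof (induction u)
      case (Suc t)
      show ?case
      proof (cases "t = 0")
        case False
        then have vt: "(t, i, k) \<in> vertices P" "(t, i, k') \<in> vertices P" "t < i"
          using Suc.prems by (auto simp: vertices_def)
        show ?thesis using commutes_B_shift[OF C c vt(1,2) vt(3) vt(3)] Suc.IH[OF vt(1,2)] by simp
      qed simp
    qed (simp add: vertices_def)
    have "(1, i, k) \<in> vertices P" "(1, i, k') \<in> vertices P" using v True by (auto simp: vertices_def)
    then have "k < k'" using nz d shift[of u] v True unfolding e diagonal_free_def by (metis not_le)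
    then show ?thesis unfolding e weight_def using True by simp
  next
    case False
    then have "2 * u + (sum_list P - i) < 2 * u' + (sum_list P - j)" using le bd by auto
    then have "Suc (2 * u + (sum_list P - i)) * (length P + 1) \<le> (2 * u' + (sum_list P - j)) * (length P + 1)"
      by (intro mult_le_mono1) simp
    then show ?thesis unfolding e weight_def using bd by simp
  qed
qed

lemma commutes_diagonal_free_nilpotent:
  fixes C :: "'a :: field mat"
  assumes C: "C \<in> carrier_mat (sum_list P) (sum_list P)" and c: "C * B_mat P = B_mat P * C"
    and d: "diagonal_free P C"
  shows "\<exists>m. C ^\<^sub>m m = 0\<^sub>m (sum_list P) (sum_list P)"
proof -
  have pow: "coef P (C ^\<^sub>m m) b b' \<noteq> 0 \<Longrightarrow> weight P b + m \<le> weight P b'"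
    if "b \<in> vertices P" "b' \<in> vertices P" for m b b'
    using that
  proof (induction m arbitrary: b)
    case 0
    then have "b = b'" using C idx_less nth_idx unfolding coef_def
      by (metis (full_types) carrier_matD(1) index_one_mat(1) pow_mat.simps(1))
    then show ?case by simp
  next
    case (Suc m)
    have Cm: "C ^\<^sub>m m \<in> carrier_mat (sum_list P) (sum_list P)" using C by simp
    from Suc.prems have "(\<Sum>c\<in>vertices P. coef P C b c * coef P (C ^\<^sub>m m) c b') \<noteq> 0"
      unfolding pow_mat.simps using coef_mult[OF Cm C] by metis
    then obtain c where "c \<in> vertices P" "coef P C b c \<noteq> 0" "coef P (C ^\<^sub>m m) c b' \<noteq> 0"
      by (metis (no_types, lifting) mult_eq_0_iff sum.neutral)
    then show ?case
      using Suc.IH[of c] Suc.prems coef_nonzero_weight[OF C assms(2) d, of b c] by fastforce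
  qed
  obtain N where N: "weight P b < N" if "b \<in> vertices P" for b
    using finite_imageI[OF finite_vertices, of "weight P" P]
    by (metis finite_nat_set_iff_bounded imageI)
  have "C ^\<^sub>m N = 0\<^sub>m (sum_list P) (sum_list P)"
  proof (rule coef_eqI)
    fix b b' assume b: "b \<in> vertices P" "b' \<in> vertices P"
    have "coef P (C ^\<^sub>m N) b b' = 0" using pow[OF b, of N] N[OF b(2)] by linarith
    then show "coef P (C ^\<^sub>m N) b b' = coef P (0\<^sub>m (sum_list P) (sum_list P)) b b'"
      unfolding coef_def using b idx_less by simp
  qed (use C in auto)
  then show ?thesis by blast
qed

text \<open>Nilpotency is automatic, so that \<open>U\<^sub>B\<close> is cut out by linear conditions.\<close>

lemma U_B_iff:
  "C \<in> U_B P \<longleftrightarrow> C \<in> carrier_mat (sum_list P) (sum_list P) \<and> C * B_mat P = B_mat P * C \<and>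
     diagonal_free P (C :: 'a :: field mat)"
proof -
  have "(\<forall>r < sum_list P. \<forall>c < sum_list P. \<forall>i k k'.
     vertex_list P ! c = (1, i, k) \<and> vertex_list P ! r = (1, i, k') \<and> k' \<le> k \<longrightarrow> C $$ (r, c) = 0)
    \<longleftrightarrow> diagonal_free P C" (is "?L = ?R")
  proof
    assume ?L
    then show ?R unfolding diagonal_free_def coef_def using idx_less nth_idx by metis
  next
    assume ?R
    then show ?L unfolding diagonal_free_def using coef_nth nth_in_vertices by metis
  qed
  then show ?thesis unfolding U_B_def N_B_def
    using commutes_diagonal_free_nilpotent[of C P] by blast
qed

lemma coef_line:
  assumes "C \<in> carrier_mat (sum_list P) (sum_list P)" "D \<in> carrier_mat (sum_list P) (sum_list P)"
    and "b \<in> vertices P" "b' \<in> vertices P"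
  shows "coef P (a \<cdot>\<^sub>m C + c \<cdot>\<^sub>m D) b b' = a * coef P C b b' + c * coef P D b b'"
  unfolding coef_def using assms idx_less by simp

lemma U_B_line:
  fixes C D :: "'a :: field mat"
  assumes C: "C \<in> U_B P" and D: "D \<in> U_B P"
  shows "a \<cdot>\<^sub>m C + c \<cdot>\<^sub>m D \<in> U_B P"
proof -
  have carr: "C \<in> carrier_mat (sum_list P) (sum_list P)" "D \<in> carrier_mat (sum_list P) (sum_list P)"
    using C D unfolding U_B_iff by auto
  then have carr2: "a \<cdot>\<^sub>m C + c \<cdot>\<^sub>m D \<in> carrier_mat (sum_list P) (sum_list P)" by simp
  have "(a \<cdot>\<^sub>m C + c \<cdot>\<^sub>m D) * B_mat P = B_mat P * (a \<cdot>\<^sub>m C + c \<cdot>\<^sub>m D)"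
  proof -
    note B = B_mat_carrier[of P, where ?'a = 'a]
    have "(a \<cdot>\<^sub>m C + c \<cdot>\<^sub>m D) * B_mat P = a \<cdot>\<^sub>m (C * B_mat P) + c \<cdot>\<^sub>m (D * B_mat P)"
      using carr B by (subst add_mult_distrib_mat[of _ "sum_list P" "sum_list P"]) auto
    also have "\<dots> = a \<cdot>\<^sub>m (B_mat P * C) + c \<cdot>\<^sub>m (B_mat P * D)" using C D unfolding U_B_iff by simp
    also have "\<dots> = B_mat P * (a \<cdot>\<^sub>m C + c \<cdot>\<^sub>m D)"
      using carr B by (subst mult_add_distrib_mat[of _ "sum_list P" "sum_list P"]) auto
    finally show ?thesis .
  qed
  moreover have "diagonal_free P (a \<cdot>\<^sub>m C + c \<cdot>\<^sub>m D)"
    using C D coef_line[OF carr] unfolding U_B_iff diagonal_free_def by simp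
  ultimately show ?thesis unfolding U_B_iff using carr2 by blast
qed

section \<open>Every element of \<open>N\<^sub>B\<close> is conjugate to one of \<open>U\<^sub>B\<close>\<close>

text \<open>The action on the span of the vertices \<open>(1, i, k)\<close> modulo the other vertices.\<close>

definition head_block :: "nat list \<Rightarrow> nat \<Rightarrow> 'a mat \<Rightarrow> 'a mat" where
  "head_block P i A = mat (count_list P i) (count_list P i) (\<lambda>(r, c). coef P A (1, i, Suc c) (1, i, Suc r))"

lemma head_block_carrier: "head_block P i A \<in> carrier_mat (count_list P i) (count_list P i)"
  unfolding head_block_def by simp

lemma head_vertex:
  assumes "i \<in> set P" "0 \<notin> set P" "k < count_list P i"
  shows "(1, i, Suc k) \<in> vertices P"
proof -
  have "i \<noteq> 0" using assms(1,2) by metis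
  then have "1 \<le> i" by simp
  then show ?thesis using assms by (simp add: vertices_def)
qed

text \<open>A path from \<open>(1, i, _)\<close> back to \<open>(1, i, _)\<close> cannot leave the vertices of this form, because images
  and kernels of powers of \<open>B\<close> are preserved.\<close>

lemma head_block_mult:
  fixes A C :: "'a :: field mat"
  assumes A: "A \<in> carrier_mat (sum_list P) (sum_list P)" "A * B_mat P = B_mat P * A"
    and C: "C \<in> carrier_mat (sum_list P) (sum_list P)" "C * B_mat P = B_mat P * C"
    and i: "i \<in> set P" "0 \<notin> set P"
  shows "head_block P i (A * C) = head_block P i A * head_block P i C"
proof (rule eq_matI)
  let ?n = "count_list P i"
  fix r c assume "r < dim_row (head_block P i A * head_block P i C)" "c < dim_col (head_block P i A * head_block P i C)"
  then have rc: "r < ?n" "c < ?n" by (auto simp: head_block_def)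
  have hv: "(1, i, Suc k) \<in> vertices P" if "k < ?n" for k
    by (rule head_vertex[OF i that])
  let ?f = "\<lambda>k. (1, i, Suc k) :: vertex"
  have "coef P (A * C) (1, i, Suc c) (1, i, Suc r) =
      (\<Sum>v\<in>vertices P. coef P C (1, i, Suc c) v * coef P A v (1, i, Suc r))"
    by (rule coef_mult[OF A(1) C(1) hv[OF rc(2)] hv[OF rc(1)]])
  also have "\<dots> = (\<Sum>v\<in>?f ` {..<?n}. coef P C (1, i, Suc c) v * coef P A v (1, i, Suc r))"
  proof (rule sum.mono_neutral_right[OF finite_vertices])
    show "?f ` {..<?n} \<subseteq> vertices P" using hv by auto
    show "\<forall>v\<in>vertices P - ?f ` {..<?n}. coef P C (1, i, Suc c) v * coef P A v (1, i, Suc r) = 0"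
    proof
      fix v assume v: "v \<in> vertices P - ?f ` {..<?n}"
      obtain u j k where e: "v = (u, j, k)" by (metis prod_cases3)
      have vv: "(u, j, k) \<in> vertices P" using v e by simp
      have "u \<noteq> 1 \<or> j \<noteq> i"
      proof (rule ccontr)
        assume "\<not> (u \<noteq> 1 \<or> j \<noteq> i)"
        then have "v = ?f (k - 1)" "k - 1 < ?n" using vv e by (auto simp: vertices_def)
        then show False using v by blast
      qed
      then consider "1 < u" | "u = 1" "i < j" | "u = 1" "j < i"
        using vv by (auto simp: vertices_def) linarith
      then show "coef P C (1, i, Suc c) v * coef P A v (1, i, Suc r) = 0"
      proof cases
        case 1
        then show ?thesis unfolding e using commutes_B_preserves_images[OF A vv hv[OF rc(1)]] by simp
      next
        case 2
        then show ?thesis unfolding e using commutes_B_preserves_kernels[OF C hv[OF rc(2)] vv] by simp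
      next
        case 3
        then show ?thesis unfolding e using commutes_B_preserves_kernels[OF A vv hv[OF rc(1)]] by simp
      qed
    qed
  qed
  also have "\<dots> = (\<Sum>k<?n. coef P C (1, i, Suc c) (?f k) * coef P A (?f k) (1, i, Suc r))"
    by (subst sum.reindex) (auto simp: inj_on_def)
  finally show "head_block P i (A * C) $$ (r, c) = (head_block P i A * head_block P i C) $$ (r, c)"
    using rc by (simp add: head_block_def scalar_prod_def lessThan_atLeast0 mult.commute)
qed (auto simp: head_block_def)

lemma head_block_one:
  assumes i: "i \<in> set P" "0 \<notin> set P"
  shows "head_block P i (1\<^sub>m (sum_list P) :: 'a :: field mat) = 1\<^sub>m (count_list P i)"
proof (rule eq_matI)
  let ?n = "count_list P i"
  fix r c assume "r < dim_row (1\<^sub>m ?n :: 'a mat)" "c < dim_col (1\<^sub>m ?n :: 'a mat)"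
  then have rc: "r < ?n" "c < ?n" by auto
  have hv: "(1, i, Suc k) \<in> vertices P" if "k < ?n" for k
    by (rule head_vertex[OF i that])
  have "idx P (1, i, Suc r) = idx P (1, i, Suc c) \<longleftrightarrow> r = c"
    using nth_idx[OF hv[OF rc(1)]] nth_idx[OF hv[OF rc(2)]] by (metis Pair_inject nat.inject)
  then show "head_block P i (1\<^sub>m (sum_list P) :: 'a mat) $$ (r, c) = 1\<^sub>m ?n $$ (r, c)"
    using rc idx_less[OF hv[OF rc(1)]] idx_less[OF hv[OF rc(2)]] by (simp add: head_block_def coef_def)
qed (auto simp: head_block_def)

lemma commute_pow_mat:
  assumes "A \<in> carrier_mat n n" "D \<in> carrier_mat n n" "A * D = D * (A :: 'a :: semiring_1 mat)"
  shows "A ^\<^sub>m m * D = D * A ^\<^sub>m m"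
proof (induction m)
  case 0 then show ?case using assms by simp
next
  case (Suc m)
  have Am: "A ^\<^sub>m m \<in> carrier_mat n n" using assms by simp
  have "A ^\<^sub>m m * A * D = A ^\<^sub>m m * (A * D)" by (rule assoc_mult_mat[OF Am assms(1,2)])
  also have "\<dots> = A ^\<^sub>m m * D * A" unfolding assms(3) by (rule assoc_mult_mat[OF Am assms(2,1), symmetric])
  also have "\<dots> = D * (A ^\<^sub>m m * A)" unfolding Suc by (rule assoc_mult_mat[OF assms(2) Am assms(1)])
  finally show ?case by simp
qed

lemma head_block_pow:
  fixes A :: "'a :: field mat"
  assumes A: "A \<in> carrier_mat (sum_list P) (sum_list P)" "A * B_mat P = B_mat P * A"
    and i: "i \<in> set P" "0 \<notin> set P"
  shows "head_block P i (A ^\<^sub>m m) = head_block P i A ^\<^sub>m m"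
proof (induction m)
  case 0
  have "dim_row A = sum_list P" "dim_row (head_block P i A) = count_list P i"
    using A head_block_carrier[of P i A] by auto
  then show ?case using head_block_one[OF i] by simp
next
  case (Suc m)
  have "A ^\<^sub>m m \<in> carrier_mat (sum_list P) (sum_list P)" using A by simp
  from head_block_mult[OF this commute_pow_mat[OF A(1) B_mat_carrier A(2)] A i] Suc
  show ?case by simp
qed

text \<open>The endomorphism of the module \<open>V = \<Oplus>\<^sub>i (k[B] / B\<^sup>i)\<^bsup>n(i)\<^esup>\<close> that acts on the generators of the \<open>i\<close>-th
  summand by \<open>G i\<close>.\<close>

definition block_scalar :: "nat list \<Rightarrow> (nat \<Rightarrow> 'a mat) \<Rightarrow> 'a :: zero mat" where
  "block_scalar P G = endo_mat P (\<lambda>(u, i, k) (u', j, k'). if u = u' \<and> i = j then G i $$ (k' - 1, k - 1) else 0)"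

lemma coef_block_scalar:
  assumes "(u, i, k) \<in> vertices P" "(u', j, k') \<in> vertices P"
  shows "coef P (block_scalar P G) (u, i, k) (u', j, k') = (if u = u' \<and> i = j then G i $$ (k' - 1, k - 1) else 0)"
  unfolding block_scalar_def coef_endo_mat[OF assms] by simp

lemma block_scalar_carrier: "block_scalar P G \<in> carrier_mat (sum_list P) (sum_list P)"
  unfolding block_scalar_def by (rule endo_mat_carrier)

lemma block_scalar_commutes:
  "block_scalar P G * B_mat P = B_mat P * (block_scalar P G :: 'a :: field mat)"
  unfolding commutes_B_iff[OF block_scalar_carrier]
proof (intro allI impI)
  fix u i k u' j k' assume v: "(u, i, k) \<in> vertices P" "(u', j, k') \<in> vertices P"
  have "coef P (block_scalar P G) (u + 1, i, k) (u', j, k') = (if u + 1 = u' \<and> i = j then G i $$ (k' - 1, k - 1) else 0)"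
    if "u < i" using v that by (intro coef_block_scalar) (auto simp: vertices_def)
  moreover have "coef P (block_scalar P G) (u, i, k) (u' - 1, j, k') = (if u = u' - 1 \<and> i = j then G i $$ (k' - 1, k - 1) else 0)"
    if "1 < u'" using v that by (intro coef_block_scalar) (auto simp: vertices_def)
  ultimately show "(if u < i then coef P (block_scalar P G) (u + 1, i, k) (u', j, k') else 0) =
    (if 1 < u' then coef P (block_scalar P G) (u, i, k) (u' - 1, j, k') else 0)"
    using v by (auto simp: vertices_def)
qed

lemma block_scalar_inverse:
  fixes G H :: "nat \<Rightarrow> 'a :: field mat"
  assumes GH: "\<And>i. i \<in> set P \<Longrightarrow> G i \<in> carrier_mat (count_list P i) (count_list P i)"
    "\<And>i. i \<in> set P \<Longrightarrow> H i \<in> carrier_mat (count_list P i) (count_list P i)"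
    "\<And>i. i \<in> set P \<Longrightarrow> G i * H i = 1\<^sub>m (count_list P i)"
  shows "block_scalar P G * block_scalar P H = 1\<^sub>m (sum_list P)"
proof (rule coef_eqI)
  fix b b' assume b: "b \<in> vertices P" "b' \<in> vertices P"
  obtain u i k u' j k' where e: "b = (u, i, k)" "b' = (u', j, k')" by (metis prod_cases3)
  note v = b[unfolded e]
  let ?n = "count_list P i"
  let ?f = "\<lambda>l. (u, i, Suc l) :: vertex"
  have i: "i \<in> set P" and k: "k - 1 < ?n" "1 \<le> k" using v by (auto simp: vertices_def)
  have fv: "?f ` {..<?n} \<subseteq> vertices P" using v by (auto simp: vertices_def)
  have "coef P (block_scalar P G * block_scalar P H) b b' =
     (\<Sum>c\<in>vertices P. coef P (block_scalar P H) b c * coef P (block_scalar P G) c b')"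
    by (rule coef_mult[OF block_scalar_carrier block_scalar_carrier b])
  also have "\<dots> = (\<Sum>c\<in>?f ` {..<?n}. coef P (block_scalar P H) b c * coef P (block_scalar P G) c b')"
  proof (rule sum.mono_neutral_right[OF finite_vertices fv], rule ballI)
    fix c assume c: "c \<in> vertices P - ?f ` {..<?n}"
    obtain w l m where ec: "c = (w, l, m)" by (metis prod_cases3)
    have "\<not> (u = w \<and> i = l)"
    proof
      assume "u = w \<and> i = l"
      then have "c = ?f (m - 1)" "m - 1 < ?n" using c ec by (auto simp: vertices_def)
      then show False using c by blast
    qed
    then show "coef P (block_scalar P H) b c * coef P (block_scalar P G) c b' = 0"
      using c v unfolding e ec by (subst coef_block_scalar) auto
  qed
  also have "\<dots> = (\<Sum>l<?n. coef P (block_scalar P H) b (?f l) * coef P (block_scalar P G) (?f l) b')"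
    by (subst sum.reindex) (auto simp: inj_on_def)
  also have "\<dots> = (\<Sum>l<?n. if u = u' \<and> i = j then G i $$ (k' - 1, l) * H i $$ (l, k - 1) else 0)"
    unfolding e using fv v by (intro sum.cong refl) (auto simp: coef_block_scalar image_subset_iff)
  also have "\<dots> = (if u = u' \<and> i = j then (G i * H i) $$ (k' - 1, k - 1) else 0)"
  proof -
    have "k' - 1 < ?n" if "i = j" using v that by (auto simp: vertices_def)
    then show ?thesis using GH(1,2)[OF i] k by (auto simp: scalar_prod_def lessThan_atLeast0)
  qed
  also have "\<dots> = (if b = b' then 1 else 0)"
  proof -
    have "k' - 1 < ?n" "1 \<le> k'" if "i = j" using v that by (auto simp: vertices_def)
    then show ?thesis using GH(3)[OF i] k unfolding e by auto
  qed
  also have "\<dots> = coef P (1\<^sub>m (sum_list P)) b b'"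
    unfolding coef_def using b idx_less nth_idx by (metis index_one_mat(1))
  finally show "coef P (block_scalar P G * block_scalar P H) b b' = coef P (1\<^sub>m (sum_list P)) b b'" .
next
  show "block_scalar P G * block_scalar P H \<in> carrier_mat (sum_list P) (sum_list P)"
    by (rule mult_carrier_mat[OF block_scalar_carrier block_scalar_carrier])
qed simp

lemma head_block_block_scalar:
  assumes "i \<in> set P" "0 \<notin> set P" "G i \<in> carrier_mat (count_list P i) (count_list P i)"
  shows "head_block P i (block_scalar P G) = G i"
proof (rule eq_matI)
  fix r c assume "r < dim_row (G i)" "c < dim_col (G i)"
  then have rc: "r < count_list P i" "c < count_list P i" using assms by auto
  then have "(1, i, Suc c) \<in> vertices P" "(1, i, Suc r) \<in> vertices P"
    using head_vertex[OF assms(1,2)] by simp_all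
  then show "head_block P i (block_scalar P G) $$ (r, c) = G i $$ (r, c)"
    using rc by (simp add: head_block_def coef_block_scalar)
qed (use assms in \<open>auto simp: head_block_def\<close>)

lemma commute_conjugate:
  fixes A D h g :: "'a :: semiring_1 mat"
  assumes c: "A \<in> carrier_mat n n" "D \<in> carrier_mat n n" "g \<in> carrier_mat n n" "h \<in> carrier_mat n n"
    and "A * D = D * A" "g * D = D * g" "h * D = D * h"
  shows "h * A * g * D = D * (h * A * g)"
proof -
  have hA: "h * A \<in> carrier_mat n n" using c by simp
  have "h * A * g * D = h * A * (g * D)" by (rule assoc_mult_mat[OF hA c(3,2)])
  also have "\<dots> = h * A * D * g" unfolding assms(6) by (rule assoc_mult_mat[OF hA c(2,3), symmetric])
  also have "h * A * D = h * (A * D)" by (rule assoc_mult_mat[OF c(4,1,2)])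
  also have "\<dots> = h * D * A" unfolding assms(5) by (rule assoc_mult_mat[OF c(4,2,1), symmetric])
  also have "\<dots> = D * (h * A)" unfolding assms(7) by (rule assoc_mult_mat[OF c(2,4,1)])
  also have "\<dots> * g = D * (h * A * g)" by (rule assoc_mult_mat[OF c(2) hA c(3)])
  finally show ?thesis .
qed

lemma regroup_mult_mat:
  fixes W X Y Z M :: "'a :: semiring_1 mat"
  assumes "W \<in> carrier_mat n n" "X \<in> carrier_mat n n" "M \<in> carrier_mat n n"
    "Y \<in> carrier_mat n n" "Z \<in> carrier_mat n n"
  shows "W * (X * M * Y) * Z = (W * X) * M * (Y * Z)"
proof -
  have XM: "X * M \<in> carrier_mat n n" and WX: "W * X \<in> carrier_mat n n" using assms by simp_all
  have "W * (X * M * Y) = W * (X * M) * Y" by (rule assoc_mult_mat[OF assms(1) XM assms(4), symmetric])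
  also have "W * (X * M) = W * X * M" by (rule assoc_mult_mat[OF assms(1,2,3), symmetric])
  finally have 1: "W * (X * M * Y) = W * X * M * Y" .
  show ?thesis unfolding 1 by (rule assoc_mult_mat[OF mult_carrier_mat[OF WX assms(3)] assms(4,5)])
qed

text \<open>Triangularise all the nilpotent blocks \<open>head_block P i A\<close> and conjugate by the corresponding
  automorphism of the \<open>k[B]\<close>-module: afterwards the blocks are strictly triangular, which is the condition for
  \<open>U\<^sub>B\<close>.\<close>

lemma N_B_conjugate_U_B:
  fixes A :: "'a :: field mat"
  assumes A: "A \<in> N_B P" and z: "0 \<notin> set P"
  obtains C g h where "C \<in> U_B P" "g \<in> carrier_mat (sum_list P) (sum_list P)"
    "h \<in> carrier_mat (sum_list P) (sum_list P)" "g * h = 1\<^sub>m (sum_list P)" "h * g = 1\<^sub>m (sum_list P)"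
    "g * B_mat P = B_mat P * g" "h * B_mat P = B_mat P * h" "A = g * C * h"
proof -
  let ?n = "sum_list P"
  from A obtain m where Ac: "A \<in> carrier_mat ?n ?n" "A * B_mat P = B_mat P * A" "A ^\<^sub>m m = 0\<^sub>m ?n ?n"
    unfolding N_B_def by blast
  have "\<exists>T G H. T \<in> carrier_mat (count_list P i) (count_list P i) \<and>
      G \<in> carrier_mat (count_list P i) (count_list P i) \<and> H \<in> carrier_mat (count_list P i) (count_list P i) \<and>
      G * H = 1\<^sub>m (count_list P i) \<and> H * G = 1\<^sub>m (count_list P i) \<and> head_block P i A = G * T * H \<and>
      (\<forall>c<count_list P i. \<forall>r\<le>c. T $$ (r, c) = 0)" if i: "i \<in> set P" for i
  proof -
    let ?k = "count_list P i"
    let ?M = "head_block P i A"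
    note M = head_block_carrier[of P i A]
    have pow: "?M ^\<^sub>m m = 0\<^sub>m ?k ?k"
    proof -
      have "?M ^\<^sub>m m = head_block P i (A ^\<^sub>m m)" by (rule head_block_pow[OF Ac(1,2) i z, symmetric])
      also have "\<dots> = 0\<^sub>m ?k ?k" unfolding Ac(3)
      proof (rule eq_matI)
        fix r c assume "r < dim_row (0\<^sub>m ?k ?k :: 'a mat)" "c < dim_col (0\<^sub>m ?k ?k :: 'a mat)"
        then have rc: "r < ?k" "c < ?k" by auto
        then have "(1, i, Suc c) \<in> vertices P" "(1, i, Suc r) \<in> vertices P"
          using head_vertex[OF i z] by simp_all
        then show "head_block P i (0\<^sub>m ?n ?n) $$ (r, c) = (0\<^sub>m ?k ?k :: 'a mat) $$ (r, c)"
          using rc by (simp add: head_block_def coef_def idx_less)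
      qed (auto simp: head_block_def)
      finally show ?thesis .
    qed
    have Mt: "?M\<^sup>T \<in> carrier_mat ?k ?k" using M by simp
    have tpow: "(?M\<^sup>T) ^\<^sub>m r = (?M ^\<^sub>m r)\<^sup>T" for r
    proof (induction r)
      case 0 then show ?case using M by simp
    next
      case (Suc r)
      have Mr: "?M ^\<^sub>m r \<in> carrier_mat ?k ?k" using M by simp
      have "?M ^\<^sub>m Suc r = ?M * ?M ^\<^sub>m r"
        using commute_pow_mat[OF M M refl, of r] by simp
      then show ?case using transpose_mult[OF M Mr] Suc by simp
    qed
    have "(?M\<^sup>T) ^\<^sub>m m = 0\<^sub>m ?k ?k" unfolding tpow pow by simp
    from nilpotent_similar_strictly_upper[OF Mt this] obtain T X Y where
      w: "similar_mat_wit (?M\<^sup>T) T X Y" and T: "T \<in> carrier_mat ?k ?k" "\<forall>i<?k. \<forall>j\<le>i. T $$ (i, j) = 0"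
      by blast
    note W = similar_mat_witD2[OF Mt w]
    have "?M = (X * T * Y)\<^sup>T" using W(3) by (metis transpose_transpose)
    also have "\<dots> = Y\<^sup>T * (T\<^sup>T * X\<^sup>T)"
      unfolding transpose_mult[OF mult_carrier_mat[OF W(6) T(1)] W(7)] transpose_mult[OF W(6) T(1)] ..
    also have "\<dots> = Y\<^sup>T * T\<^sup>T * X\<^sup>T" using W T by (intro assoc_mult_mat[symmetric]) auto
    finally have 1: "?M = Y\<^sup>T * T\<^sup>T * X\<^sup>T" .
    have 2: "Y\<^sup>T * X\<^sup>T = 1\<^sub>m ?k" "X\<^sup>T * Y\<^sup>T = 1\<^sub>m ?k"
      unfolding transpose_mult[OF W(6,7), symmetric] transpose_mult[OF W(7,6), symmetric] W(1,2) by simp_all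
    show ?thesis
      using 1 2 T W(6,7) by (intro exI[of _ "T\<^sup>T"] exI[of _ "Y\<^sup>T"] exI[of _ "X\<^sup>T"]) auto
  qed
  then obtain T G H where TGH: "\<And>i. i \<in> set P \<Longrightarrow> T i \<in> carrier_mat (count_list P i) (count_list P i) \<and>
      G i \<in> carrier_mat (count_list P i) (count_list P i) \<and> H i \<in> carrier_mat (count_list P i) (count_list P i) \<and>
      G i * H i = 1\<^sub>m (count_list P i) \<and> H i * G i = 1\<^sub>m (count_list P i) \<and> head_block P i A = G i * T i * H i \<and>
      (\<forall>c<count_list P i. \<forall>r\<le>c. T i $$ (r, c) = 0)"
    by metis
  define g where "g = block_scalar P G"
  define h where "h = block_scalar P H"
  have g: "g \<in> carrier_mat ?n ?n" "g * B_mat P = B_mat P * g"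
    and h: "h \<in> carrier_mat ?n ?n" "h * B_mat P = B_mat P * h"
    unfolding g_def h_def by (rule block_scalar_carrier block_scalar_commutes)+
  have gh: "g * h = 1\<^sub>m ?n" unfolding g_def h_def using TGH by (intro block_scalar_inverse) auto
  have hg: "h * g = 1\<^sub>m ?n" unfolding g_def h_def using TGH by (intro block_scalar_inverse) auto
  define C where "C = h * A * g"
  have C: "C \<in> carrier_mat ?n ?n" unfolding C_def using g h Ac by simp
  have hA: "h * A \<in> carrier_mat ?n ?n" using h Ac by simp
  have comm: "C * B_mat P = B_mat P * C"
    unfolding C_def by (rule commute_conjugate[OF Ac(1) B_mat_carrier g(1) h(1) Ac(2) g(2) h(2)])
  have hAc: "h * A * B_mat P = B_mat P * (h * A)"
  proof -
    have "h * A * B_mat P = h * (A * B_mat P)" by (rule assoc_mult_mat[OF h(1) Ac(1) B_mat_carrier])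
    also have "\<dots> = h * B_mat P * A" unfolding Ac(2) by (rule assoc_mult_mat[OF h(1) B_mat_carrier Ac(1), symmetric])
    also have "\<dots> = B_mat P * (h * A)" unfolding h(2) by (rule assoc_mult_mat[OF B_mat_carrier h(1) Ac(1)])
    finally show ?thesis .
  qed
  have hb: "head_block P i C = T i" if i: "i \<in> set P" for i
  proof -
    note t = TGH[OF i]
    have "head_block P i C = head_block P i h * head_block P i A * head_block P i g"
      unfolding C_def head_block_mult[OF hA hAc g i z] head_block_mult[OF h Ac(1,2) i z] ..
    also have "\<dots> = H i * (G i * T i * H i) * G i"
      unfolding g_def h_def using t by (simp add: head_block_block_scalar[OF i z])
    also have "\<dots> = (H i * G i) * T i * (H i * G i)"
      using t by (intro regroup_mult_mat[of _ "count_list P i"]) blast+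
    also have "\<dots> = T i" using t by (metis left_mult_one_mat right_mult_one_mat)
    finally show ?thesis .
  qed
  have "diagonal_free P C"
    unfolding diagonal_free_def
  proof (intro allI impI)
    fix i k k' assume v: "(1, i, k) \<in> vertices P" "(1, i, k') \<in> vertices P" "k' \<le> k"
    then have i: "i \<in> set P" and k: "k - 1 < count_list P i" "k' - 1 \<le> k - 1" "1 \<le> k" "1 \<le> k'"
      by (auto simp: vertices_def)
    have "coef P C (1, i, k) (1, i, k') = head_block P i C $$ (k' - 1, k - 1)"
      using k by (simp add: head_block_def)
    also have "\<dots> = 0" unfolding hb[OF i] using TGH[OF i] k by blast
    finally show "coef P C (1, i, k) (1, i, k') = 0" .
  qed
  then have "C \<in> U_B P" unfolding U_B_iff using C comm by blast
  moreover have "A = g * C * h"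
  proof -
    have "g * C * h = g * (h * A * g) * h" unfolding C_def ..
    also have "\<dots> = (g * h) * A * (g * h)"
      by (rule regroup_mult_mat[OF g(1) h(1) Ac(1) g(1) h(1)])
    also have "\<dots> = A" unfolding gh using Ac(1) by simp
    finally show ?thesis by simp
  qed
  ultimately show thesis using that g h gh hg by blast
qed

section \<open>Lines and the generic Jordan type\<close>

definition univ_poly_funs :: "('a :: field \<Rightarrow> 'a) set" where
  "univ_poly_funs = {f. \<exists>p. \<forall>x. f x = poly p x}"

lemma function_algebra_univ_poly_funs: "function_algebra univ_poly_funs"
  unfolding function_algebra_def univ_poly_funs_def
proof (intro conjI ballI allI)
  show "(\<lambda>_. c) \<in> {f. \<exists>p. \<forall>x. f x = poly p x}" for c :: 'a
    by (intro CollectI exI[of _ "[:c:]"]) simp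
next
  fix f g :: "'a \<Rightarrow> 'a"
  assume "f \<in> {f. \<exists>p. \<forall>x. f x = poly p x}" "g \<in> {f. \<exists>p. \<forall>x. f x = poly p x}"
  then obtain p r where "\<forall>x. f x = poly p x" "\<forall>x. g x = poly r x" by auto
  then show "(\<lambda>x. f x + g x) \<in> {f. \<exists>p. \<forall>x. f x = poly p x}"
      "(\<lambda>x. f x * g x) \<in> {f. \<exists>p. \<forall>x. f x = poly p x}"
    by (auto intro: exI[of _ "p + r"] exI[of _ "p * r"])
qed

lemma id_univ_poly_funs: "(\<lambda>x. x) \<in> univ_poly_funs"
  unfolding univ_poly_funs_def by (intro CollectI exI[of _ "[:0, 1:]"]) simp

lemma finite_zeros_univ_poly_funs:
  assumes "f \<in> univ_poly_funs" "f x0 \<noteq> 0"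
  shows "finite {x. f x = 0}"
proof -
  obtain p where p: "\<And>x. f x = poly p x" using assms(1) unfolding univ_poly_funs_def by auto
  then have "p \<noteq> 0" using assms(2) by auto
  then show ?thesis using poly_roots_finite p by simp
qed

text \<open>A finite set of nonzero polynomials has finitely many zeros altogether.\<close>

lemma common_nonzero:
  fixes F :: "('a :: field \<Rightarrow> 'a) set"
  assumes inf: "infinite (UNIV :: 'a set)" and fin: "finite F"
    and F: "\<And>f. f \<in> F \<Longrightarrow> f \<in> univ_poly_funs \<and> (\<exists>x. f x \<noteq> 0)"
  obtains x where "\<And>f. f \<in> F \<Longrightarrow> f x \<noteq> 0"
proof -
  have "finite (\<Union>f\<in>F. {x. f x = 0})"
    using F finite_zeros_univ_poly_funs by (intro finite_UN_I[OF fin]) blast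
  with inf obtain x where "x \<notin> (\<Union>f\<in>F. {x. f x = 0})" using ex_new_if_finite by blast
  then show thesis using that by blast
qed

lemma poly_funs_compose:
  assumes F: "function_algebra F" and f: "f \<in> poly_funs n"
    and M: "\<And>i j. i < n \<Longrightarrow> j < n \<Longrightarrow> (\<lambda>x. M x $$ (i, j)) \<in> F"
  shows "(\<lambda>x. f (M x)) \<in> F"
  using f by induction (auto intro: function_algebraD[OF F] M)

definition line :: "'a :: field mat \<Rightarrow> 'a mat \<Rightarrow> 'a \<Rightarrow> 'a mat" where
  "line C D x = (1 - x) \<cdot>\<^sub>m C + x \<cdot>\<^sub>m D"

lemma affine_univ_poly_funs: "(\<lambda>x. (1 - x) * a + x * b) \<in> univ_poly_funs"
  unfolding univ_poly_funs_def by (intro CollectI exI[of _ "[:a, b - a:]"]) (simp add: algebra_simps)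

lemma line_ends:
  assumes "C \<in> carrier_mat n n" "D \<in> carrier_mat n n"
  shows "line C D 0 = C" "line C D 1 = D"
  unfolding line_def using assms by (intro eq_matI; auto)+

lemma poly_funs_line:
  assumes "f \<in> poly_funs n" "C \<in> carrier_mat n n" "D \<in> carrier_mat n n"
  shows "(\<lambda>x. f (line C D x)) \<in> univ_poly_funs"
proof (rule poly_funs_compose[OF function_algebra_univ_poly_funs assms(1)])
  fix i j assume "i < n" "j < n"
  then have "line C D x $$ (i, j) = (1 - x) * C $$ (i, j) + x * D $$ (i, j)" for x
    unfolding line_def using assms(2,3) by simp
  then show "(\<lambda>x. line C D x $$ (i, j)) \<in> univ_poly_funs"
    using affine_univ_poly_funs by simp
qed

lemma jordan_type_props:
  fixes A :: "'a :: field mat"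
  assumes "A \<in> carrier_mat n n" "has_jordan_type A q"
  shows "sum_list q = n" "0 \<notin> set q" "length q \<le> n"
proof -
  show s: "sum_list q = n" and z: "0 \<notin> set q" using has_jordan_typeE[OF assms] by metis+
  have "length l \<le> sum_list l" if "0 \<notin> set l" for l :: "nat list"
    using that by (induction l) auto
  then show "length q \<le> n" using s z by blast
qed

lemma N_B_has_jordan_type: "A \<in> N_B P \<Longrightarrow> \<exists>q. has_jordan_type (A :: 'a :: field mat) q"
  unfolding N_B_def using nilpotent_has_jordan_type by blast

lemma N_B_carrier: "A \<in> N_B P \<Longrightarrow> A \<in> carrier_mat (sum_list P) (sum_list P)"
  unfolding N_B_def by blast

lemma U_B_subset_N_B: "C \<in> U_B P \<Longrightarrow> C \<in> N_B P"
  unfolding U_B_def by blast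

lemma conjugate_has_jordan_type:
  fixes C :: "'a :: field mat"
  assumes "C \<in> carrier_mat n n" "g \<in> carrier_mat n n" "h \<in> carrier_mat n n"
    "g * h = 1\<^sub>m n" "h * g = 1\<^sub>m n"
  shows "has_jordan_type (g * C * h) q \<longleftrightarrow> has_jordan_type C q"
proof -
  have gCh: "g * C * h \<in> carrier_mat n n" using assms by simp
  have "similar_mat_wit (g * C * h) C g h"
    by (rule similar_mat_witI[OF assms(4,5) refl gCh assms(1-3)])
  then have s: "similar_mat (g * C * h) C" unfolding similar_mat_def by blast
  have "similar_mat (g * C * h) J \<longleftrightarrow> similar_mat C J" for J
    using similar_mat_trans[OF s, of J] similar_mat_trans[OF similar_mat_sym[OF s], of J] by argo
  then show ?thesis unfolding has_jordan_type_def jordan_nf_def by simp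
qed

lemma conjugate_N_B:
  fixes C :: "'a :: field mat"
  assumes C: "C \<in> N_B P" and g: "g \<in> carrier_mat (sum_list P) (sum_list P)"
    "h \<in> carrier_mat (sum_list P) (sum_list P)" "g * h = 1\<^sub>m (sum_list P)" "h * g = 1\<^sub>m (sum_list P)"
    "g * B_mat P = B_mat P * g" "h * B_mat P = B_mat P * h"
  shows "g * C * h \<in> N_B P"
proof -
  let ?n = "sum_list P"
  from C obtain m where Cc: "C \<in> carrier_mat ?n ?n" "C * B_mat P = B_mat P * C" "C ^\<^sub>m m = 0\<^sub>m ?n ?n"
    unfolding N_B_def by blast
  have gCh: "g * C * h \<in> carrier_mat ?n ?n" using g Cc by simp
  have "similar_mat_wit (g * C * h) C g h"
    by (rule similar_mat_witI[OF g(3,4) refl gCh Cc(1) g(1,2)])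
  from similar_mat_wit_pow_id[OF this, of m] have "(g * C * h) ^\<^sub>m m = 0\<^sub>m ?n ?n"
    unfolding Cc(3) using g by simp
  moreover have "g * C * h * B_mat P = B_mat P * (g * C * h)"
    by (rule commute_conjugate[OF Cc(1) B_mat_carrier g(2,1) Cc(2) g(6,5)])
  ultimately show ?thesis unfolding N_B_def using gCh by blast
qed

lemma take_ge_sum:
  assumes "sum_list q = n" "0 \<notin> set (q :: nat list)" "n \<le> s"
  shows "sum_list (take s q) = n"
proof -
  have "length l \<le> sum_list l" if "0 \<notin> set l" for l :: "nat list"
    using that by (induction l) auto
  then have "length q \<le> s" using assms by fastforce
  then show ?thesis using assms by simp
qed

lemma dominates_antisym:
  assumes "dominates p q" "dominates q p" "0 \<notin> set p" "0 \<notin> set q"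
  shows "p = q"
  using assms
proof (induction p arbitrary: q)
  case Nil
  then have "sum_list (take (length q) q) \<le> 0" unfolding dominates_def by (metis sum_list.Nil take_Nil)
  then show ?case using Nil(4) by (cases q) auto
next
  case (Cons x p)
  note d = Cons.prems(1,2)[unfolded dominates_def, rule_format]
  obtain y q' where q: "q = y # q'"
    using d(2)[of 1] Cons.prems(3) by (cases q) auto
  have xy: "x = y" using d[of 1] unfolding q by simp
  have "dominates p q'" "dominates q' p"
    unfolding dominates_def using d[of "Suc i" for i] unfolding q xy by simp_all
  then show ?case using Cons unfolding q xy by simp
qed

lemma jordan_type_dominatesI:
  fixes A A' :: "'a :: field mat"
  assumes "A \<in> carrier_mat n n" "has_jordan_type A q" "A' \<in> carrier_mat n n" "has_jordan_type A' q'"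
    and le: "\<And>s. s \<le> n \<Longrightarrow> sum_list (take s q) \<le> sum_list (take s q')"
  shows "dominates q' q"
  unfolding dominates_def
proof
  fix s
  note p = jordan_type_props[OF assms(1,2)] jordan_type_props[OF assms(3,4)]
  show "sum_list (take s q) \<le> sum_list (take s q')"
  proof (cases "s \<le> n")
    case False
    then show ?thesis using take_ge_sum[of q n s] take_ge_sum[of q' n s] p by simp
  qed (rule le)
qed

text \<open>Induction on the number of partial sums that are maximal: on the line from an element for which the first \<open>m\<close>
  partial sums are maximal to one that maximises the next, a general point inherits all these maxima.\<close>

lemma exists_dominant_U_B:
  assumes inf: "infinite (UNIV :: 'a :: field set)" and z: "0 \<notin> set P"
  shows "\<exists>C \<in> U_B P. \<exists>q. has_jordan_type (C :: 'a mat) q \<and>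
    (\<forall>A \<in> N_B P. \<forall>q'. has_jordan_type (A :: 'a mat) q' \<longrightarrow> dominates q q')"
proof -
  let ?n = "sum_list P"
  note carr = N_B_carrier[OF U_B_subset_N_B]
  have "\<exists>C \<in> U_B P. \<exists>q. has_jordan_type (C :: 'a mat) q \<and>
    (\<forall>s<m. \<forall>A \<in> N_B P. \<forall>q'. has_jordan_type (A :: 'a mat) q' \<longrightarrow> sum_list (take s q') \<le> sum_list (take s q))"
    for m
  proof (induction m)
    case 0
    have "\<exists>m. (0\<^sub>m ?n ?n :: 'a mat) ^\<^sub>m m = 0\<^sub>m ?n ?n" by (rule exI[of _ 1]) simp
    then have "(0\<^sub>m ?n ?n :: 'a mat) \<in> N_B P" unfolding N_B_def
      using left_mult_zero_mat[OF B_mat_carrier[of P, where ?'a = 'a]]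
        right_mult_zero_mat[OF B_mat_carrier[of P, where ?'a = 'a]] zero_carrier_mat by simp
    from N_B_conjugate_U_B[OF this z] obtain C :: "'a mat" where "C \<in> U_B P" by blast
    then show ?case using N_B_has_jordan_type[OF U_B_subset_N_B] by blast
  next
    case (Suc m)
    then obtain C q where C: "C \<in> U_B P" "has_jordan_type (C :: 'a mat) q"
      and max: "\<And>s A q'. s < m \<Longrightarrow> A \<in> N_B P \<Longrightarrow> has_jordan_type (A :: 'a mat) q' \<Longrightarrow>
         sum_list (take s q') \<le> sum_list (take s q)" by blast
    define S where "S = {sum_list (take m q') | q'. \<exists>A \<in> N_B P. has_jordan_type (A :: 'a mat) q'}"
    have "S \<subseteq> {..?n}"
    proof
      fix x assume "x \<in> S"
      then obtain A q' where A: "A \<in> N_B P" "has_jordan_type (A :: 'a mat) q'" "x = sum_list (take m q')"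
        unfolding S_def by blast
      then show "x \<in> {..?n}"
        using jordan_type_props(1)[OF N_B_carrier[OF A(1)] A(2)] append_take_drop_id[of m q']
        by (metis atMost_iff le_add1 sum_list_append)
    qed
    then have fin: "finite S" using finite_subset by blast
    moreover have "S \<noteq> {}" unfolding S_def using C U_B_subset_N_B by blast
    ultimately have "Max S \<in> S" by (rule Max_in)
    then obtain A q1 where A: "A \<in> N_B P" "has_jordan_type (A :: 'a mat) q1" "Max S = sum_list (take m q1)"
      unfolding S_def by blast
    obtain D g h where D: "D \<in> U_B P" and g: "g \<in> carrier_mat ?n ?n"
      "h \<in> carrier_mat ?n ?n" "g * h = 1\<^sub>m ?n" "h * g = 1\<^sub>m ?n" "A = g * D * h"
      using N_B_conjugate_U_B[OF A(1) z] by metis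
    have Dq: "has_jordan_type D q1"
      using A(2) conjugate_has_jordan_type[OF carr[OF D] g(1-4)] unfolding g(5) by simp
    have "\<forall>s. \<exists>f\<in>poly_funs ?n. f C \<noteq> 0 \<and> (\<forall>A' q'. A' \<in> carrier_mat ?n ?n \<longrightarrow> has_jordan_type A' q' \<longrightarrow>
     f A' \<noteq> 0 \<longrightarrow> sum_list (take s q) \<le> sum_list (take s q'))"
      using jordan_type_semicontinuous[OF carr[OF C(1)] C(2)] by blast
    then obtain f where f: "\<And>s. f s \<in> poly_funs ?n" "\<And>s. f s C \<noteq> 0"
      "\<And>s A' q'. A' \<in> carrier_mat ?n ?n \<Longrightarrow> has_jordan_type A' q' \<Longrightarrow> f s A' \<noteq> 0 \<Longrightarrow>
         sum_list (take s q) \<le> sum_list (take s q')" by metis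
    obtain f1 where f1: "f1 \<in> poly_funs ?n" "f1 D \<noteq> 0"
      "\<And>A' q'. A' \<in> carrier_mat ?n ?n \<Longrightarrow> has_jordan_type A' q' \<Longrightarrow> f1 A' \<noteq> 0 \<Longrightarrow>
         sum_list (take m q1) \<le> sum_list (take m q')"
      using jordan_type_semicontinuous[OF carr[OF D] Dq, of m] by metis
    let ?F = "insert (\<lambda>x. f1 (line C D x)) ((\<lambda>s x. f s (line C D x)) ` {..<m})"
    obtain x where x: "\<And>u. u \<in> ?F \<Longrightarrow> u x \<noteq> 0"
    proof (rule common_nonzero[OF inf, of ?F])
      fix u assume "u \<in> ?F"
      then consider "u = (\<lambda>x. f1 (line C D x))" | s where "u = (\<lambda>x. f s (line C D x))" by blast
      then show "u \<in> univ_poly_funs \<and> (\<exists>x. u x \<noteq> 0)"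
      proof cases
        case 1
        then have "u 1 \<noteq> 0" using f1(2) line_ends[OF carr[OF C(1)] carr[OF D]] by simp
        then show ?thesis using 1 poly_funs_line[OF f1(1) carr[OF C(1)] carr[OF D]] by blast
      next
        case 2
        then have "u 0 \<noteq> 0" using f(2) line_ends[OF carr[OF C(1)] carr[OF D]] by simp
        then show ?thesis using 2 poly_funs_line[OF f(1) carr[OF C(1)] carr[OF D]] by blast
      qed
    qed auto
    define E where "E = line C D x"
    have E: "E \<in> U_B P" unfolding E_def line_def by (rule U_B_line[OF C(1) D])
    obtain qE where qE: "has_jordan_type E qE" using N_B_has_jordan_type[OF U_B_subset_N_B[OF E]] by blast
    have "sum_list (take s q') \<le> sum_list (take s qE)"
      if s: "s < Suc m" and A': "A' \<in> N_B P" "has_jordan_type (A' :: 'a mat) q'" for s A' q'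
    proof (cases "s = m")
      case True
      have "sum_list (take m q') \<le> Max S" using fin A' unfolding S_def by (intro Max_ge) blast+
      also have "\<dots> \<le> sum_list (take m qE)"
        unfolding A(3) using f1(3)[OF carr[OF E] qE] x unfolding E_def by blast
      finally show ?thesis unfolding True .
    next
      case False
      then have s': "s < m" using s by simp
      have "sum_list (take s q) \<le> sum_list (take s qE)"
        using f(3)[OF carr[OF E] qE, of s] x s' unfolding E_def by blast
      with max[OF s' A'] show ?thesis by (rule order_trans)
    qed
    then show ?case using E qE by blast
  qed
  from this[of "Suc ?n"] obtain C q where C: "C \<in> U_B P" "has_jordan_type (C :: 'a mat) q"
      and max: "\<And>s A q'. s < Suc ?n \<Longrightarrow> A \<in> N_B P \<Longrightarrow> has_jordan_type (A :: 'a mat) q' \<Longrightarrow>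
         sum_list (take s q') \<le> sum_list (take s q)" by blast
  have "dominates q q'" if "A \<in> N_B P" "has_jordan_type (A :: 'a mat) q'" for A q'
    by (rule jordan_type_dominatesI[OF N_B_carrier[OF that(1)] that(2) carr[OF C(1)] C(2)])
       (use max that in simp)
  then show ?thesis using C by blast
qed

lemma zariski_basis:
  assumes "openin (zariski n) T" "A \<in> T"
  shows "\<exists>f\<in>poly_funs n. f A \<noteq> 0 \<and> {A' \<in> carrier_mat n n. f A' \<noteq> 0} \<subseteq> T"
proof -
  let ?S = "{{A \<in> carrier_mat n n. f A \<noteq> 0} | f. f \<in> poly_funs n}"
  have "generate_topology_on ?S T"
    using assms(1) unfolding zariski_def openin_topology_generated_by_iff .
  then show ?thesis using assms(2)
  proof induction
    case (Int a b)
    then obtain f g where f: "f \<in> poly_funs n" "f A \<noteq> 0" "{A' \<in> carrier_mat n n. f A' \<noteq> 0} \<subseteq> a"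
      and g: "g \<in> poly_funs n" "g A \<noteq> 0" "{A' \<in> carrier_mat n n. g A' \<noteq> 0} \<subseteq> b" by blast
    show ?case
      by (rule bexI[OF _ poly_funs.mult[OF f(1) g(1)]]) (use f g in auto)
  next
    case (UN K)
    then obtain k where k: "k \<in> K" "A \<in> k" by blast
    from UN.IH[OF this] obtain f where "f \<in> poly_funs n" "f A \<noteq> 0" "{A' \<in> carrier_mat n n. f A' \<noteq> 0} \<subseteq> k"
      by blast
    then show ?case using k(1) by (intro bexI[of _ f]) auto
  next
    case (Basis s)
    then obtain f where "f \<in> poly_funs n" "s = {A \<in> carrier_mat n n. f A \<noteq> 0}" by blast
    then show ?case using Basis.prems by (intro bexI[of _ f]) auto
  qed simp
qed

lemma openin_zariski_nonzero:
  assumes "f \<in> poly_funs n"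
  shows "openin (zariski n) {A \<in> carrier_mat n n. f A \<noteq> 0}"
  unfolding zariski_def openin_topology_generated_by_iff
  using assms by (intro generate_topology_on.Basis) blast

lemma poly_funs_prod:
  "finite S \<Longrightarrow> (\<And>s. s \<in> S \<Longrightarrow> f s \<in> poly_funs n) \<Longrightarrow> (\<lambda>A. \<Prod>s\<in>S. f s A) \<in> poly_funs n"
  by (induction S rule: finite_induct) (auto intro: poly_funs.intros)

text \<open>The generic type is the largest one: the locus where it is attained is open by semicontinuity;
  it is dense because through any \<open>A = g C g\<^sup>-\<^sup>1\<close> with \<open>C \<in> U\<^sub>B\<close> there is the line \<open>g (line C D x) g\<^sup>-\<^sup>1\<close> in
  \<open>N\<^sub>B\<close> to a conjugate of the dominant element \<open>D\<close>.\<close>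

lemma generic_type_dominates:
  assumes inf: "infinite (UNIV :: 'a :: field set)" and z: "0 \<notin> set P"
    and A: "A \<in> N_B P" "has_jordan_type (A :: 'a mat) p"
  shows "dominates (Q TYPE('a) P) p"
proof -
  let ?n = "sum_list P"
  let ?X = "subtopology (zariski ?n) (N_B P) :: 'a mat topology"
  have N_sub: "N_B P \<subseteq> (carrier_mat ?n ?n :: 'a mat set)" using N_B_carrier by blast
  have space: "topspace ?X = N_B P" using N_sub by (simp add: topspace_zariski Int_absorb1)
  obtain D q where D: "D \<in> U_B P" "has_jordan_type (D :: 'a mat) q"
    and max: "\<And>A q'. A \<in> N_B P \<Longrightarrow> has_jordan_type (A :: 'a mat) q' \<Longrightarrow> dominates q q'"
    using exists_dominant_U_B[OF inf z] by blast
  note DN = U_B_subset_N_B[OF D(1)]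
  define W where "W = {A \<in> N_B P. has_jordan_type (A :: 'a mat) q}"
  have nbhd: "\<exists>f\<in>poly_funs ?n. f A \<noteq> 0 \<and> {A' \<in> carrier_mat ?n ?n. f A' \<noteq> 0} \<inter> N_B P \<subseteq> W"
    if A: "A \<in> W" for A
  proof -
    have Ac: "A \<in> carrier_mat ?n ?n" "has_jordan_type A q" using A N_B_carrier unfolding W_def by auto
    have "\<forall>s. \<exists>f\<in>poly_funs ?n. f A \<noteq> 0 \<and> (\<forall>A' q'. A' \<in> carrier_mat ?n ?n \<longrightarrow> has_jordan_type A' q' \<longrightarrow>
       f A' \<noteq> 0 \<longrightarrow> sum_list (take s q) \<le> sum_list (take s q'))"
      using jordan_type_semicontinuous[OF Ac] by blast
    then obtain f where f: "\<And>s. f s \<in> poly_funs ?n" "\<And>s. f s A \<noteq> 0"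
      "\<And>s A' q'. A' \<in> carrier_mat ?n ?n \<Longrightarrow> has_jordan_type A' q' \<Longrightarrow> f s A' \<noteq> 0 \<Longrightarrow>
         sum_list (take s q) \<le> sum_list (take s q')" by metis
    let ?f = "\<lambda>A. \<Prod>s\<in>{..?n}. f s A"
    have "A' \<in> W" if A': "A' \<in> N_B P" "?f A' \<noteq> 0" for A'
    proof -
      obtain q' where q': "has_jordan_type A' q'" using N_B_has_jordan_type[OF A'(1)] by blast
      have "f s A' \<noteq> 0" if "s \<le> ?n" for s using A'(2) that by simp
      then have "dominates q' q"
        by (intro jordan_type_dominatesI[OF Ac N_B_carrier[OF A'(1)] q'] f(3)[OF N_B_carrier[OF A'(1)] q'])
      moreover have "dominates q q'" by (rule max[OF A'(1) q'])
      ultimately have "q' = q"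
        using jordan_type_props(2)[OF Ac] jordan_type_props(2)[OF N_B_carrier[OF A'(1)] q']
        by (intro dominates_antisym)
      then show ?thesis using A' q' unfolding W_def by simp
    qed
    moreover have "?f A \<noteq> 0" using f(2) by simp
    moreover have "?f \<in> poly_funs ?n" by (intro poly_funs_prod f(1)) simp
    ultimately show ?thesis by (intro bexI[of _ ?f]) auto
  qed
  have open_W: "openin ?X W"
  proof (subst openin_subopen, intro ballI)
    fix A assume A: "A \<in> W"
    from nbhd[OF A] obtain f where f: "f \<in> poly_funs ?n" "f A \<noteq> 0"
      "{A' \<in> carrier_mat ?n ?n. f A' \<noteq> 0} \<inter> N_B P \<subseteq> W" by blast
    have "openin ?X ({A' \<in> carrier_mat ?n ?n. f A' \<noteq> 0} \<inter> N_B P)"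
      by (rule openin_subtopology_Int[OF openin_zariski_nonzero[OF f(1)]])
    moreover have "A \<in> {A' \<in> carrier_mat ?n ?n. f A' \<noteq> 0} \<inter> N_B P"
      using A f(2) N_sub unfolding W_def by auto
    ultimately show "\<exists>T. openin ?X T \<and> A \<in> T \<and> T \<subseteq> W" using f(3) by blast
  qed
  have dense: "?X closure_of W = N_B P"
  proof (rule equalityI)
    show "?X closure_of W \<subseteq> N_B P" using closure_of_subset_topspace[of ?X W] space by simp
    show "N_B P \<subseteq> ?X closure_of W"
    proof
      fix A :: "'a mat" assume A: "A \<in> N_B P"
      show "A \<in> ?X closure_of W"
        unfolding in_closure_of space
      proof (intro conjI allI impI A)
        fix T assume T: "A \<in> T \<and> openin ?X T"
        then obtain T' where T': "openin (zariski ?n) T'" "T = T' \<inter> N_B P"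
          unfolding openin_subtopology by blast
        then obtain f where f: "f \<in> poly_funs ?n" "f A \<noteq> 0" "{A' \<in> carrier_mat ?n ?n. f A' \<noteq> 0} \<subseteq> T'"
          using zariski_basis[of ?n T' A] T by blast
        obtain C g h where C: "C \<in> U_B P" and g: "g \<in> carrier_mat ?n ?n"
          "h \<in> carrier_mat ?n ?n" "g * h = 1\<^sub>m ?n" "h * g = 1\<^sub>m ?n"
          "g * B_mat P = B_mat P * g" "h * B_mat P = B_mat P * h" "A = g * C * h"
          using N_B_conjugate_U_B[OF A z] by metis
        note Cc = N_B_carrier[OF U_B_subset_N_B[OF C]] and Dc = N_B_carrier[OF DN]
        define L where "L = (\<lambda>x. g * line C D x * h)"
        have LN: "L x \<in> N_B P" for x
          unfolding L_def line_def
          by (intro conjugate_N_B[OF U_B_subset_N_B[OF U_B_line[OF C D(1)]] g(1-6)])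
        have L0: "L 0 = A" and L1: "L 1 = g * D * h"
          unfolding L_def line_ends[OF Cc Dc] g(7) by simp_all
        have "L 1 \<in> W"
          using LN[of 1] D(2) conjugate_has_jordan_type[OF Dc g(1-4)] unfolding W_def L1 by simp
        from nbhd[OF this] obtain f1 where f1: "f1 \<in> poly_funs ?n" "f1 (L 1) \<noteq> 0"
          "{A' \<in> carrier_mat ?n ?n. f1 A' \<noteq> 0} \<inter> N_B P \<subseteq> W" by blast
        have entry: "(\<lambda>x. L x $$ (i, j)) \<in> univ_poly_funs" if "i < ?n" "j < ?n" for i j
        proof -
          have lc: "line C D x \<in> carrier_mat ?n ?n" for x unfolding line_def using Cc Dc by simp
          have "L x $$ (i, j) = (\<Sum>a<?n. \<Sum>b<?n. g $$ (i, a) * line C D x $$ (a, b) * h $$ (b, j))" for x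
            unfolding L_def by (rule index_mult_three[OF g(1) lc g(2) that])
          moreover have "(\<lambda>x. line C D x $$ (a, b)) \<in> univ_poly_funs" if "a < ?n" "b < ?n" for a b
            by (rule poly_funs_line[OF poly_funs.entry[OF that] Cc Dc])
          ultimately show ?thesis
            by (auto intro!: function_algebra_sum function_algebra_univ_poly_funs
                function_algebraD[OF function_algebra_univ_poly_funs])
        qed
        \<comment> \<open>\<open>f\<close> does not vanish at \<open>x = 0\<close>, and \<open>f1\<close> does not vanish at \<open>x = 1\<close>.\<close>
        let ?F = "{\<lambda>x. f (L x), \<lambda>x. f1 (L x)}"
        obtain x where x: "\<And>u. u \<in> ?F \<Longrightarrow> u x \<noteq> 0"
        proof (rule common_nonzero[OF inf, of ?F])
          fix u assume "u \<in> ?F"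
          then consider "u = (\<lambda>x. f (L x))" | "u = (\<lambda>x. f1 (L x))" by blast
          then show "u \<in> univ_poly_funs \<and> (\<exists>x. u x \<noteq> 0)"
          proof cases
            case 1
            then have "u 0 \<noteq> 0" using f(2) L0 by simp
            then show ?thesis
              using 1 poly_funs_compose[OF function_algebra_univ_poly_funs f(1) entry] by blast
          next
            case 2
            then have "u 1 \<noteq> 0" using f1(2) by simp
            then show ?thesis
              using 2 poly_funs_compose[OF function_algebra_univ_poly_funs f1(1) entry] by blast
          qed
        qed auto
        have "L x \<in> T" using f(3) x LN[of x] N_B_carrier[OF LN[of x]] unfolding T'(2) by blast
        moreover have "L x \<in> W" using f1(3) x LN[of x] N_B_carrier[OF LN[of x]] by blast
        ultimately show "\<exists>y. y \<in> W \<and> y \<in> T" by blast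
      qed
    qed
  qed
  have "is_generic_type TYPE('a) P q"
    unfolding is_generic_type_def using open_W dense by (intro exI[of _ W]) (auto simp: W_def)
  \<comment> \<open>Uniqueness: a second dense set of constant type meets the open set \<open>W\<close>.\<close>
  moreover have "q1 = q" if "is_generic_type TYPE('a) P q1" for q1
  proof -
    from that obtain W1 where W1: "?X closure_of W1 = N_B P" "\<forall>A \<in> W1. has_jordan_type (A :: 'a mat) q1"
      unfolding is_generic_type_def by blast
    have "D \<in> ?X closure_of W1" unfolding W1(1) by (rule DN)
    moreover have "D \<in> W" using DN D(2) unfolding W_def by simp
    ultimately obtain A where "A \<in> W1" "A \<in> W" using open_W unfolding in_closure_of by blast
    then show ?thesis using W1(2) has_jordan_type_unique unfolding W_def by blast
  qed
  ultimately have "Q TYPE('a) P = q" unfolding Q_def by (rule the_equality)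
  then show ?thesis using max[OF A] by simp
qed

section \<open>Gram determinants of continued fractions\<close>

text \<open>The Gram determinant of the form \<open>\<langle>f, g\<rangle> = [x\<^bsup>l-1\<^esup>] f g \<Phi>\<close>. Here \<open>x\<close> is the variable of the power series and
  \<open>y\<close> that of their coefficients.\<close>

definition gram_det :: "nat \<Rightarrow> nat \<Rightarrow> (nat \<Rightarrow> 'a fps) \<Rightarrow> 'a fps \<Rightarrow> 'a :: comm_ring_1" where
  "gram_det l s f \<Phi> = det (mat s s (\<lambda>(i, j). fps_nth (f i * f j * \<Phi>) (l - 1)))"

text \<open>The vectors are polynomials of degree less than \<open>s\<close> with integral coefficients. The bound on the degree makes
  products of two of them invisible in the coefficient of \<open>x\<^bsup>l-1\<^esup>\<close> when \<open>2 s \<le> l\<close>.\<close>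

definition gram_pole :: "nat \<Rightarrow> 'a :: field fls fps \<Rightarrow> nat \<Rightarrow> nat \<Rightarrow> bool" where
  "gram_pole l \<Phi> s L \<longleftrightarrow> (\<exists>f. (\<forall>i<s. (\<forall>m. pole_le 0 (fps_nth (f i) m)) \<and> (\<forall>m\<ge>s. fps_nth (f i) m = 0)) \<and>
     (\<exists>p\<ge>L. fls_nth (gram_det l s f \<Phi>) (- int p) \<noteq> 0))"

abbreviation cst :: "'a :: field \<Rightarrow> 'a fls fps" where
  "cst e \<equiv> fps_const (fls_const e)"

abbreviation yp :: "nat \<Rightarrow> 'a :: field fls fps" where
  "yp k \<equiv> fps_const (fls_X ^ k)"

text \<open>Families of Laurent series that depend polynomially on one parameter in the ground field.\<close>

abbreviation pfuns :: "('a :: field \<Rightarrow> 'a fls) set" where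
  "pfuns \<equiv> laurent_funs univ_poly_funs"

lemmas pfuns_intros = laurent_funs.add laurent_funs_const[OF function_algebra_univ_poly_funs]
  laurent_funs_mult[OF function_algebra_univ_poly_funs] laurent_funs_sum[OF function_algebra_univ_poly_funs]
  laurent_funs_det[OF function_algebra_univ_poly_funs]

lemma fls_const_pfuns: "fls_const \<in> pfuns"
  using laurent_funs.base[OF id_univ_poly_funs, of 1] by simp

definition fps_pfuns :: "('a :: field \<Rightarrow> 'a fls fps) set" where
  "fps_pfuns = {\<Phi>. \<forall>m. (\<lambda>e. fps_nth (\<Phi> e) m) \<in> pfuns}"

lemma fps_pfuns_nth: "\<Phi> \<in> fps_pfuns \<Longrightarrow> (\<lambda>e. fps_nth (\<Phi> e) m) \<in> pfuns"
  unfolding fps_pfuns_def by blast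

lemma fps_pfuns_const: "(\<lambda>_. \<Phi>) \<in> fps_pfuns"
  unfolding fps_pfuns_def by (auto intro: pfuns_intros)

lemma fps_pfuns_cst: "(\<lambda>e. cst e) \<in> fps_pfuns"
  unfolding fps_pfuns_def
proof (intro CollectI allI)
  show "(\<lambda>e. fps_nth (cst e) m) \<in> pfuns" for m
    by (cases m) (simp_all add: fls_const_pfuns laurent_funs_const[OF function_algebra_univ_poly_funs])
qed

lemma fps_pfuns_mult: "\<Phi> \<in> fps_pfuns \<Longrightarrow> \<Psi> \<in> fps_pfuns \<Longrightarrow> (\<lambda>e. \<Phi> e * \<Psi> e) \<in> fps_pfuns"
  unfolding fps_pfuns_def mem_Collect_eq fps_mult_nth by (auto intro!: pfuns_intros)

lemma fps_pfuns_add: "\<Phi> \<in> fps_pfuns \<Longrightarrow> \<Psi> \<in> fps_pfuns \<Longrightarrow> (\<lambda>e. \<Phi> e + \<Psi> e) \<in> fps_pfuns"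
  unfolding fps_pfuns_def mem_Collect_eq fps_add_nth by (auto intro!: pfuns_intros)

lemma fps_pfuns_diff:
  assumes "\<Phi> \<in> fps_pfuns" "\<Psi> \<in> fps_pfuns"
  shows "(\<lambda>e. \<Phi> e - \<Psi> e) \<in> fps_pfuns"
  using fps_pfuns_add[OF assms(1) fps_pfuns_mult[OF fps_pfuns_const[of "-1"] assms(2)]] by simp

text \<open>The coefficients of the inverse are given by a recursion that divides only by the constant coefficient, which is
  independent of the parameter.\<close>

lemma fps_pfuns_inverse:
  assumes U: "U \<in> fps_pfuns" and c: "\<And>e. fps_nth (U e) 0 = c" "c \<noteq> 0"
  shows "(\<lambda>e. inverse (U e)) \<in> fps_pfuns"
  unfolding fps_pfuns_def
proof (intro CollectI allI)
  fix m
  show "(\<lambda>e. fps_nth (inverse (U e)) m) \<in> pfuns"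
  proof (induction m rule: less_induct)
    case (less m)
    show ?case
    proof (cases "m = 0")
      case True
      then show ?thesis using c by (auto intro: pfuns_intros)
    next
      case False
      have eq: "fps_nth (inverse (U e)) m = - inverse c * (\<Sum>i\<in>{1..m}. fps_nth (U e) i * fps_nth (inverse (U e)) (m - i))" for e
      proof -
        have "U e * inverse (U e) = 1" using c by (intro inverse_mult_eq_1') simp
        then have "(\<Sum>i=0..m. fps_nth (U e) i * fps_nth (inverse (U e)) (m - i)) = 0"
          using False by (metis fps_mult_nth fps_one_nth)
        then have "c * fps_nth (inverse (U e)) m + (\<Sum>i\<in>{1..m}. fps_nth (U e) i * fps_nth (inverse (U e)) (m - i)) = 0"
          using c by (simp add: sum.atLeast_Suc_atMost)
        then have "c * fps_nth (inverse (U e)) m = - (\<Sum>i\<in>{1..m}. fps_nth (U e) i * fps_nth (inverse (U e)) (m - i))"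
          by (simp add: eq_neg_iff_add_eq_0)
        then have "inverse c * (c * fps_nth (inverse (U e)) m) = inverse c * - (\<Sum>i\<in>{1..m}. fps_nth (U e) i * fps_nth (inverse (U e)) (m - i))"
          by simp
        then show ?thesis using c(2) by (simp add: mult.assoc[symmetric])
      qed
      show ?thesis unfolding eq
        by (intro pfuns_intros fps_pfuns_nth[OF U] less) (use False in auto)
    qed
  qed
qed

text \<open>A coefficient that does not vanish at the parameter 0 does not vanish at some nonzero parameter.\<close>

lemma pfuns_generic:
  assumes inf: "infinite (UNIV :: 'a :: field set)" and F: "F \<in> pfuns" and nz: "fls_nth (F (0 :: 'a)) m \<noteq> 0"
  obtains e where "e \<noteq> 0" "fls_nth (F e) m \<noteq> 0"
proof -
  let ?F = "{\<lambda>e. fls_nth (F e) m, \<lambda>e. e}"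
  obtain e where "\<And>u. u \<in> ?F \<Longrightarrow> u e \<noteq> 0"
  proof (rule common_nonzero[OF inf, of ?F])
    fix u assume "u \<in> ?F"
    then show "u \<in> univ_poly_funs \<and> (\<exists>x. u x \<noteq> 0)"
      using laurent_funs_nth[OF function_algebra_univ_poly_funs F, of m] id_univ_poly_funs nz
      by (auto intro: exI[of _ 0] exI[of _ 1])
  qed auto
  then show thesis using that by blast
qed

lemma fps_nth_mult_eq_0:
  assumes "\<And>m. m \<ge> a \<Longrightarrow> fps_nth f m = 0" "\<And>m. m \<ge> b \<Longrightarrow> fps_nth g m = 0" "k + 1 \<ge> a + b"
  shows "fps_nth (f * g :: 'a :: comm_ring_1 fps) k = 0"
  unfolding fps_mult_nth
proof (intro sum.neutral ballI)
  fix i assume "i \<in> {0..k}"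
  then have "i \<ge> a \<or> k - i \<ge> b" using assms(3) by auto
  then show "fps_nth f i * fps_nth g (k - i) = 0" using assms(1,2) by auto
qed

lemma fls_nth_X_inv_power_mult:
  "fls_nth (fls_X_inv ^ k * f) m = fls_nth (f :: 'a :: field fls) (m + int k)"
  by (simp add: fls_X_inv_power_times_conv_shift)

lemma fls_X_inverse_power: "fls_X_inv ^ k * fls_X ^ k = (1 :: 'a :: field fls)"
  using fls_X_inv_power_mult_X_power(1)[of k k] by simp

lemma det_scale_rows:
  fixes a :: "nat \<Rightarrow> nat \<Rightarrow> 'a :: comm_ring_1"
  shows "det (mat s s (\<lambda>(i, j). c i * a i j)) = (\<Prod>i<s. c i) * det (mat s s (\<lambda>(i, j). a i j))"
proof -
  have "mat s s (\<lambda>(i, j). c i * a i j) = mat\<^sub>r s s (\<lambda>i. c i \<cdot>\<^sub>v vec s (a i))"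
    by (intro eq_matI) auto
  moreover have "mat s s (\<lambda>(i, j). a i j) = mat\<^sub>r s s (\<lambda>i. vec s (a i))"
    by (intro eq_matI) auto
  ultimately show ?thesis using det_rows_mul[of "\<lambda>i. vec s (a i)" s c] by (simp add: lessThan_atLeast0)
qed

lemma det_first_row:
  fixes a :: "nat \<Rightarrow> nat \<Rightarrow> 'a :: comm_ring_1"
  assumes "\<And>j. j < s \<Longrightarrow> a 0 (Suc j) = 0"
  shows "det (mat (Suc s) (Suc s) (\<lambda>(i, j). a i j)) = a 0 0 * det (mat s s (\<lambda>(i, j). a (Suc i) (Suc j)))"
proof -
  let ?A = "mat (Suc s) (Suc s) (\<lambda>(i, j). a i j)"
  have "det ?A = (\<Sum>j<Suc s. ?A $$ (0, j) * cofactor ?A 0 j)"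
    by (rule laplace_expansion_row) auto
  also have "\<dots> = a 0 0 * cofactor ?A 0 0"
    unfolding sum.lessThan_Suc_shift using assms by simp
  also have "cofactor ?A 0 0 = det (mat s s (\<lambda>(i, j). a (Suc i) (Suc j)))"
    unfolding cofactor_def mat_delete_def by (auto intro!: arg_cong[of _ _ det] eq_matI)
  finally show ?thesis .
qed

lemma gram_pole_0: "gram_pole l \<Phi> 0 0"
proof -
  have "gram_det l 0 f \<Phi> = 1" for f unfolding gram_det_def by (rule det_dim_zero) simp
  then show ?thesis unfolding gram_pole_def by auto
qed

text \<open>Descending through a level that belongs to no brace: \<open>\<epsilon>\<close> is the coupling to the lower levels.
  The term of order 0 in \<open>\<epsilon>\<close> is constant in \<open>x\<close> and does not reach the coefficient of \<open>x ^ (l - 1)\<close>;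
  hence every entry is \<open>\<epsilon>\<close> times a quantity which for \<open>\<epsilon> = 0\<close> is \<open>y ^ (- 2 n)\<close> times the old entry.\<close>

lemma gram_pole_pass_level:
  fixes \<Phi>' :: "'a :: field fls fps"
  assumes inf: "infinite (UNIV :: 'a set)"
    and g': "gram_pole l' \<Phi>' s L" and l: "1 \<le> l'" "l' < l" "2 * s \<le> l"
  obtains e where "gram_pole l (inverse (yp n - cst e * fps_X ^ (l - l') * \<Phi>')) s (L + 2 * n * s)"
proof -
  define g where "g = fps_X ^ (l - l') * \<Phi>'"
  define \<Phi> where "\<Phi> = (\<lambda>e. inverse (yp n - cst e * g))"
  define W :: "'a fls fps" where "W = fps_const (fls_X_inv ^ n)"
  obtain f p where fint: "\<And>i m. i < s \<Longrightarrow> pole_le 0 (fps_nth (f i) m)"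
    and fdeg: "\<And>i m. i < s \<Longrightarrow> m \<ge> s \<Longrightarrow> fps_nth (f i) m = 0"
    and p: "p \<ge> L" "fls_nth (gram_det l' s f \<Phi>') (- int p) \<noteq> 0"
    using g' unfolding gram_pole_def by blast
  have g0: "fps_nth g 0 = 0" unfolding g_def using l by simp
  have U0: "fps_nth (yp n - cst e * g) 0 = fls_X ^ n" for e by (simp add: g0)
  have \<Phi>P: "\<Phi> \<in> fps_pfuns" unfolding \<Phi>_def
    by (rule fps_pfuns_inverse[OF _ U0]) (auto intro!: fps_pfuns_diff fps_pfuns_mult fps_pfuns_const fps_pfuns_cst)
  have WY: "W * yp n = 1" unfolding W_def by (simp add: fls_X_inverse_power)
  have \<Phi>eq: "\<Phi> e = W + cst e * W * g * \<Phi> e" for e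
  proof -
    have "\<Phi> e * (yp n - cst e * g) = 1" unfolding \<Phi>_def by (rule inverse_mult_eq_1) (simp add: g0)
    then have "W * yp n * \<Phi> e - cst e * W * g * \<Phi> e = W" by (simp add: algebra_simps)
    then show ?thesis unfolding WY by (simp add: algebra_simps)
  qed
  have \<Phi>exp: "\<Phi> e = W + cst e * (W * W * g + cst e * (W * W * g * g * \<Phi> e))" for e
  proof -
    have "\<Phi> e = W + cst e * W * g * (W + cst e * W * g * \<Phi> e)" using \<Phi>eq[of e] by simp
    then show ?thesis by (simp add: algebra_simps)
  qed
  define u where "u = (\<lambda>i j e. fps_nth (f i * f j * (W * W * g)) (l - 1) +
     fls_const e * fps_nth (f i * f j * (W * W * g * g * \<Phi> e)) (l - 1))"
  have entry: "fps_nth (f i * f j * \<Phi> e) (l - 1) = fls_const e * u i j e" if "i < s" "j < s" for i j e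
  proof -
    have "fps_nth (f i * f j) (l - 1) = 0"
      by (rule fps_nth_mult_eq_0[of s _ s]) (use fdeg that l in auto)
    then have e1: "fps_nth (f i * f j * W) (l - 1) = 0" unfolding W_def by simp
    have e2: "f i * f j * \<Phi> e = f i * f j * W + cst e * (f i * f j * (W * W * g) + cst e * (f i * f j * (W * W * g * g * \<Phi> e)))"
      by (subst \<Phi>exp) (simp add: algebra_simps)
    show ?thesis unfolding e2 u_def fps_add_nth fps_mult_left_const_nth e1 by simp
  qed
  define h where "h = (\<lambda>e. det (mat s s (\<lambda>(i, j). u i j e)))"
  have hP: "h \<in> pfuns" unfolding h_def u_def
    by (intro pfuns_intros fls_const_pfuns fps_pfuns_nth fps_pfuns_mult fps_pfuns_const \<Phi>P)
  have u0: "u i j 0 = (fls_X_inv ^ (2 * n)) * fps_nth (f i * f j * \<Phi>') (l' - 1)" for i j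
  proof -
    have e: "f i * f j * (W * W * g) = fps_const (fls_X_inv ^ (2 * n)) * (fps_X ^ (l - l') * (f i * f j * \<Phi>'))"
      unfolding g_def W_def mult_2 power_add fps_const_mult[symmetric] by (simp only: mult_ac)
    have l2: "\<not> l - 1 < l - l'" "l - 1 - (l - l') = l' - 1" using l by auto
    have "fps_nth (f i * f j * (W * W * g)) (l - 1) =
        fls_X_inv ^ (2 * n) * fps_nth (f i * f j * \<Phi>') (l' - 1)"
      unfolding e fps_mult_left_const_nth fps_X_power_mult_nth using l2 by simp
    then show ?thesis unfolding u_def by simp
  qed
  have "h 0 = (fls_X_inv ^ (2 * n)) ^ s * gram_det l' s f \<Phi>'"
    unfolding h_def u0 det_scale_rows gram_det_def by simp
  then have "h 0 = fls_X_inv ^ (2 * n * s) * gram_det l' s f \<Phi>'" by (simp add: power_mult)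
  then have "fls_nth (h 0) (- int (p + 2 * n * s)) \<noteq> 0"
    using p(2) by (simp add: fls_nth_X_inv_power_mult)
  from pfuns_generic[OF inf hP this] obtain e where e: "e \<noteq> 0" "fls_nth (h e) (- int (p + 2 * n * s)) \<noteq> 0" .
  have "gram_det l s f (\<Phi> e) = det (mat s s (\<lambda>(i, j). fls_const e * u i j e))"
    unfolding gram_det_def by (intro arg_cong[of _ _ det] cong_mat refl) (simp only: prod.case entry)
  also have "\<dots> = fls_const (e ^ s) * h e"
    unfolding det_scale_rows h_def by (simp add: fls_const_power)
  finally have "fls_nth (gram_det l s f (\<Phi> e)) (- int (p + 2 * n * s)) \<noteq> 0" using e by simp
  then have "gram_pole l (\<Phi> e) s (L + 2 * n * s)"
    unfolding gram_pole_def using fint fdeg p(1)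
    by (intro exI[of _ f] conjI exI[of _ "p + 2 * n * s"]) auto
  then show thesis using that[of e] unfolding \<Phi>_def g_def by (simp add: mult.assoc)
qed

text \<open>Descending through a brace, the common part of the cases of one and of two levels. At \<open>\<epsilon> = 0\<close> the series is
  \<open>y ^ b / D\<close> with \<open>D = y ^ c - x\<close>. Take the vectors \<open>1, D f\<^sub>0, D f\<^sub>1, \<dots>\<close>. For \<open>\<epsilon> = 0\<close> the vectors \<open>D f\<^sub>j\<close> are
  orthogonal to all of these vectors for reasons of degree, and the first vector has norm \<open>y ^ (b - c l)\<close>, the coefficient of
  \<open>x ^ (l - 1)\<close> in \<open>y ^ b / D\<close>. In first order in \<open>\<epsilon>\<close> the Gram matrix of the \<open>D f\<^sub>j\<close> is the old Gram matrix of the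
  \<open>f\<^sub>j\<close>. After a factor \<open>\<epsilon>\<close> has been taken out of all rows but the first one, the matrix is block triangular at
  \<open>\<epsilon> = 0\<close>.\<close>

lemma gram_pole_pass_brace:
  fixes \<Phi>' :: "'a :: field fls fps"
  assumes inf: "infinite (UNIV :: 'a set)"
    and g': "gram_pole l' \<Phi>' s L" and l: "s = 0 \<or> 1 \<le> l' \<and> l' < l" "2 * s + 1 \<le> l" and bc: "b \<le> c"
    and P: "\<Phi> \<in> fps_pfuns" "G \<in> fps_pfuns" "H \<in> fps_pfuns"
  defines "D \<equiv> yp c - fps_X"
  assumes D1: "\<And>e. D * \<Phi> e = yp b + cst e * G e"
    and D2: "\<And>e. D * (D * \<Phi> e) = yp b * D + cst e * (fps_X ^ (l - l') * \<Phi>' + cst e * H e)"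
  obtains e where "gram_pole l (\<Phi> e) (Suc s) (L + (c * l - b))"
proof -
  obtain f p where fint: "\<And>i m. i < s \<Longrightarrow> pole_le 0 (fps_nth (f i) m)"
    and fdeg: "\<And>i m. i < s \<Longrightarrow> m \<ge> s \<Longrightarrow> fps_nth (f i) m = 0"
    and p: "p \<ge> L" "fls_nth (gram_det l' s f \<Phi>') (- int p) \<noteq> 0"
    using g' unfolding gram_pole_def by blast
  \<comment> \<open>\<open>u i j e\<close> below is the new Gram matrix with the factor \<open>w e i\<close> of row \<open>i\<close> removed.\<close>
  define f' where "f' = (\<lambda>i. case i of 0 \<Rightarrow> 1 | Suc i \<Rightarrow> D * f i)"
  have Dnth: "fps_nth (D * q) m = fls_X ^ c * fps_nth q m - (if m = 0 then 0 else fps_nth q (m - 1))" for q m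
    unfolding D_def by (simp add: left_diff_distrib)
  have f'int: "pole_le 0 (fps_nth (f' i) m)" if "i < Suc s" for i m
    using that fint unfolding f'_def
    by (auto split: nat.split simp: Dnth intro!: pole_le_diff pole_le_mult_integral(1))
  have f'deg: "fps_nth (f' i) m = 0" if "i < Suc s" "m \<ge> Suc s" for i m
    using that fdeg unfolding f'_def by (auto split: nat.split simp: Dnth)
  define u where "u = (\<lambda>i j e. case i of
      0 \<Rightarrow> (case j of 0 \<Rightarrow> fps_nth (\<Phi> e) (l - 1) | Suc j \<Rightarrow> fls_const e * fps_nth (f j * G e) (l - 1))
    | Suc i \<Rightarrow> (case j of 0 \<Rightarrow> fps_nth (f i * G e) (l - 1)
         | Suc j \<Rightarrow> fps_nth (f i * f j * \<Phi>') (l' - 1) + fls_const e * fps_nth (f i * f j * H e) (l - 1)))"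
  define w where "w = (\<lambda>(e :: 'a) (i :: nat). if i = 0 then 1 else fls_const e)"
  have D\<Phi>: "fps_nth (f i * (D * \<Phi> e)) (l - 1) = fls_const e * fps_nth (f i * G e) (l - 1)" if "i < s" for i e
  proof -
    have e1: "fps_nth (f i) (l - 1) = 0" using fdeg[OF that] l that by simp
    have e2: "f i * (D * \<Phi> e) = yp b * f i + cst e * (f i * G e)"
      unfolding D1 by (simp add: algebra_simps)
    show ?thesis unfolding e2 fps_add_nth fps_mult_left_const_nth e1 by simp
  qed
  have DD\<Phi>: "fps_nth (f i * f j * (D * (D * \<Phi> e))) (l - 1) = fls_const e * (fps_nth (f i * f j * \<Phi>') (l' - 1) +
      fls_const e * fps_nth (f i * f j * H e) (l - 1))" if ij: "i < s" "j < s" for i j e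
  proof -
    have l': "1 \<le> l'" "l' < l" using l(1) ij by auto
    have z: "fps_nth (f i * f j) m = 0" if "m \<ge> 2 * s - 1" for m
      by (rule fps_nth_mult_eq_0[of s _ s]) (use fdeg ij that in auto)
    have "fps_nth (D * (f i * f j)) (l - 1) = 0"
      unfolding Dnth using z[of "l - 1"] z[of "l - 1 - 1"] l(2) ij by auto
    then have z2: "fps_nth (yp b * (D * (f i * f j))) (l - 1) = 0" by simp
    have e2: "f i * f j * (D * (D * \<Phi> e)) = yp b * (D * (f i * f j)) +
        cst e * (fps_X ^ (l - l') * (f i * f j * \<Phi>') + cst e * (f i * f j * H e))"
      unfolding D2 by (simp add: algebra_simps)
    have l2: "\<not> l - 1 < l - l'" "l - 1 - (l - l') = l' - 1" using l' by auto
    show ?thesis unfolding e2 fps_add_nth fps_mult_left_const_nth[of "fls_const e"] z2 fps_X_power_mult_nth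
      using l2 by simp
  qed
  have entry: "fps_nth (f' i * f' j * \<Phi> e) (l - 1) = w e i * u i j e" if ij: "i < Suc s" "j < Suc s" for i j e
  proof (cases i)
    case 0
    show ?thesis
    proof (cases j)
      case (Suc j')
      have eq: "f' i * f' j * \<Phi> e = f j' * (D * \<Phi> e)" unfolding f'_def 0 Suc by (simp add: algebra_simps)
      show ?thesis unfolding eq using D\<Phi>[of j' e] ij unfolding u_def w_def 0 Suc by simp
    qed (simp add: 0 f'_def u_def w_def)
  next
    case (Suc i')
    show ?thesis
    proof (cases j)
      case 0
      have eq: "f' i * f' j * \<Phi> e = f i' * (D * \<Phi> e)" unfolding f'_def 0 Suc by (simp add: algebra_simps)
      show ?thesis unfolding eq using D\<Phi>[of i' e] ij unfolding u_def w_def 0 Suc by simp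
    next
      case (Suc j')
      have eq: "f' i * f' j * \<Phi> e = f i' * f j' * (D * (D * \<Phi> e))"
        unfolding f'_def \<open>i = Suc i'\<close> Suc by (simp add: algebra_simps)
      show ?thesis unfolding eq using DD\<Phi>[of i' j' e] ij unfolding u_def w_def \<open>i = Suc i'\<close> Suc by simp
    qed
  qed
  define h where "h = (\<lambda>e. det (mat (Suc s) (Suc s) (\<lambda>(i, j). u i j e)))"
  have "(\<lambda>e. u i j e) \<in> pfuns" for i j
    unfolding u_def
    by (cases i; cases j) (auto intro!: pfuns_intros fls_const_pfuns fps_pfuns_nth fps_pfuns_mult fps_pfuns_const P)
  then have hP: "h \<in> pfuns" unfolding h_def by (intro pfuns_intros)
  have \<Phi>0: "fps_nth (\<Phi> 0) m = (fls_X_inv ^ c) ^ Suc m * fls_X ^ b" for m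
  proof -
    have D0: "D * \<Phi> 0 = yp b" using D1[of 0] by simp
    have step: "fps_nth (\<Phi> 0) m = fls_X_inv ^ c * (fps_nth (yp b) m + (if m = 0 then 0 else fps_nth (\<Phi> 0) (m - 1)))" for m
    proof -
      have "fls_X ^ c * fps_nth (\<Phi> 0) m = fps_nth (yp b) m + (if m = 0 then 0 else fps_nth (\<Phi> 0) (m - 1))"
        using Dnth[of "\<Phi> 0" m] unfolding D0 by simp
      then have "fls_X_inv ^ c * (fls_X ^ c * fps_nth (\<Phi> 0) m) =
         fls_X_inv ^ c * (fps_nth (yp b) m + (if m = 0 then 0 else fps_nth (\<Phi> 0) (m - 1)))" by simp
      then show ?thesis unfolding mult.assoc[symmetric] fls_X_inverse_power by simp
    qed
    show ?thesis
    proof (induction m)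
      case 0 show ?case by (subst step) simp
    next
      case (Suc m) show ?case by (subst step) (simp add: Suc mult.assoc)
    qed
  qed
  have b': "b \<le> c * l" using bc l(2) mult_le_mono2[of 1 l c] by linarith
  have u00: "u 0 0 0 = fls_X_inv ^ (c * l - b)"
    using l(2) b' fls_X_inv_power_mult_X_power(1)[OF b'] unfolding u_def
    by (simp add: \<Phi>0 power_mult[symmetric])
  have "h 0 = u 0 0 0 * det (mat s s (\<lambda>(i, j). u (Suc i) (Suc j) 0))"
    unfolding h_def by (rule det_first_row) (simp add: u_def)
  also have "det (mat s s (\<lambda>(i, j). u (Suc i) (Suc j) 0)) = gram_det l' s f \<Phi>'"
    unfolding gram_det_def u_def by simp
  finally have "fls_nth (h 0) (- int (p + (c * l - b))) \<noteq> 0"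
    using p(2) unfolding u00 by (simp add: fls_nth_X_inv_power_mult)
  from pfuns_generic[OF inf hP this] obtain e where e: "e \<noteq> 0" "fls_nth (h e) (- int (p + (c * l - b))) \<noteq> 0" .
  have "gram_det l (Suc s) f' (\<Phi> e) = det (mat (Suc s) (Suc s) (\<lambda>(i, j). w e i * u i j e))"
    unfolding gram_det_def by (intro arg_cong[of _ _ det] cong_mat refl) (simp only: prod.case entry)
  also have "\<dots> = fls_const (e ^ s) * h e"
    unfolding det_scale_rows h_def prod.lessThan_Suc_shift by (simp add: w_def fls_const_power)
  finally have "fls_nth (gram_det l (Suc s) f' (\<Phi> e)) (- int (p + (c * l - b))) \<noteq> 0" using e by simp
  then have "gram_pole l (\<Phi> e) (Suc s) (L + (c * l - b))"
    unfolding gram_pole_def using f'int f'deg p(1)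
    by (intro exI[of _ f'] conjI exI[of _ "p + (c * l - b)"]) auto
  then show thesis by (rule that)
qed

text \<open>With \<open>t\<^sub>l = 1\<close> and a small coupling \<open>\<epsilon>\<close> below \<open>l - 1\<close>, the series at \<open>\<epsilon> = 0\<close> is \<open>1 / (y\<^sup>a - x / y\<^sup>b)\<close>, hence equal to
  \<open>y\<^sup>b / (y\<^bsup>a+b\<^esup> - x)\<close>.\<close>

lemma gram_pole_pass_pair:
  fixes \<Phi>' :: "'a :: field fls fps"
  assumes inf: "infinite (UNIV :: 'a set)" and g': "gram_pole l' \<Phi>' s L"
    and l: "s = 0 \<or> 1 \<le> l'" "l' < l - 1" "2 * s + 1 \<le> l"
  obtains e where "gram_pole l (inverse (yp a - fps_X * inverse (yp b - cst e * fps_X ^ (l - 1 - l') * \<Phi>')))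
     (Suc s) (L + (a * l + b * (l - 1)))"
proof -
  define g where "g = fps_X ^ (l - 1 - l') * \<Phi>'"
  have g0: "fps_nth g 0 = 0" unfolding g_def using l by simp
  define \<Psi> where "\<Psi> = (\<lambda>e. inverse (yp b - cst e * g))"
  define \<Phi> where "\<Phi> = (\<lambda>e. inverse (yp a - fps_X * \<Psi> e))"
  have P: "\<Psi> \<in> fps_pfuns" unfolding \<Psi>_def
    by (rule fps_pfuns_inverse[of _ "fls_X ^ b"])
       (auto simp: g0 intro!: fps_pfuns_diff fps_pfuns_mult fps_pfuns_const fps_pfuns_cst)
  then have P': "\<Phi> \<in> fps_pfuns" unfolding \<Phi>_def
    by (intro fps_pfuns_inverse[of _ "fls_X ^ a"])
       (auto intro!: fps_pfuns_diff fps_pfuns_mult fps_pfuns_const)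
  have e1: "\<Psi> e * (yp b - cst e * g) = 1" for e
    unfolding \<Psi>_def by (rule inverse_mult_eq_1) (simp add: g0)
  have e2: "\<Phi> e * (yp a - fps_X * \<Psi> e) = 1" for e
    unfolding \<Phi>_def by (rule inverse_mult_eq_1) simp
  let ?D = "yp (a + b) - fps_X :: 'a fls fps"
  have yab: "(yp (a + b) :: 'a fls fps) = yp a * yp b" by (simp add: power_add)
  define G where "G = (\<lambda>e. g * (yp a * \<Phi> e - 1))"
  define H where "H = (\<lambda>e. yp a * g * G e)"
  have GP: "G \<in> fps_pfuns" unfolding G_def
    by (intro fps_pfuns_mult fps_pfuns_diff fps_pfuns_const P')
  have HP: "H \<in> fps_pfuns" unfolding H_def
    by (intro fps_pfuns_mult fps_pfuns_const GP)
  have D1: "?D * \<Phi> e = yp b + cst e * G e" for e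
  proof -
    have "\<Phi> e * (yp a * (yp b - cst e * g) - fps_X * (\<Psi> e * (yp b - cst e * g))) =
       \<Phi> e * (yp a - fps_X * \<Psi> e) * (yp b - cst e * g)" by (simp only: algebra_simps)
    then have "\<Phi> e * (yp a * (yp b - cst e * g) - fps_X) = yp b - cst e * g" unfolding e1 e2 by simp
    then have "?D * \<Phi> e = yp b - cst e * g + \<Phi> e * (yp a * (cst e * g))"
      unfolding yab by (simp only: algebra_simps)
    then show ?thesis unfolding G_def by (simp add: algebra_simps)
  qed
  have D2: "?D * (?D * \<Phi> e) = yp b * ?D + cst e * (fps_X ^ (l - l') * \<Phi>' + cst e * H e)" for e
  proof -
    have "?D * G e = g * (yp a * (?D * \<Phi> e) - ?D)" unfolding G_def by (simp only: algebra_simps mult_1_left mult_1_right)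
    also have "\<dots> = g * fps_X + cst e * H e"
      unfolding D1 unfolding H_def yab by (simp only: algebra_simps mult_1_left mult_1_right)
    also have "g * fps_X = fps_X ^ (l - l') * \<Phi>'"
    proof -
      have "l - l' = Suc (l - 1 - l')" using l by simp
      then show ?thesis unfolding g_def by (simp add: mult_ac)
    qed
    finally have DG: "?D * G e = fps_X ^ (l - l') * \<Phi>' + cst e * H e" .
    have "?D * (?D * \<Phi> e) = yp b * ?D + cst e * (?D * G e)"
      unfolding D1 by (simp only: algebra_simps)
    then show ?thesis unfolding DG .
  qed
  have L: "(a + b) * l - b = a * l + b * (l - 1)" using l by (cases l) (auto simp: add_mult_distrib)
  have l': "s = 0 \<or> 1 \<le> l' \<and> l' < l" using l by auto
  obtain e where "gram_pole l (\<Phi> e) (Suc s) (L + ((a + b) * l - b))"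
    by (rule gram_pole_pass_brace[OF inf g' l' l(3) _ P' GP HP D1 D2]) simp_all
  then show thesis using that[of e] unfolding \<Phi>_def \<Psi>_def g_def L by (simp add: mult.assoc)
qed

text \<open>Without a level \<open>l - 1\<close>, the loop \<open>w\<^sub>l\<close> with coefficient 1 takes its place: at \<open>\<epsilon> = 0\<close> the series is
  \<open>1 / (y\<^sup>a - x)\<close>.\<close>

lemma gram_pole_pass_single:
  fixes \<Phi>' :: "'a :: field fls fps"
  assumes inf: "infinite (UNIV :: 'a set)" and g': "gram_pole l' \<Phi>' s L"
    and l: "s = 0 \<or> 1 \<le> l'" "l' < l" "2 * s + 1 \<le> l"
  obtains e where "gram_pole l (inverse (yp a - fps_X - cst e * fps_X ^ (l - l') * \<Phi>')) (Suc s) (L + a * l)"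
proof -
  define g where "g = fps_X ^ (l - l') * \<Phi>'"
  have g0: "fps_nth g 0 = 0" unfolding g_def using l by simp
  define \<Phi> where "\<Phi> = (\<lambda>e. inverse (yp a - fps_X - cst e * g))"
  have P': "\<Phi> \<in> fps_pfuns" unfolding \<Phi>_def
    by (rule fps_pfuns_inverse[of _ "fls_X ^ a"])
       (auto simp: g0 intro!: fps_pfuns_diff fps_pfuns_mult fps_pfuns_const fps_pfuns_cst)
  have e1: "\<Phi> e * (yp a - fps_X - cst e * g) = 1" for e
    unfolding \<Phi>_def by (rule inverse_mult_eq_1) (simp add: g0)
  let ?D = "yp a - fps_X :: 'a fls fps"
  define G where "G = (\<lambda>e. g * \<Phi> e)"
  define H where "H = (\<lambda>e. g * G e)"
  have GP: "G \<in> fps_pfuns" unfolding G_def by (intro fps_pfuns_mult fps_pfuns_const P')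
  have HP: "H \<in> fps_pfuns" unfolding H_def by (intro fps_pfuns_mult fps_pfuns_const GP)
  have D1: "?D * \<Phi> e = yp 0 + cst e * G e" for e
  proof -
    have "?D * \<Phi> e = \<Phi> e * (yp a - fps_X - cst e * g) + cst e * G e"
      unfolding G_def by (simp add: algebra_simps)
    then show ?thesis unfolding e1 by simp
  qed
  have D2: "?D * (?D * \<Phi> e) = yp 0 * ?D + cst e * (fps_X ^ (l - l') * \<Phi>' + cst e * H e)" for e
  proof -
    have "?D * G e = g * (?D * \<Phi> e)" unfolding G_def by (simp only: mult_ac)
    also have "\<dots> = g + cst e * H e" unfolding D1 H_def by (simp add: distrib_left mult_ac)
    finally have DG: "?D * G e = fps_X ^ (l - l') * \<Phi>' + cst e * H e" unfolding g_def .
    have "?D * (?D * \<Phi> e) = yp 0 * ?D + cst e * (?D * G e)"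
      unfolding D1 by (simp only: algebra_simps)
    then show ?thesis unfolding DG .
  qed
  have l': "s = 0 \<or> 1 \<le> l' \<and> l' < l" using l by auto
  obtain e where "gram_pole l (\<Phi> e) (Suc s) (L + (a * l - 0))"
    by (rule gram_pole_pass_brace[OF inf g' l' l(3) _ P' GP HP D1 D2]) simp_all
  then show thesis using that[of e] unfolding \<Phi>_def g_def by (simp add: mult.assoc)
qed

section \<open>The continued fraction of a partition\<close>

fun top_part :: "nat list \<Rightarrow> nat" where
  "top_part [] = 0"
| "top_part (l # ls) = l"

text \<open>The continued fraction \<open>\<phi>\<^sub>l\<close> of the list of levels from \<open>l\<close> downwards; \<open>n\<close> gives the multiplicities. For
  the last level the term with \<open>t\<close> vanishes together with \<open>phi n t z []\<close>.\<close>

fun phi :: "(nat \<Rightarrow> nat) \<Rightarrow> (nat \<Rightarrow> 'a) \<Rightarrow> (nat \<Rightarrow> 'a) \<Rightarrow> nat list \<Rightarrow> 'a :: field fls fps" where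
  "phi n t z [] = 0"
| "phi n t z (l # ls) = inverse (yp (n l) - cst (z l) * fps_X -
      cst (t l) * fps_X ^ (l - top_part ls) * phi n t z ls)"

text \<open>Chains are treated as sets of parts in the following; \<open>gapped\<close> is the condition \<open>a\<^sub>i \<ge> a\<^bsub>i+1\<^esub> + 2\<close>.\<close>

definition gapped :: "nat set \<Rightarrow> bool" where
  "gapped X \<longleftrightarrow> (\<forall>x\<in>X. Suc x \<notin> X)"

definition brace_set :: "nat set \<Rightarrow> nat set" where
  "brace_set X = (\<Union>x\<in>X. {x, x - 1})"

definition below :: "nat set \<Rightarrow> nat \<Rightarrow> nat" where
  "below X l = card {x \<in> X. x < l}"

text \<open>The number of vertices covered by a chain, counting both ends of a row as if they did not overlap.\<close>

definition chain_bound :: "(nat \<Rightarrow> nat) \<Rightarrow> nat set \<Rightarrow> nat set \<Rightarrow> nat" where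
  "chain_bound n S X = (\<Sum>l\<in>S. n l * (if l \<in> brace_set X then l else 2 * below X l))"

lemma phi_cong:
  "(\<And>l. l \<in> set ls \<Longrightarrow> t l = t' l \<and> z l = z' l) \<Longrightarrow> phi n t z ls = phi n t' z' ls"
  by (induction ls) auto

text \<open>Guarantees that the coefficient of \<open>x\<^bsup>l-1\<^esup>\<close> lies beyond the degrees of the products of vectors.\<close>

lemma card_gapped:
  assumes "gapped X" "X \<subseteq> {1..m}"
  shows "2 * card X \<le> m + 1"
proof -
  have fin: "finite X" using assms(2) finite_subset by blast
  have "X \<inter> Suc ` X = {}" using assms(1) unfolding gapped_def by auto
  then have "card (X \<union> Suc ` X) = 2 * card X"
    using fin by (simp add: card_Un_disjoint card_image)
  moreover have "X \<union> Suc ` X \<subseteq> {1..m + 1}" using assms(2) by auto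
  then have "card (X \<union> Suc ` X) \<le> card {1..m + 1}" by (intro card_mono) auto
  ultimately show ?thesis by simp
qed

text \<open>Remove the top level, or the levels of the top brace, and apply the corresponding descent. The set \<open>Z\<close>
  consists of the levels at which a loop is available.\<close>

lemma exists_gram_pole:
  fixes n :: "nat \<Rightarrow> nat"
  assumes inf: "infinite (UNIV :: 'a :: field set)"
    and "sorted_wrt (>) ls" "0 \<notin> set ls" "X \<subseteq> set ls" "gapped X" "\<And>a. a \<in> X \<Longrightarrow> a - 1 \<in> set ls \<or> a \<in> Z"
  shows "\<exists>(t :: nat \<Rightarrow> 'a) z. (\<forall>l. l \<notin> Z \<longrightarrow> z l = 0) \<and>
    gram_pole (top_part ls) (phi n t z ls) (card X) (chain_bound n (set ls) X)"
  using assms(2-)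
proof (induction "length ls" arbitrary: ls X rule: less_induct)
  case less
  note srt = less.prems(1) and pos = less.prems(2) and X = less.prems(3) and gp = less.prems(4) and cnd = less.prems(5)
  have finX: "finite X" using X finite_subset by blast
  show ?case
  proof (cases "X = {}")
    case True
    then have "chain_bound n (set ls) X = 0" by (simp add: chain_bound_def brace_set_def below_def)
    then show ?thesis unfolding True
      by (intro exI[of _ "\<lambda>_. 0"] conjI) (simp_all add: gram_pole_0)
  next
    case False
    then obtain l ls' where ls: "ls = l # ls'" using X by (cases ls) auto
    have lt: "x < l" if "x \<in> set ls'" for x using srt that unfolding ls by auto
    have srt': "sorted_wrt (>) ls'" and l0: "0 < l" and pos': "0 \<notin> set ls'" using srt pos unfolding ls by auto
    have lnot: "l \<notin> set ls'" using lt by blast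
    \<comment> \<open>Either \<open>l\<close> is the maximum of \<open>X\<close>, or it belongs to no brace and the whole of \<open>X\<close> lies below.\<close>
    show ?thesis
    proof (cases "l \<in> X")
      case False
      have X': "X \<subseteq> set ls'" using X False unfolding ls by auto
      have cnd': "a - 1 \<in> set ls' \<or> a \<in> Z" if "a \<in> X" for a
        using cnd[OF that] lt[of a] X' that unfolding ls by auto
      obtain t :: "nat \<Rightarrow> 'a" and z where z: "\<And>l. l \<notin> Z \<Longrightarrow> z l = 0"
        and g: "gram_pole (top_part ls') (phi n t z ls') (card X) (chain_bound n (set ls') X)"
        using less.hyps[OF _ srt' pos' X' gp cnd'] unfolding ls by auto
      have "ls' \<noteq> []" using X' \<open>X \<noteq> {}\<close> by auto
      then have tp: "1 \<le> top_part ls'" "top_part ls' < l" using pos' lt by (cases ls'; force)+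
      have "X \<subseteq> {1..l - 1}"
      proof
        fix x assume "x \<in> X"
        then have "x \<in> set ls'" using X' by blast
        moreover from this have "x \<noteq> 0" using pos' by metis
        ultimately show "x \<in> {1..l - 1}" using lt[of x] by simp
      qed
      from card_gapped[OF gp this] l0 have card: "2 * card X \<le> l" by simp
      obtain e where e: "gram_pole l (inverse (yp (n l) - cst e * fps_X ^ (l - top_part ls') * phi n t z ls'))
          (card X) (chain_bound n (set ls') X + 2 * n l * card X)"
        using gram_pole_pass_level[OF inf g tp card] by blast
      have ph: "phi n (t(l := e)) (z(l := 0)) ls' = phi n t z ls'"
        using lnot by (intro phi_cong) auto
      have "l \<notin> brace_set X" using False X' lt unfolding brace_set_def by fastforce
      moreover have "{x \<in> X. x < l} = X" using X' lt by auto
      ultimately have "chain_bound n (set ls) X = chain_bound n (set ls') X + 2 * n l * card X"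
        unfolding chain_bound_def ls using lnot by (simp add: below_def)
      then show ?thesis
        using e z by (intro exI[of _ "t(l := e)"] exI[of _ "z(l := 0)"]) (simp add: ls ph)
    next
      case True
      define X1 where "X1 = X - {l}"
      have cardX: "card X = Suc (card X1)" unfolding X1_def using True finX by (metis card_Suc_Diff1)
      have gp1: "gapped X1" using gp unfolding X1_def gapped_def by auto
      have notl1: "l - 1 \<notin> X" using gp True l0 unfolding gapped_def by force
      have lt1: "x < l - 1" if "x \<in> X1" for x
      proof -
        have "x \<in> set ls'" using that X unfolding X1_def ls by auto
        moreover have "x \<noteq> l - 1" using that notl1 unfolding X1_def by auto
        ultimately show ?thesis using lt[of x] by linarith
      qed
      have "X1 \<subseteq> {1..l - 2}"
      proof
        fix x assume x: "x \<in> X1"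
        then have "x \<in> set ls" using X unfolding X1_def by blast
        then have "x \<noteq> 0" using pos by metis
        then show "x \<in> {1..l - 2}" using lt1[OF x] by auto
      qed
      from card_gapped[OF gp1 this] have card1: "2 * card X1 + 1 \<le> l"
        using l0 \<open>X1 \<subseteq> {1..l - 2}\<close> by (cases "l = 1") auto
      have brX: "x \<in> brace_set X \<longleftrightarrow> x = l \<or> x = l - 1 \<or> x \<in> brace_set X1" for x
        unfolding brace_set_def X1_def using True by auto
      have belowX: "below X x = below X1 x" if "x < l" for x
      proof -
        have "{y \<in> X. y < x} = {y \<in> X1. y < x}" using that unfolding X1_def by auto
        then show ?thesis unfolding below_def by simp
      qed
      have br1: "x \<notin> brace_set X1" if "x \<ge> l - 1" for x
        using lt1 that unfolding brace_set_def by fastforce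
      show ?thesis
      proof (cases "l - 1 \<in> set ls")
        case l1: True
        then have l1': "l - 1 \<in> set ls'" using l0 unfolding ls by auto
        obtain ls'' where ls'': "ls' = (l - 1) # ls''"
        proof (cases ls')
          case (Cons m ms)
          have "m = l - 1" using l1' srt' lt[of m] unfolding Cons by auto
          then show ?thesis using that Cons by blast
        qed (use l1' in simp)
        have "l - 1 \<noteq> 0" using l1' pos' by metis
        then have l2: "1 \<le> l - 1" by simp
        have lt2: "x < l - 1" if "x \<in> set ls''" for x using srt' that unfolding ls'' by auto
        have srt2: "sorted_wrt (>) ls''" "0 \<notin> set ls''" using srt' pos' unfolding ls'' by auto
        have X1': "X1 \<subseteq> set ls''"
          using X lt1 unfolding X1_def ls ls'' by fastforce
        have cnd1: "a - 1 \<in> set ls'' \<or> a \<in> Z" if a: "a \<in> X1" for a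
          using cnd[of a] lt1[OF a] a unfolding X1_def ls ls'' by auto
        obtain t :: "nat \<Rightarrow> 'a" and z where z: "\<And>l. l \<notin> Z \<Longrightarrow> z l = 0"
          and g: "gram_pole (top_part ls'') (phi n t z ls'') (card X1) (chain_bound n (set ls'') X1)"
          using less.hyps[OF _ srt2 X1' gp1 cnd1] unfolding ls ls'' by auto
        have tp: "card X1 = 0 \<or> 1 \<le> top_part ls''"
        proof (cases ls'')
          case Nil then show ?thesis using X1' by simp
        next
          case (Cons m ms) then show ?thesis using srt2(2) by (cases m) auto
        qed
        have tp2: "top_part ls'' < l - 1" using lt2 l2 by (cases ls'') auto
        obtain e where e: "gram_pole l (inverse (yp (n l) - fps_X * inverse (yp (n (l - 1)) -
             cst e * fps_X ^ (l - 1 - top_part ls'') * phi n t z ls''))) (Suc (card X1))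
             (chain_bound n (set ls'') X1 + (n l * l + n (l - 1) * (l - 1)))"
          using gram_pole_pass_pair[OF inf g tp tp2 card1] by blast
        let ?t = "t(l := 1, l - 1 := e)" and ?z = "z(l := 0, l - 1 := 0)"
        have ph: "phi n ?t ?z ls'' = phi n t z ls''"
          using lt2 by (intro phi_cong) force
        have ph2: "phi n ?t ?z ls = inverse (yp (n l) - fps_X * inverse (yp (n (l - 1)) -
             cst e * fps_X ^ (l - 1 - top_part ls'') * phi n t z ls''))"
        proof -
          have "l - (l - 1) = 1" "l \<noteq> l - 1" using l0 by auto
          then show ?thesis unfolding ls ls'' phi.simps ph top_part.simps by simp
        qed
        have "chain_bound n (set ls) X = n l * l + n (l - 1) * (l - 1) + chain_bound n (set ls'') X1"
        proof -
          have "l \<notin> insert (l - 1) (set ls'')" "l - 1 \<notin> set ls''" using lt2 l0 by force+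
          moreover have "(\<Sum>x\<in>set ls''. n x * (if x \<in> brace_set X then x else 2 * below X x)) = chain_bound n (set ls'') X1"
            unfolding chain_bound_def
            by (intro sum.cong refl) (use lt2 in \<open>force simp: brX belowX\<close>)
          ultimately show ?thesis unfolding ls ls'' chain_bound_def by (simp add: brX)
        qed
        then have "gram_pole l (phi n ?t ?z ls) (card X) (chain_bound n (set ls) X)"
          unfolding ph2 cardX using e by (simp add: add_ac)
        then show ?thesis using z by (intro exI[of _ ?t] exI[of _ ?z]) (simp add: ls)
      next
        case l1: False
        then have lZ: "l \<in> Z" using cnd[OF True] by blast
        have X1': "X1 \<subseteq> set ls'" using X unfolding X1_def ls by auto
        have cnd1: "a - 1 \<in> set ls' \<or> a \<in> Z" if a: "a \<in> X1" for a
          using cnd[of a] lt1[OF a] a unfolding X1_def ls by auto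
        obtain t :: "nat \<Rightarrow> 'a" and z where z: "\<And>l. l \<notin> Z \<Longrightarrow> z l = 0"
          and g: "gram_pole (top_part ls') (phi n t z ls') (card X1) (chain_bound n (set ls') X1)"
          using less.hyps[OF _ srt' pos' X1' gp1 cnd1] unfolding ls by auto
        have tp: "card X1 = 0 \<or> 1 \<le> top_part ls'"
        proof (cases ls')
          case Nil then show ?thesis using X1' by simp
        next
          case (Cons m ms) then show ?thesis using pos' by (cases m) auto
        qed
        have tp2: "top_part ls' < l" using lt l0 by (cases ls') auto
        obtain e where e: "gram_pole l (inverse (yp (n l) - fps_X - cst e * fps_X ^ (l - top_part ls') * phi n t z ls'))
             (Suc (card X1)) (chain_bound n (set ls') X1 + n l * l)"
          using gram_pole_pass_single[OF inf g tp tp2 card1] by blast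
        let ?t = "t(l := e)" and ?z = "z(l := 1)"
        have ph: "phi n ?t ?z ls' = phi n t z ls'"
          using lnot by (intro phi_cong) auto
        have "chain_bound n (set ls) X = n l * l + chain_bound n (set ls') X1"
        proof -
          have "l - 1 \<notin> set ls'" using l1 unfolding ls by simp
          then have "(\<Sum>x\<in>set ls'. n x * (if x \<in> brace_set X then x else 2 * below X x)) = chain_bound n (set ls') X1"
            unfolding chain_bound_def
            by (intro sum.cong refl) (use lt in \<open>force simp: brX belowX\<close>)
          then show ?thesis unfolding ls chain_bound_def using lnot by (simp add: brX)
        qed
        then have "gram_pole l (phi n ?t ?z ls) (card X) (chain_bound n (set ls) X)"
          unfolding cardX ls phi.simps ph using e by (simp add: add_ac)
        then show ?thesis using z lZ by (intro exI[of _ ?t] exI[of _ ?z]) (auto simp: ls)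
      qed
    qed
  qed
qed

section \<open>The linear family that contains the adequate matrices\<close>

definition param_coeff :: "nat list \<Rightarrow> (nat \<Rightarrow> 'a) \<Rightarrow> (nat \<Rightarrow> 'a) \<Rightarrow> (nat \<Rightarrow> nat \<Rightarrow> 'a) \<Rightarrow> (nat \<Rightarrow> 'a)
    \<Rightarrow> vertex \<Rightarrow> vertex \<Rightarrow> 'a :: field" where
  "param_coeff P s t t' z b b' =
     (\<Sum>i \<in> set P - {last P}. s i * elem_coeff (beta_map P i) b b' + t i * elem_coeff (alpha_map P i) b b') +
     (\<Sum>i \<in> set P. \<Sum>k \<in> {1..<count_list P i}. t' i k * elem_coeff (e_map i k) b b') +
     (\<Sum>l \<in> odd_mcs_mins P. z l * elem_coeff (w_map P l) b b')"

definition param_mat :: "nat list \<Rightarrow> (nat \<Rightarrow> 'a) \<Rightarrow> (nat \<Rightarrow> 'a) \<Rightarrow> (nat \<Rightarrow> nat \<Rightarrow> 'a) \<Rightarrow> (nat \<Rightarrow> 'a) \<Rightarrow> 'a :: field mat" where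
  "param_mat P s t t' z = endo_mat P (param_coeff P s t t' z)"

lemma adequate_param_mat:
  assumes "\<And>i. i \<in> set P - {last P} \<Longrightarrow> s i \<noteq> 0 \<and> t i \<noteq> 0"
    "\<And>i k. i \<in> set P \<Longrightarrow> k \<in> {1..<count_list P i} \<Longrightarrow> t' i k \<noteq> 0"
    "\<And>l. l \<in> odd_mcs_mins P \<Longrightarrow> z l \<noteq> 0"
  shows "adequate P (param_mat P s t t' z)"
  unfolding adequate_def param_mat_def param_coeff_def
  using assms by (intro exI[of _ s] exI[of _ t] exI[of _ t'] exI[of _ z] conjI) auto

lemma last_le:
  assumes "sorted_wrt (\<ge>) P" "i \<in> set P"
  shows "last P \<le> (i :: nat)"
  using assms by (induction P) (auto split: if_splits)

lemma prev_part_props: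
  assumes "sorted_wrt (\<ge>) P" "i \<in> set P - {last P}"
  shows "prev_part P i \<in> set P" "prev_part P i < i" "\<And>j. j \<in> set P \<Longrightarrow> j < i \<Longrightarrow> j \<le> prev_part P i"
proof -
  have "last P \<in> {s \<in> set P. s < i}" using assms last_le[OF assms(1), of i] by (cases P) auto
  then have "{s \<in> set P. s < i} \<noteq> {}" by blast
  then have "Max {s \<in> set P. s < i} \<in> {s \<in> set P. s < i}" by (intro Max_in) auto
  then show "prev_part P i \<in> set P" "prev_part P i < i" unfolding prev_part_def by auto
  show "j \<le> prev_part P i" if "j \<in> set P" "j < i" for j
    unfolding prev_part_def using that by (intro Max_ge) auto
qed

lemma odd_mcs_mins_subset: "odd_mcs_mins P \<subseteq> set P"
proof
  fix l assume "l \<in> odd_mcs_mins P"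
  then obtain M where M: "is_mcs (set P) M" "l = Min M" unfolding odd_mcs_mins_def by blast
  then obtain a b where "a \<le> b" "M = {a..b}" "M \<subseteq> set P" unfolding is_mcs_def by blast
  then show "l \<in> set P" using M(2) Min_in[of M] by auto
qed

text \<open>The entries of a matrix commuting with \<open>B\<close>, as a linear condition.\<close>

definition shift_invariant :: "nat list \<Rightarrow> (vertex \<Rightarrow> vertex \<Rightarrow> 'a :: field) \<Rightarrow> bool" where
  "shift_invariant P f \<longleftrightarrow> (\<forall>u i k u' j k'. (u, i, k) \<in> vertices P \<longrightarrow> (u', j, k') \<in> vertices P \<longrightarrow>
     (if u < i then f (u + 1, i, k) (u', j, k') else 0) = (if 1 < u' then f (u, i, k) (u' - 1, j, k') else 0))"

lemma shift_invariant_add: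
  "shift_invariant P f \<Longrightarrow> shift_invariant P g \<Longrightarrow> shift_invariant P (\<lambda>b b'. f b b' + g b b')"
  unfolding shift_invariant_def by (simp split: if_splits) (metis add_0)

lemma shift_invariant_smult:
  "shift_invariant P f \<Longrightarrow> shift_invariant P (\<lambda>b b'. a * f b b')"
  unfolding shift_invariant_def by (simp split: if_splits) (metis mult_zero_right)

lemma shift_invariant_sum:
  "(\<And>x. x \<in> S \<Longrightarrow> shift_invariant P (f x)) \<Longrightarrow> shift_invariant P (\<lambda>b b'. \<Sum>x\<in>S. f x b b')"
proof (induction S rule: infinite_finite_induct)
  case (insert x S)
  have "shift_invariant P (\<lambda>b b'. f x b b' + (\<Sum>x\<in>S. f x b b'))"
    by (rule shift_invariant_add) (use insert in blast)+
  then show ?case using insert(1,2) by simp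
qed (simp_all add: shift_invariant_def)

lemma shift_invariant_elemI:
  assumes "\<And>u i k u' j k'. (u, i, k) \<in> vertices P \<Longrightarrow> (u', j, k') \<in> vertices P \<Longrightarrow>
    u < i \<and> g (u + 1, i, k) = Some (u', j, k') \<longleftrightarrow> 1 < u' \<and> g (u, i, k) = Some (u' - 1, j, k')"
  shows "shift_invariant P (elem_coeff g)"
  unfolding shift_invariant_def elem_coeff_def
proof (intro allI impI)
  fix u i k u' j k' assume "(u, i, k) \<in> vertices P" "(u', j, k') \<in> vertices P"
  from assms[OF this] show "(if u < i then if g (u + 1, i, k) = Some (u', j, k') then 1 else 0 else 0) =
     (if 1 < u' then if g (u, i, k) = Some (u' - 1, j, k') then 1 else 0 else 0)" by argo
qed

lemma shift_invariant_elem: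
  assumes P: "sorted_wrt (\<ge>) P"
  shows "i \<in> set P - {last P} \<Longrightarrow> shift_invariant P (elem_coeff (beta_map P i))"
    and "i \<in> set P - {last P} \<Longrightarrow> shift_invariant P (elem_coeff (alpha_map P i))"
    and "shift_invariant P (elem_coeff (e_map i l))"
    and "shift_invariant P (elem_coeff (w_map P i))"
proof -
  show "shift_invariant P (elem_coeff (beta_map P i))" if i: "i \<in> set P - {last P}"
  proof (rule shift_invariant_elemI)
    fix u l k u' j k' assume "(u, l, k) \<in> vertices P" "(u', j, k') \<in> vertices P"
    then have "1 \<le> u" "u \<le> l" "1 \<le> u'" "u' \<le> j" by (auto simp: vertices_def)
    then show "u < l \<and> beta_map P i (u + 1, l, k) = Some (u', j, k') \<longleftrightarrow>
       1 < u' \<and> beta_map P i (u, l, k) = Some (u' - 1, j, k')"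
      using prev_part_props(2)[OF P i] unfolding beta_map_def by auto
  qed
  show "shift_invariant P (elem_coeff (alpha_map P i))" if i: "i \<in> set P - {last P}"
  proof (rule shift_invariant_elemI)
    fix u l k u' j k' assume "(u, l, k) \<in> vertices P" "(u', j, k') \<in> vertices P"
    then have "1 \<le> u" "u \<le> l" "1 \<le> u'" "u' \<le> j" by (auto simp: vertices_def)
    then show "u < l \<and> alpha_map P i (u + 1, l, k) = Some (u', j, k') \<longleftrightarrow>
       1 < u' \<and> alpha_map P i (u, l, k) = Some (u' - 1, j, k')"
      using prev_part_props(2)[OF P i] unfolding alpha_map_def by auto
  qed
  show "shift_invariant P (elem_coeff (e_map i l))"
  proof (rule shift_invariant_elemI)
    fix u m k u' j k' assume "(u, m, k) \<in> vertices P" "(u', j, k') \<in> vertices P"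
    then have "1 \<le> u" "u \<le> m" "1 \<le> u'" "u' \<le> j" by (auto simp: vertices_def)
    then show "u < m \<and> e_map i l (u + 1, m, k) = Some (u', j, k') \<longleftrightarrow>
       1 < u' \<and> e_map i l (u, m, k) = Some (u' - 1, j, k')"
      unfolding e_map_def by auto
  qed
  show "shift_invariant P (elem_coeff (w_map P i))"
  proof (rule shift_invariant_elemI)
    fix u m k u' j k' assume "(u, m, k) \<in> vertices P" "(u', j, k') \<in> vertices P"
    then have "1 \<le> u" "u \<le> m" "1 \<le> u'" "u' \<le> j" by (auto simp: vertices_def)
    then show "u < m \<and> w_map P i (u + 1, m, k) = Some (u', j, k') \<longleftrightarrow>
       1 < u' \<and> w_map P i (u, m, k) = Some (u' - 1, j, k')"
      unfolding w_map_def by auto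
  qed
qed

text \<open>The elementary maps commute with \<open>B\<close>, and none of them sends a vertex \<open>(1, i, k)\<close> to some \<open>(1, i, k')\<close>
  with \<open>k' \<le> k\<close>.\<close>

lemma param_mat_U_B:
  assumes P: "sorted_wrt (\<ge>) P"
  shows "param_mat P s t t' z \<in> U_B P"
  unfolding U_B_iff
proof (intro conjI)
  show c: "param_mat P s t t' z \<in> carrier_mat (sum_list P) (sum_list P)"
    unfolding param_mat_def by (rule endo_mat_carrier)
  have sh: "shift_invariant P (param_coeff P s t t' z)"
    unfolding param_coeff_def
    by (intro shift_invariant_add shift_invariant_sum shift_invariant_smult shift_invariant_elem[OF P])
  show "param_mat P s t t' z * B_mat P = B_mat P * param_mat P s t t' z"
    unfolding commutes_B_iff[OF c]
  proof (intro allI impI)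
    fix u i k u' j k' assume v: "(u, i, k) \<in> vertices P" "(u', j, k') \<in> vertices P"
    have 1: "coef P (param_mat P s t t' z) (u + 1, i, k) (u', j, k') = param_coeff P s t t' z (u + 1, i, k) (u', j, k')"
      if "u < i" unfolding param_mat_def by (rule coef_endo_mat) (use v that in \<open>auto simp: vertices_def\<close>)
    have 2: "coef P (param_mat P s t t' z) (u, i, k) (u' - 1, j, k') = param_coeff P s t t' z (u, i, k) (u' - 1, j, k')"
      if "1 < u'" unfolding param_mat_def by (rule coef_endo_mat) (use v that in \<open>auto simp: vertices_def\<close>)
    show "(if u < i then coef P (param_mat P s t t' z) (u + 1, i, k) (u', j, k') else 0) =
       (if 1 < u' then coef P (param_mat P s t t' z) (u, i, k) (u' - 1, j, k') else 0)"
      using sh[unfolded shift_invariant_def, rule_format, OF v] by (simp only: 1 2 cong: if_cong)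
  qed
  show "diagonal_free P (param_mat P s t t' z)"
    unfolding diagonal_free_def
  proof (intro allI impI)
    fix i k k' assume v: "(1, i, k) \<in> vertices P" "(1, i, k') \<in> vertices P" and k: "k' \<le> k"
    have "elem_coeff (beta_map P l) (1, i, k) (1, i, k') = (0 :: 'a)"
      "elem_coeff (alpha_map P l) (1, i, k) (1, i, k') = (0 :: 'a)" if "l \<in> set P - {last P}" for l
      using prev_part_props(2)[OF P that] by (auto simp: elem_coeff_def beta_map_def alpha_map_def)
    moreover have "elem_coeff (e_map l m) (1, i, k) (1, i, k') = (0 :: 'a)"
      "elem_coeff (w_map P l) (1, i, k) (1, i, k') = (0 :: 'a)" for l m
      using k by (auto simp: elem_coeff_def e_map_def w_map_def)
    ultimately show "coef P (param_mat P s t t' z) (1, i, k) (1, i, k') = 0"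
      unfolding param_mat_def coef_endo_mat[OF v] param_coeff_def by simp
  qed
qed

section \<open>The resolvent of a member of the family\<close>

lemma jordan_nil_pow_eq_0:
  assumes "r < sum_list q" "c < sum_list q" "sum_list q \<le> N"
  shows "((jordan_nil q :: 'a :: field mat) ^\<^sub>m N) $$ (r, c) = 0"
  using assms
proof (induction q arbitrary: r c)
  case (Cons m q)
  then show ?case by (subst jordan_nil_pow_Cons) auto
qed simp

lemma mpow_eq_0:
  fixes A :: "'a :: field mat"
  assumes A: "A \<in> carrier_mat n n" and q: "has_jordan_type A q" and rc: "r < n" "c < n"
  shows "mpow n A n r c = 0"
proof -
  obtain X Y where n: "n = sum_list q" and X: "X \<in> carrier_mat n n" and Y: "Y \<in> carrier_mat n n"
    and pow: "\<And>N. A ^\<^sub>m N = X * jordan_nil q ^\<^sub>m N * Y"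
    using has_jordan_typeE[OF A q] by metis
  have J: "(jordan_nil q :: 'a mat) ^\<^sub>m N \<in> carrier_mat n n" for N
    unfolding n by (rule pow_carrier_mat[OF jordan_nil_carrier])
  have "((jordan_nil q :: 'a mat) ^\<^sub>m n) $$ (a, b) = 0" if "a < n" "b < n" for a b
    using that jordan_nil_pow_eq_0[of a q b n] unfolding n by simp
  then show ?thesis unfolding mpow_eq[OF A rc] pow index_mult_three[OF X J Y rc] by simp
qed

text \<open>A solution of \<open>(y - A) \<psi> = d\<close> is unique: it is the resolvent applied to \<open>d\<close>.\<close>

lemma resolvent_solution:
  fixes A :: "'a :: field mat"
  assumes A: "A \<in> carrier_mat n n" and q: "has_jordan_type A q"
    and sol: "\<And>r. r < n \<Longrightarrow> fls_X * \<psi> r - (\<Sum>c<n. fls_const (A $$ (r, c)) * \<psi> c) = d r" and r: "r < n"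
  shows "(\<Sum>c<n. resolvent n A r c * d c) = \<psi> r"
proof -
  define act where "act = (\<lambda>N. \<Sum>c<n. fls_const (mpow n A N r c) * \<psi> c)"
  have act_Suc: "act (Suc N) = fls_X * act N - (\<Sum>l<n. fls_const (mpow n A N r l) * d l)" for N
  proof -
    have "act (Suc N) = (\<Sum>c<n. \<Sum>l<n. fls_const (mpow n A N r l) * (fls_const (A $$ (l, c)) * \<psi> c))"
      unfolding act_def mpow.simps fls_const_sum fls_const_mult_const[symmetric] sum_distrib_right
      by (simp only: mult.assoc)
    also have "\<dots> = (\<Sum>l<n. fls_const (mpow n A N r l) * (\<Sum>c<n. fls_const (A $$ (l, c)) * \<psi> c))"
      unfolding sum_distrib_left by (rule sum.swap)
    also have "\<dots> = (\<Sum>l<n. fls_X * (fls_const (mpow n A N r l) * \<psi> l) - fls_const (mpow n A N r l) * d l)"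
    proof (intro sum.cong refl)
      fix l assume "l \<in> {..<n}"
      then have eq: "(\<Sum>c<n. fls_const (A $$ (l, c)) * \<psi> c) = fls_X * \<psi> l - d l"
        using sol[of l] unfolding diff_eq_eq eq_diff_eq by (simp add: add.commute)
      show "fls_const (mpow n A N r l) * (\<Sum>c<n. fls_const (A $$ (l, c)) * \<psi> c) =
         fls_X * (fls_const (mpow n A N r l) * \<psi> l) - fls_const (mpow n A N r l) * d l"
        unfolding eq by (simp only: right_diff_distrib mult.left_commute)
    qed
    also have "\<dots> = fls_X * act N - (\<Sum>l<n. fls_const (mpow n A N r l) * d l)"
      unfolding act_def sum_subtractf sum_distrib_left ..
    finally show ?thesis .
  qed
  have tele: "(\<Sum>N<M. fls_X_inv ^ Suc N * (\<Sum>l<n. fls_const (mpow n A N r l) * d l)) = act 0 - fls_X_inv ^ M * act M" for M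
  proof (induction M)
    case (Suc M)
    have inv: "fls_X_inv * fls_X = (1 :: 'a fls)" using fls_X_inverse_power[of 1] by simp
    have eq: "(\<Sum>l<n. fls_const (mpow n A M r l) * d l) = fls_X * act M - act (Suc M)"
      using act_Suc[of M] by simp
    have "fls_X_inv ^ Suc M * (\<Sum>l<n. fls_const (mpow n A M r l) * d l) =
       (fls_X_inv * fls_X) * (fls_X_inv ^ M * act M) - fls_X_inv ^ Suc M * act (Suc M)"
      unfolding eq by (simp only: power_Suc right_diff_distrib mult_ac)
    then show ?case unfolding inv sum.lessThan_Suc Suc by simp
  qed simp
  have "act n = 0" unfolding act_def by (simp add: mpow_eq_0[OF A q r])
  moreover have "act 0 = \<psi> r"
  proof -
    have "act 0 = (\<Sum>c<n. if c = r then \<psi> c else 0)"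
      unfolding act_def by (intro sum.cong) auto
    then show ?thesis using r by simp
  qed
  moreover have "(\<Sum>c<n. resolvent n A r c * d c) =
      (\<Sum>N<n. fls_X_inv ^ Suc N * (\<Sum>l<n. fls_const (mpow n A N r l) * d l))"
    unfolding resolvent_def sum_distrib_left sum_distrib_right
    by (subst sum.swap) (simp only: mult.assoc)
  ultimately show ?thesis using tele[of n] by simp
qed

lemma sum_elem_coeff:
  fixes \<psi> :: "vertex \<Rightarrow> 'a :: field fls"
  assumes "\<And>b. b \<in> vertices P \<Longrightarrow> g b = Some b' \<longleftrightarrow> b = b0 \<and> cond" "cond \<Longrightarrow> b0 \<in> vertices P"
  shows "(\<Sum>b\<in>vertices P. fls_const (elem_coeff g b b') * \<psi> b) = (if cond then \<psi> b0 else 0)"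
proof -
  have "(\<Sum>b\<in>vertices P. fls_const (elem_coeff g b b') * \<psi> b) =
     (\<Sum>b\<in>vertices P. if b = b0 then if cond then \<psi> b else 0 else 0)"
    using assms(1) by (intro sum.cong refl) (auto simp: elem_coeff_def)
  also have "\<dots> = (if cond then \<psi> b0 else 0)"
    using assms(2) by (simp add: sum.delta[OF finite_vertices])
  finally show ?thesis .
qed

text \<open>The arrows that end in \<open>(u, j, k)\<close>. For \<open>k > 1\<close> there is only \<open>e\<^bsub>j,k-1\<^esub>\<close>. A row with \<open>k = 1\<close> is entered by \<open>\<beta>\<close> from
  the next larger part (the sum over \<open>i\<close> has at most one nonzero term), by \<open>\<alpha>\<^sub>j\<close> from the next smaller one, and by
  the loop \<open>w\<^sub>j\<close>.\<close>

lemma inflow_param_coeff: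
  fixes \<psi> :: "vertex \<Rightarrow> 'a :: field fls"
  assumes P: "sorted_wrt (\<ge>) P" and v: "(u, j, k) \<in> vertices P"
  shows "(\<Sum>b\<in>vertices P. fls_const (param_coeff P (\<lambda>_. 1) t (\<lambda>_ _. 1) z b (u, j, k)) * \<psi> b) =
    (if k = 1 then
      (\<Sum>i\<in>set P - {last P}. if j = prev_part P i then \<psi> (u, i, count_list P i) else 0) +
      (if j \<noteq> last P \<and> j - prev_part P j < u
       then fls_const (t j) * \<psi> (u + prev_part P j - j, prev_part P j, count_list P (prev_part P j)) else 0) +
      (if j \<in> odd_mcs_mins P \<and> 1 < u then fls_const (z j) * \<psi> (u - 1, j, count_list P j) else 0)
     else \<psi> (u, j, k - 1))"
proof -
  let ?V = "vertices P"
  let ?c = "\<lambda>g b. fls_const (elem_coeff g b (u, j, k) :: 'a)"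
  note v' = v[unfolded vertices_def, simplified]
  have jP: "j \<in> set P" using v' by simp
  have cnt: "1 \<le> count_list P i" if "i \<in> set P" for i
    using that count_list_0_iff[of P i] by linarith
  have beta: "(\<Sum>b\<in>?V. ?c (beta_map P i) b * \<psi> b) = (if j = prev_part P i \<and> k = 1 then \<psi> (u, i, count_list P i) else 0)"
    if i: "i \<in> set P - {last P}" for i
  proof (rule sum_elem_coeff)
    note p = prev_part_props(2)[OF P i]
    show "beta_map P i b = Some (u, j, k) \<longleftrightarrow> b = (u, i, count_list P i) \<and> (j = prev_part P i \<and> k = 1)" if "b \<in> ?V" for b
      using v' by (cases b) (auto simp: beta_map_def)
    show "(u, i, count_list P i) \<in> ?V" if "j = prev_part P i \<and> k = 1"
      using that p v' i cnt[of i] by (simp add: vertices_def)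
  qed
  have alpha: "(\<Sum>b\<in>?V. ?c (alpha_map P i) b * \<psi> b) = (if i = j \<and> k = 1 \<and> j - prev_part P j < u then
      \<psi> (u + prev_part P j - j, prev_part P j, count_list P (prev_part P j)) else 0)"
    if i: "i \<in> set P - {last P}" for i
  proof (rule sum_elem_coeff)
    note p = prev_part_props(1,2)[OF P i]
    show "alpha_map P i b = Some (u, j, k) \<longleftrightarrow>
       b = (u + prev_part P j - j, prev_part P j, count_list P (prev_part P j)) \<and> (i = j \<and> k = 1 \<and> j - prev_part P j < u)"
      if "b \<in> ?V" for b
      using v' that p by (cases b) (auto simp: alpha_map_def vertices_def)
    show "(u + prev_part P j - j, prev_part P j, count_list P (prev_part P j)) \<in> ?V"
      if "i = j \<and> k = 1 \<and> j - prev_part P j < u"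
      using that p v' cnt[of "prev_part P j"] by (auto simp: vertices_def)
  qed
  have e: "(\<Sum>b\<in>?V. ?c (e_map i l) b * \<psi> b) = (if i = j \<and> k = l + 1 then \<psi> (u, j, l) else 0)"
    if i: "i \<in> set P" "l \<in> {1..<count_list P i}" for i l
  proof (rule sum_elem_coeff)
    show "e_map i l b = Some (u, j, k) \<longleftrightarrow> b = (u, j, l) \<and> (i = j \<and> k = l + 1)" if "b \<in> ?V" for b
      using v' by (cases b) (auto simp: e_map_def)
    show "(u, j, l) \<in> ?V" if "i = j \<and> k = l + 1" using that v' i by (simp add: vertices_def)
  qed
  have w: "(\<Sum>b\<in>?V. ?c (w_map P i) b * \<psi> b) = (if i = j \<and> k = 1 \<and> 1 < u then \<psi> (u - 1, j, count_list P j) else 0)"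
    for i
  proof (rule sum_elem_coeff)
    show "w_map P i b = Some (u, j, k) \<longleftrightarrow> b = (u - 1, j, count_list P j) \<and> (i = j \<and> k = 1 \<and> 1 < u)" if "b \<in> ?V" for b
      using v' that by (cases b) (auto simp: w_map_def vertices_def)
    show "(u - 1, j, count_list P j) \<in> ?V" if "i = j \<and> k = 1 \<and> 1 < u" using that v' cnt[OF jP] by (auto simp: vertices_def)
  qed
  have fin: "finite (odd_mcs_mins P)" using odd_mcs_mins_subset finite_subset by blast
  have "(\<Sum>b\<in>?V. fls_const (param_coeff P (\<lambda>_. 1) t (\<lambda>_ _. 1) z b (u, j, k)) * \<psi> b) =
     (\<Sum>b\<in>?V. (\<Sum>i\<in>set P - {last P}. ?c (beta_map P i) b * \<psi> b + fls_const (t i) * (?c (alpha_map P i) b * \<psi> b)) +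
       (\<Sum>i\<in>set P. \<Sum>l\<in>{1..<count_list P i}. ?c (e_map i l) b * \<psi> b) +
       (\<Sum>i\<in>odd_mcs_mins P. fls_const (z i) * (?c (w_map P i) b * \<psi> b)))"
    unfolding param_coeff_def fls_plus_const[symmetric] fls_const_sum fls_const_mult_const[symmetric]
      distrib_right sum_distrib_right
    by (simp only: mult.assoc fls_const_1 mult_1_left)
  also have "\<dots> = (\<Sum>i\<in>set P - {last P}. (\<Sum>b\<in>?V. ?c (beta_map P i) b * \<psi> b) +
         fls_const (t i) * (\<Sum>b\<in>?V. ?c (alpha_map P i) b * \<psi> b)) +
       (\<Sum>i\<in>set P. \<Sum>l\<in>{1..<count_list P i}. \<Sum>b\<in>?V. ?c (e_map i l) b * \<psi> b) +
       (\<Sum>i\<in>odd_mcs_mins P. fls_const (z i) * (\<Sum>b\<in>?V. ?c (w_map P i) b * \<psi> b))"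
  proof -
    have "(\<Sum>b\<in>?V. \<Sum>i\<in>set P. \<Sum>l\<in>{1..<count_list P i}. ?c (e_map i l) b * \<psi> b) =
       (\<Sum>i\<in>set P. \<Sum>b\<in>?V. \<Sum>l\<in>{1..<count_list P i}. ?c (e_map i l) b * \<psi> b)" by (rule sum.swap)
    also have "\<dots> = (\<Sum>i\<in>set P. \<Sum>l\<in>{1..<count_list P i}. \<Sum>b\<in>?V. ?c (e_map i l) b * \<psi> b)"
      by (intro sum.cong refl sum.swap)
    finally show ?thesis unfolding sum.distrib sum_distrib_left
      by (simp only: sum.swap[of _ "?V"])
  qed
  also have "(\<Sum>i\<in>set P - {last P}. (\<Sum>b\<in>?V. ?c (beta_map P i) b * \<psi> b) +
         fls_const (t i) * (\<Sum>b\<in>?V. ?c (alpha_map P i) b * \<psi> b)) =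
     (if k = 1 then (\<Sum>i\<in>set P - {last P}. if j = prev_part P i then \<psi> (u, i, count_list P i) else 0) +
       (if j \<noteq> last P \<and> j - prev_part P j < u
       then fls_const (t j) * \<psi> (u + prev_part P j - j, prev_part P j, count_list P (prev_part P j)) else 0) else 0)"
  proof -
    have "(\<Sum>i\<in>set P - {last P}. \<Sum>b\<in>?V. ?c (beta_map P i) b * \<psi> b) =
      (\<Sum>i\<in>set P - {last P}. if j = prev_part P i \<and> k = 1 then \<psi> (u, i, count_list P i) else 0)"
      by (intro sum.cong refl beta)
    also have "\<dots> = (if k = 1 then \<Sum>i\<in>set P - {last P}. if j = prev_part P i then \<psi> (u, i, count_list P i) else 0 else 0)"
      by (cases "k = 1") simp_all
    finally have B: "(\<Sum>i\<in>set P - {last P}. \<Sum>b\<in>?V. ?c (beta_map P i) b * \<psi> b) = \<dots>" .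
    have A: "(\<Sum>i\<in>set P - {last P}. fls_const (t i) * (\<Sum>b\<in>?V. ?c (alpha_map P i) b * \<psi> b)) =
      (\<Sum>i\<in>set P - {last P}. if i = j then if k = 1 \<and> j - prev_part P j < u then fls_const (t j) *
        \<psi> (u + prev_part P j - j, prev_part P j, count_list P (prev_part P j)) else 0 else 0)"
      by (intro sum.cong refl) (simp only: alpha, simp)
    show ?thesis unfolding sum.distrib A B using jP by simp
  qed
  also have "(\<Sum>i\<in>set P. \<Sum>l\<in>{1..<count_list P i}. \<Sum>b\<in>?V. ?c (e_map i l) b * \<psi> b) =
     (if k = 1 then 0 else \<psi> (u, j, k - 1))"
  proof -
    have "(\<Sum>i\<in>set P. \<Sum>l\<in>{1..<count_list P i}. \<Sum>b\<in>?V. ?c (e_map i l) b * \<psi> b) =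
       (\<Sum>i\<in>set P. if i = j then (\<Sum>l\<in>{1..<count_list P i}. if l = k - 1 then \<psi> (u, j, l) else 0) else 0)"
    proof (intro sum.cong refl)
      fix i assume i: "i \<in> set P"
      have "(\<Sum>l\<in>{1..<count_list P i}. \<Sum>b\<in>?V. ?c (e_map i l) b * \<psi> b) =
        (\<Sum>l\<in>{1..<count_list P i}. if i = j \<and> k = l + 1 then \<psi> (u, j, l) else 0)"
        using e[OF i] by (intro sum.cong refl) simp
      also have "\<dots> = (if i = j then (\<Sum>l\<in>{1..<count_list P i}. if l = k - 1 then \<psi> (u, j, l) else 0) else 0)"
      proof (cases "i = j")
        case True
        have "(if i = j \<and> k = l + 1 then \<psi> (u, j, l) else 0) = (if l = k - 1 then \<psi> (u, j, l) else 0)"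
          if "l \<in> {1..<count_list P i}" for l using that True v' by auto
        then show ?thesis unfolding if_P[OF True] by (rule sum.cong[OF refl])
      qed simp
      finally show "(\<Sum>l\<in>{1..<count_list P i}. \<Sum>b\<in>?V. ?c (e_map i l) b * \<psi> b) = \<dots>" .
    qed
    also have "\<dots> = (\<Sum>l\<in>{1..<count_list P j}. if l = k - 1 then \<psi> (u, j, l) else 0)" using jP by simp
    also have "\<dots> = (if k = 1 then 0 else \<psi> (u, j, k - 1))" using v' by (subst sum.delta) auto
    finally show ?thesis .
  qed
  also have "(\<Sum>i\<in>odd_mcs_mins P. fls_const (z i) * (\<Sum>b\<in>?V. ?c (w_map P i) b * \<psi> b)) =
     (if k = 1 \<and> j \<in> odd_mcs_mins P \<and> 1 < u then fls_const (z j) * \<psi> (u - 1, j, count_list P j) else 0)"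
  proof -
    have "(\<Sum>i\<in>odd_mcs_mins P. fls_const (z i) * (\<Sum>b\<in>?V. ?c (w_map P i) b * \<psi> b)) =
      (\<Sum>i\<in>odd_mcs_mins P. if i = j then if k = 1 \<and> 1 < u then fls_const (z j) * \<psi> (u - 1, j, count_list P j) else 0 else 0)"
      by (intro sum.cong refl) (simp only: w, simp)
    then show ?thesis by (simp add: sum.delta[OF fin])
  qed
  finally show ?thesis by simp
qed

text \<open>Decreasing, since the continued fraction starts at the largest part.\<close>

definition levels :: "nat set \<Rightarrow> nat list" where
  "levels T = rev (sorted_list_of_set T)"

lemma levels_props:
  assumes "finite T"
  shows "set (levels T) = T" "sorted_wrt (>) (levels T)"
  unfolding levels_def using assms by (auto simp: sorted_wrt_rev)

lemma levels_Max:
  assumes fin: "finite T" and l: "l \<in> T" "\<And>i. i \<in> T \<Longrightarrow> i \<le> l"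
  shows "levels T = l # levels (T - {l})"
proof -
  have "sorted_list_of_set T = sorted_list_of_set (T - {l}) @ [l]"
  proof (rule sorted_distinct_set_unique)
    show "sorted (sorted_list_of_set (T - {l}) @ [l])" using fin l by (auto simp: sorted_append)
    show "distinct (sorted_list_of_set (T - {l}) @ [l])" using fin by simp
    show "set (sorted_list_of_set T) = set (sorted_list_of_set (T - {l}) @ [l])" using fin l by auto
  qed (use fin in simp_all)
  then show ?thesis unfolding levels_def by simp
qed

definition tail_phi :: "nat list \<Rightarrow> (nat \<Rightarrow> 'a) \<Rightarrow> (nat \<Rightarrow> 'a) \<Rightarrow> nat \<Rightarrow> 'a :: field fls fps" where
  "tail_phi P t z l = phi (count_list P) t z (levels {i \<in> set P. i \<le> l})"

lemma tail_phi_eq: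
  assumes P: "sorted_wrt (\<ge>) P" and l: "l \<in> set P"
  shows "(yp (count_list P l) - cst (z l) * fps_X -
     (if l = last P then 0 else cst (t l) * fps_X ^ (l - prev_part P l) * tail_phi P t z (prev_part P l))) *
     tail_phi P t z l = 1"
proof -
  let ?T = "{i \<in> set P. i < l}"
  have T: "{i \<in> set P. i \<le> l} - {l} = ?T" by auto
  have lev: "levels {i \<in> set P. i \<le> l} = l # levels ?T"
    by (rule levels_Max[of "{i \<in> set P. i \<le> l}" l, unfolded T]) (use l in auto)
  have "cst (t l) * fps_X ^ (l - top_part (levels ?T)) * phi (count_list P) t z (levels ?T) =
     (if l = last P then 0 else cst (t l) * fps_X ^ (l - prev_part P l) * tail_phi P t z (prev_part P l)) \<and>
     fps_nth (cst (t l) * fps_X ^ (l - top_part (levels ?T)) * phi (count_list P) t z (levels ?T)) 0 = 0"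
  proof (cases "l = last P")
    case True
    then have "?T = {}" using last_le[OF P] by force
    then have "levels ?T = []" by (simp only: levels_def sorted_list_of_set_empty rev.simps(1))
    then show ?thesis using True by simp
  next
    case False
    then have l': "l \<in> set P - {last P}" using l by simp
    note p = prev_part_props[OF P l']
    have Tp: "?T = {i \<in> set P. i \<le> prev_part P l}" using p by fastforce
    have "levels {i \<in> set P. i \<le> prev_part P l} =
        prev_part P l # levels ({i \<in> set P. i \<le> prev_part P l} - {prev_part P l})"
      by (rule levels_Max) (use p(1) in auto)
    then have "top_part (levels ?T) = prev_part P l" unfolding Tp by simp
    moreover have "l - prev_part P l \<noteq> 0" using p(2) by simp
    ultimately show ?thesis using False unfolding tail_phi_def Tp by simp
  qed
  then have e: "cst (t l) * fps_X ^ (l - top_part (levels ?T)) * phi (count_list P) t z (levels ?T) =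
     (if l = last P then 0 else cst (t l) * fps_X ^ (l - prev_part P l) * tail_phi P t z (prev_part P l))"
    and n0: "fps_nth (cst (t l) * fps_X ^ (l - top_part (levels ?T)) * phi (count_list P) t z (levels ?T)) 0 = 0"
    by blast+
  let ?U = "yp (count_list P l) - cst (z l) * fps_X -
     cst (t l) * fps_X ^ (l - top_part (levels ?T)) * phi (count_list P) t z (levels ?T)"
  have "fps_nth ?U 0 \<noteq> 0" unfolding fps_sub_nth n0 by simp
  then have "?U * inverse ?U = 1" by (rule inverse_mult_eq_1')
  moreover have "tail_phi P t z l = inverse ?U" unfolding tail_phi_def lev by simp
  ultimately show ?thesis unfolding e by simp
qed

text \<open>The solution of \<open>(y - A) \<psi> = d\<close>, where the right hand side has the coefficients of \<open>f\<close> in the row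
  \<open>(_, p\<^sub>1, 1)\<close>. With the coefficients on a row collected in a power series in \<open>x\<close>, the last row of level \<open>j\<close> carries
  \<open>f\<close> times the product of the continued fractions of all levels from the top down to \<open>j\<close>, and each step
  along a map \<open>e\<^bsub>j,k\<^esub>\<close> towards that row divides by \<open>y\<close>.\<close>

definition flow :: "nat list \<Rightarrow> (nat \<Rightarrow> 'a) \<Rightarrow> (nat \<Rightarrow> 'a) \<Rightarrow> 'a fls fps \<Rightarrow> vertex \<Rightarrow> 'a :: field fls" where
  "flow P t z f = (\<lambda>(u, j, k). fls_X ^ (count_list P j - k) *
     fps_nth (f * (\<Prod>i\<in>{i \<in> set P. j \<le> i}. tail_phi P t z i)) (u - 1))"

text \<open>Rows with \<open>k > 1\<close> are entered by one arrow only. In the first row of a level the equation is the defining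
  relation of the continued fraction, multiplied by \<open>f\<close> and the fractions of the larger levels.\<close>

lemma flow_solution:
  assumes P: "sorted_wrt (\<ge>) P" and v: "(u, j, k) \<in> vertices P"
    and z: "\<And>l. l \<notin> odd_mcs_mins P \<Longrightarrow> z l = 0"
  shows "fls_X * flow P t z f (u, j, k) -
      (\<Sum>b\<in>vertices P. fls_const (param_coeff P (\<lambda>_. 1) t (\<lambda>_ _. 1) z b (u, j, k)) * flow P t z f b) =
    (if j = Max (set P) \<and> k = 1 then fps_nth f (u - 1) else 0)"
proof -
  note v' = v[unfolded vertices_def, simplified]
  have j: "j \<in> set P" using v' by simp
  let ?o = "\<lambda>j. \<Prod>i\<in>{i \<in> set P. j \<le> i}. tail_phi P t z i"
  have flow: "flow P t z f (u, j, k) = fls_X ^ (count_list P j - k) * fps_nth (f * ?o j) (u - 1)" for u j k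
    unfolding flow_def by simp
  show ?thesis
  proof (cases "k = 1")
    case False
    then have "count_list P j - (k - 1) = Suc (count_list P j - k)" using v' by auto
    then show ?thesis unfolding inflow_param_coeff[OF P v] using False by (simp add: flow mult.assoc)
  next
    case True
    let ?n = "count_list P j"
    let ?p = "prev_part P j"
    have n1: "1 \<le> ?n" using v' by simp
    \<comment> \<open>\<open>f * N\<close> is what enters the level from above.\<close>
    define N where "N = (\<Prod>i\<in>{i \<in> set P. j < i}. tail_phi P t z i)"
    have oj: "?o j = tail_phi P t z j * N"
    proof -
      have "{i \<in> set P. j \<le> i} = insert j {i \<in> set P. j < i}" using j by auto
      then show ?thesis unfolding N_def by simp
    qed
    have op: "?o ?p = tail_phi P t z ?p * ?o j" if "j \<noteq> last P"
    proof -
      have j': "j \<in> set P - {last P}" using j that by simp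
      have "{i \<in> set P. ?p \<le> i} = insert ?p {i \<in> set P. j \<le> i}"
        using prev_part_props[OF P j'] by (auto simp: not_le)
           (metis le_less_linear le_antisym)
      moreover have "?p \<notin> {i \<in> set P. j \<le> i}" using prev_part_props(2)[OF P j'] by simp
      ultimately show ?thesis by simp
    qed
    have main: "fls_X ^ ?n * fps_nth (f * ?o j) (u - 1) - (if 1 < u then fls_const (z j) * fps_nth (f * ?o j) (u - 1 - 1) else 0) -
       (if j \<noteq> last P \<and> j - ?p < u then fls_const (t j) * fps_nth (f * ?o ?p) (u + ?p - j - 1) else 0) =
       fps_nth (f * N) (u - 1)"
    proof -
      let ?T = "if j = last P then 0 else cst (t j) * fps_X ^ (j - ?p) * tail_phi P t z ?p"
      have "(yp ?n - cst (z j) * fps_X - ?T) * ?o j = N"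
        using tail_phi_eq[OF P j, of z t] unfolding oj by (simp add: mult.assoc[symmetric])
      then have "f * N = f * ((yp ?n - cst (z j) * fps_X - ?T) * ?o j)" by simp
      also have "\<dots> = yp ?n * (f * ?o j) - cst (z j) * (fps_X * (f * ?o j)) - f * (?T * ?o j)"
        by (simp only: algebra_simps)
      also have "f * (?T * ?o j) = (if j = last P then 0 else cst (t j) * (fps_X ^ (j - ?p) * (f * ?o ?p)))"
        by (simp add: op mult_ac)
      finally have fN: "f * N = yp ?n * (f * ?o j) - cst (z j) * (fps_X * (f * ?o j)) -
        (if j = last P then 0 else cst (t j) * (fps_X ^ (j - ?p) * (f * ?o ?p)))" .
      have u1: "(u - 1 = 0) = (\<not> 1 < u)" using v' by auto
      have 1: "fps_nth (yp ?n * (f * ?o j)) (u - 1) = fls_X ^ ?n * fps_nth (f * ?o j) (u - 1)" by simp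
      have 2: "fps_nth (cst (z j) * (fps_X * (f * ?o j))) (u - 1) =
          (if 1 < u then fls_const (z j) * fps_nth (f * ?o j) (u - 1 - 1) else 0)"
        unfolding fps_mult_left_const_nth fps_X_mult_nth u1 by simp
      have 3: "fps_nth (if j = last P then 0 else cst (t j) * (fps_X ^ (j - ?p) * (f * ?o ?p))) (u - 1) =
          (if j \<noteq> last P \<and> j - ?p < u then fls_const (t j) * fps_nth (f * ?o ?p) (u + ?p - j - 1) else 0)"
      proof (cases "j = last P")
        case False
        then have pj: "?p < j" using prev_part_props(2)[OF P, of j] j by simp
        have e1: "(u - 1 < j - ?p) = (\<not> j - ?p < u)" "u - 1 - (j - ?p) = u + ?p - j - 1"
          using v' pj by auto
        show ?thesis using False unfolding if_not_P[OF False] fps_mult_left_const_nth fps_X_power_mult_nth e1 by simp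
      qed simp
      show ?thesis unfolding fN fps_sub_nth 1 2 3 ..
    qed
    have nx: "(\<Sum>i\<in>set P - {last P}. if j = prev_part P i then flow P t z f (u, i, count_list P i) else 0) =
       (if j = Max (set P) then 0 else fps_nth (f * N) (u - 1))"
    proof (cases "j = Max (set P)")
      case True
      have "j \<noteq> prev_part P i" if "i \<in> set P - {last P}" for i
      proof -
        have "i \<le> Max (set P)" using that by (intro Max_ge) auto
        then show ?thesis using prev_part_props(2)[OF P that] True by linarith
      qed
      then have "(\<Sum>i\<in>set P - {last P}. if j = prev_part P i then flow P t z f (u, i, count_list P i) else 0) = 0"
        by (intro sum.neutral) auto
      then show ?thesis using True by simp
    next
      case False
      define m where "m = Min {i \<in> set P. j < i}"
      have "j < Max (set P)" using False Max_ge[OF _ j] by (simp add: order_less_le)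
      moreover have "Max (set P) \<in> set P" using j by (intro Max_in) auto
      ultimately have ne: "{i \<in> set P. j < i} \<noteq> {}" by blast
      have m: "m \<in> set P" "j < m" using Min_in[OF _ ne] unfolding m_def by auto
      have mmin: "m \<le> i" if "i \<in> set P" "j < i" for i unfolding m_def using that by (intro Min_le) auto
      have ml: "m \<in> set P - {last P}" using m last_le[OF P j] by auto
      have prev: "j = prev_part P i \<longleftrightarrow> i = m" if i: "i \<in> set P - {last P}" for i
      proof
        assume jp: "j = prev_part P i"
        have "m \<le> i" using mmin[of i] prev_part_props(2)[OF P i] i jp by auto
        moreover have "\<not> m < i" using prev_part_props(3)[OF P i m(1)] m(2) jp by auto
        ultimately show "i = m" by simp
      next
        assume im: "i = m"
        have "j \<le> prev_part P m" using prev_part_props(3)[OF P ml j m(2)] .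
        moreover have "\<not> j < prev_part P m"
          using mmin[OF prev_part_props(1)[OF P ml]] prev_part_props(2)[OF P ml] by auto
        ultimately show "j = prev_part P i" unfolding im by simp
      qed
      have "(\<Sum>i\<in>set P - {last P}. if j = prev_part P i then flow P t z f (u, i, count_list P i) else 0) =
        (\<Sum>i\<in>set P - {last P}. if i = m then flow P t z f (u, i, count_list P i) else 0)"
        by (intro sum.cong refl) (simp add: prev)
      also have "\<dots> = flow P t z f (u, m, count_list P m)" using ml by simp
      also have "\<dots> = fps_nth (f * ?o m) (u - 1)" by (simp add: flow)
      also have "{i \<in> set P. m \<le> i} = {i \<in> set P. j < i}" using m mmin by auto
      finally show ?thesis using False unfolding N_def by simp
    qed
    have N1: "N = 1" if "j = Max (set P)"
    proof -
      have e: "{i \<in> set P. j < i} = {}" unfolding that using Max_ge[of "set P"] by (auto simp: not_less)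
      show ?thesis unfolding N_def e by simp
    qed
    have X: "fls_X * flow P t z f (u, j, k) = fls_X ^ ?n * fps_nth (f * ?o j) (u - 1)"
      using n1 unfolding flow True by (simp add: mult.assoc[symmetric] power_Suc[symmetric] del: power_Suc)
    have zj: "(if j \<in> odd_mcs_mins P \<and> 1 < u then fls_const (z j) * flow P t z f (u - 1, j, count_list P j) else 0) =
       (if 1 < u then fls_const (z j) * fps_nth (f * ?o j) (u - 1 - 1) else 0)"
      using z[of j] by (auto simp: flow)
    have tj: "(if j \<noteq> last P \<and> j - ?p < u then fls_const (t j) * flow P t z f (u + ?p - j, ?p, count_list P ?p) else 0) =
       (if j \<noteq> last P \<and> j - ?p < u then fls_const (t j) * fps_nth (f * ?o ?p) (u + ?p - j - 1) else 0)"
      by (simp add: flow)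
    show ?thesis unfolding inflow_param_coeff[OF P v] if_P[OF True] X nx zj tj
      using main True N1 by (auto simp: algebra_simps)
  qed
qed

text \<open>Feed \<open>f\<^sub>j\<close> into the first row of the top level and read off its last row against \<open>f\<^sub>i\<close> in reversed order: the
  resulting entry is the coefficient of \<open>x ^ (p\<^sub>1 - 1)\<close> in \<open>f\<^sub>i f\<^sub>j \<phi>\<close>. So the Gram determinant of the continued
  fraction is a determinant of the resolvent.\<close>

lemma gram_pole_jordan_type:
  fixes t z :: "nat \<Rightarrow> 'a :: field"
  assumes P: "sorted_wrt (\<ge>) P" and ne: "P \<noteq> []" and pos: "0 \<notin> set P"
    and z: "\<And>l. l \<notin> odd_mcs_mins P \<Longrightarrow> z l = 0"
    and q: "has_jordan_type (param_mat P (\<lambda>_. 1) t (\<lambda>_ _. 1) z) q"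
    and g: "gram_pole (Max (set P)) (phi (count_list P) t z (levels (set P))) s L"
  shows "L \<le> sum_list (take s q)"
proof -
  let ?A = "param_mat P (\<lambda>_. 1) t (\<lambda>_ _. 1) z"
  let ?n = "sum_list P"
  let ?m = "Max (set P)"
  have A: "?A \<in> carrier_mat ?n ?n" unfolding param_mat_def by (rule endo_mat_carrier)
  have m: "?m \<in> set P" "\<And>i. i \<in> set P \<Longrightarrow> i \<le> ?m" using ne by auto
  have "?m \<noteq> 0" using m(1) pos by metis
  then have m0: "0 < ?m" by simp
  obtain f p where fint: "\<And>i m. i < s \<Longrightarrow> pole_le 0 (fps_nth (f i) m)"
    and p: "p \<ge> L" "fls_nth (gram_det ?m s f (phi (count_list P) t z (levels (set P)))) (- int p) \<noteq> 0"
    using g unfolding gram_pole_def by blast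
  define D where "D = (\<lambda>c j. case vertex_list P ! c of (u, l, k) \<Rightarrow>
     if l = ?m \<and> k = 1 \<and> j < s then fps_nth (f j) (u - 1) else 0)"
  define C where "C = (\<lambda>i r. case vertex_list P ! r of (u, l, k) \<Rightarrow>
     if l = ?m \<and> k = count_list P ?m \<and> i < s then fps_nth (f i) (?m - u) else 0)"
  define \<psi> where "\<psi> = (\<lambda>j r. flow P t z (f j) (vertex_list P ! r))"
  have sol: "fls_X * \<psi> j r - (\<Sum>c<?n. fls_const (?A $$ (r, c)) * \<psi> j c) = D r j" if j: "j < s" and r: "r < ?n" for j r
  proof -
    obtain u l k where e: "vertex_list P ! r = (u, l, k)" by (metis prod_cases3)
    have v: "(u, l, k) \<in> vertices P" using nth_in_vertices[OF r] unfolding e .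
    have "(\<Sum>c<?n. fls_const (?A $$ (r, c)) * \<psi> j c) =
      (\<Sum>b\<in>vertices P. fls_const (param_coeff P (\<lambda>_. 1) t (\<lambda>_ _. 1) z b (u, l, k)) * flow P t z (f j) b)"
      unfolding sum_index_vertices
    proof (intro sum.cong refl)
      fix b assume b: "b \<in> vertices P"
      have "?A $$ (r, idx P b) = coef P ?A b (u, l, k)"
        unfolding coef_def e[symmetric] idx_nth[OF r] ..
      also have "\<dots> = param_coeff P (\<lambda>_. 1) t (\<lambda>_ _. 1) z b (u, l, k)"
        unfolding param_mat_def by (rule coef_endo_mat[OF b v])
      finally show "fls_const (?A $$ (r, idx P b)) * \<psi> j (idx P b) =
        fls_const (param_coeff P (\<lambda>_. 1) t (\<lambda>_ _. 1) z b (u, l, k)) * flow P t z (f j) b"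
        unfolding \<psi>_def nth_idx[OF b] by simp
    qed
    then show ?thesis using flow_solution[OF P v z, where t = t and f = "f j"] j unfolding \<psi>_def D_def e by simp
  qed
  have res: "(\<Sum>c<?n. resolvent ?n ?A r c * D c j) = \<psi> j r" if "j < s" "r < ?n" for j r
    by (rule resolvent_solution[OF A q sol[OF that(1)] that(2)])
  have entry: "(\<Sum>r<?n. \<Sum>c<?n. C i r * resolvent ?n ?A r c * D c j) =
     fps_nth (f i * f j * phi (count_list P) t z (levels (set P))) (?m - 1)" if ij: "i < s" "j < s" for i j
  proof -
    have "(\<Sum>r<?n. \<Sum>c<?n. C i r * resolvent ?n ?A r c * D c j) = (\<Sum>r<?n. C i r * \<psi> j r)"
      using res[OF ij(2)] by (intro sum.cong refl) (simp add: mult.assoc flip: sum_distrib_left)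
    also have "\<dots> = (\<Sum>b\<in>vertices P. (case b of (u, l, k) \<Rightarrow>
     if l = ?m \<and> k = count_list P ?m then fps_nth (f i) (?m - u) else 0) * flow P t z (f j) b)"
      unfolding sum_index_vertices C_def \<psi>_def using ij by (intro sum.cong refl) (simp add: nth_idx)
    also have "\<dots> = (\<Sum>b\<in>(\<lambda>a. (?m - a, ?m, count_list P ?m)) ` {0..?m - 1}. (case b of (u, l, k) \<Rightarrow>
     if l = ?m \<and> k = count_list P ?m then fps_nth (f i) (?m - u) else 0) * flow P t z (f j) b)"
    proof (rule sum.mono_neutral_right[OF finite_vertices])
      have c1: "1 \<le> count_list P ?m" using m(1) count_list_0_iff[of P ?m] by linarith
      show "(\<lambda>a. (?m - a, ?m, count_list P ?m)) ` {0..?m - 1} \<subseteq> vertices P"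
        using m(1) c1 m0 by (auto simp: vertices_def)
      show "\<forall>b\<in>vertices P - (\<lambda>a. (?m - a, ?m, count_list P ?m)) ` {0..?m - 1}. (case b of (u, l, k) \<Rightarrow>
        if l = ?m \<and> k = count_list P ?m then fps_nth (f i) (?m - u) else 0) * flow P t z (f j) b = 0"
      proof
        fix b assume b: "b \<in> vertices P - (\<lambda>a. (?m - a, ?m, count_list P ?m)) ` {0..?m - 1}"
        obtain u l k where e: "b = (u, l, k)" by (metis prod_cases3)
        have "\<not> (l = ?m \<and> k = count_list P ?m)"
        proof
          assume lk: "l = ?m \<and> k = count_list P ?m"
          have "1 \<le> u" "u \<le> ?m" using b lk unfolding e by (auto simp: vertices_def)
          then have "b = (\<lambda>a. (?m - a, ?m, count_list P ?m)) (?m - u)" "?m - u \<in> {0..?m - 1}"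
            using lk unfolding e by auto
          then show False using b by blast
        qed
        then show "(case b of (u, l, k) \<Rightarrow> if l = ?m \<and> k = count_list P ?m then fps_nth (f i) (?m - u) else 0) *
          flow P t z (f j) b = 0" unfolding e by auto
      qed
    qed
    also have "\<dots> = (\<Sum>a\<in>{0..?m - 1}. fps_nth (f i) (?m - (?m - a)) * flow P t z (f j) (?m - a, ?m, count_list P ?m))"
      by (subst sum.reindex) (auto simp: inj_on_def)
    also have "\<dots> = (\<Sum>a\<in>{0..?m - 1}. fps_nth (f i) a * fps_nth (f j * tail_phi P t z ?m) (?m - 1 - a))"
    proof (intro sum.cong refl)
      fix a assume a: "a \<in> {0..?m - 1}"
      have "{i \<in> set P. ?m \<le> i} = {?m}" using m by (auto intro: antisym)
      then show "fps_nth (f i) (?m - (?m - a)) * flow P t z (f j) (?m - a, ?m, count_list P ?m) =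
        fps_nth (f i) a * fps_nth (f j * tail_phi P t z ?m) (?m - 1 - a)"
        using a by (cases "?m = 0") (simp_all add: flow_def)
    qed
    also have "\<dots> = fps_nth (f i * f j * tail_phi P t z ?m) (?m - 1)"
      unfolding mult.assoc by (simp add: fps_mult_nth[of "f i"])
    also have "tail_phi P t z ?m = phi (count_list P) t z (levels (set P))"
    proof -
      have "{i \<in> set P. i \<le> ?m} = set P" using m by auto
      then show ?thesis unfolding tail_phi_def by simp
    qed
    finally show ?thesis .
  qed
  have "sandwich ?n s C (resolvent ?n ?A) D =
     mat s s (\<lambda>(i, j). fps_nth (f i * f j * phi (count_list P) t z (levels (set P))) (?m - 1))"
    unfolding sandwich_def by (rule cong_mat[OF refl refl]) (simp only: prod.case entry)
  then have "det (sandwich ?n s C (resolvent ?n ?A) D) = gram_det ?m s f (phi (count_list P) t z (levels (set P)))"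
    unfolding gram_det_def by simp
  moreover have "pole_le (sum_list (take s q)) (det (sandwich ?n s C (resolvent ?n ?A) D))"
  proof (rule pole_le_det_sandwich_resolvent[OF A q])
    show "pole_le 0 (C i r)" for i r unfolding C_def using fint by (auto split: prod.split)
    show "pole_le 0 (D c j)" for c j unfolding D_def using fint by (auto split: prod.split)
  qed
  ultimately have "p \<le> sum_list (take s q)" using p(2) unfolding pole_le_def by force
  then show ?thesis using p(1) by simp
qed

section \<open>Combinatorics of chains\<close>

text \<open>The set covered by a chain. Parts below the smallest chain element need no separate treatment, as nothing of the
  chain is below them.\<close>

definition uset :: "nat list \<Rightarrow> nat set \<Rightarrow> vertex set" where
  "uset P X = {(u, l, k) \<in> vertices P. l \<in> brace_set X \<or> u \<le> below X l \<or> l + 1 \<le> u + below X l}"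

lemma chain_list_props:
  assumes "successively (\<lambda>x y. x \<ge> y + 2) (a :: nat list)"
  shows "sorted_wrt (\<lambda>x y. x \<ge> y + 2) a"
  using assms by (subst successively_conv_sorted_wrt[symmetric]) (auto simp: transp_def)

lemma chain_index_set:
  assumes "chain_index P a"
  shows "gapped (set a)" "set a \<subseteq> set P" "distinct a" "U_chain P a = uset P (set a)"
proof -
  have srt: "sorted_wrt (\<lambda>x y. x \<ge> y + 2) a" and sub: "set a \<subseteq> set P"
    using assms chain_list_props unfolding chain_index_def by blast+
  show "set a \<subseteq> set P" by (rule sub)
  have nth: "a ! i \<ge> a ! j + 2" if "i < j" "j < length a" for i j
    using sorted_wrt_nth_less[OF srt that] .
  show dist: "distinct a"
    unfolding distinct_conv_nth
  proof (intro allI impI)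
    fix i j assume "i < length a" "j < length a" "i \<noteq> j"
    then show "a ! i \<noteq> a ! j" using nth[of i j] nth[of j i] by (cases i j rule: linorder_cases) auto
  qed
  show "gapped (set a)"
    unfolding gapped_def
  proof
    fix x assume "x \<in> set a"
    then obtain i where i: "i < length a" "x = a ! i" by (metis in_set_conv_nth)
    show "Suc x \<notin> set a"
    proof
      assume "Suc x \<in> set a"
      then obtain j where j: "j < length a" "Suc x = a ! j" by (metis in_set_conv_nth)
      then show False using i nth[of i j] nth[of j i] by (cases i j rule: linorder_cases) auto
    qed
  qed
  have below: "num_below a l = below (set a) l" for l
  proof -
    have "inj_on (nth a) {i. i < length a \<and> a ! i < l}"
      by (rule inj_on_nth[OF dist]) auto
    then have "card ((nth a) ` {i. i < length a \<and> a ! i < l}) = num_below a l"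
      unfolding num_below_def by (rule card_image)
    moreover have "(nth a) ` {i. i < length a \<and> a ! i < l} = {x \<in> set a. x < l}"
      unfolding set_conv_nth by blast
    ultimately show ?thesis unfolding below_def by simp
  qed
  have last: "below (set a) l = 0" if "a \<noteq> []" "l \<le> last a" for l
  proof -
    have "last a \<le> x" if "x \<in> set a" for x
    proof -
      from \<open>x \<in> set a\<close> obtain i where i: "i < length a" "a ! i = x" by (auto simp: in_set_conv_nth)
      have "a ! (length a - 1) \<le> a ! i" 
      proof (cases "i = length a - 1")
        case False
        then have "i < length a - 1" "length a - 1 < length a" using i(1) by linarith+
        then show ?thesis using nth[of i "length a - 1"] by linarith
      qed simp
      then show ?thesis unfolding i(2) last_conv_nth[OF \<open>a \<noteq> []\<close>] .
    qed
    then have "{x \<in> set a. x < l} = {}" using that(2) by force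
    then show ?thesis unfolding below_def by (simp only: card.empty)
  qed
  have br: "braces a = brace_set (set a)" unfolding braces_def brace_set_def ..
  have nil: "below {} l = 0" "brace_set {} = {}" for l unfolding below_def brace_set_def by auto
  show "U_chain P a = uset P (set a)"
  proof (cases "a = []")
    case True
    then show ?thesis unfolding U_chain_def uset_def below br by (auto simp: nil vertices_def)
  next
    case False
    have "l > last a \<or> \<not> (u \<le> below (set a) l \<or> l + 1 \<le> u + below (set a) l)"
      if "(u, l, k) \<in> vertices P" for u l k
      using last[OF False, of l] that by (cases "l > last a") (auto simp: vertices_def)
    then show ?thesis unfolding U_chain_def uset_def below br by auto
  qed
qed

lemma chain_index_levels:
  assumes "gapped X" "X \<subseteq> set P" "sorted_wrt (>) a" "set a = X"
  shows "chain_index P a"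
proof -
  have "successively (\<lambda>x y. x \<ge> y + 2) a"
    unfolding successively_conv_nth
  proof (intro allI impI)
    fix i assume i: "Suc i < length a"
    have "a ! i > a ! Suc i" using sorted_wrt_nth_less[OF assms(3)] i by simp
    moreover have "a ! i \<in> X" "a ! Suc i \<in> X" using i assms(4) by auto
    then have "a ! i \<noteq> Suc (a ! Suc i)" using assms(1) unfolding gapped_def by metis
    ultimately show "a ! i \<ge> a ! Suc i + 2" by simp
  qed
  then show ?thesis unfolding chain_index_def using assms by simp
qed

lemma card_uset_le: "card (uset P X) \<le> chain_bound (count_list P) (set P) X"
proof -
  define U where "U = (\<lambda>l. (if l \<in> brace_set X then {1..l} else {1..below X l} \<union> {l + 1 - below X l..l}))"
  have "uset P X \<subseteq> (\<Union>l\<in>set P. (\<lambda>(u, k). (u, l, k)) ` (U l \<times> {1..count_list P l}))"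
  proof
    fix b assume "b \<in> uset P X"
    then obtain u l k where "b = (u, l, k)" "(u, l, k) \<in> vertices P"
      "l \<in> brace_set X \<or> u \<le> below X l \<or> l + 1 \<le> u + below X l" unfolding uset_def by auto
    then have "l \<in> set P" "b = (\<lambda>(u, k). (u, l, k)) (u, k)" "(u, k) \<in> U l \<times> {1..count_list P l}"
      unfolding U_def vertices_def by auto
    then show "b \<in> (\<Union>l\<in>set P. (\<lambda>(u, k). (u, l, k)) ` (U l \<times> {1..count_list P l}))" by blast
  qed
  moreover have "finite (\<Union>l\<in>set P. (\<lambda>(u, k). (u, l, k)) ` (U l \<times> {1..count_list P l}))"
    unfolding U_def by auto
  ultimately have "card (uset P X) \<le> card (\<Union>l\<in>set P. (\<lambda>(u, k). (u, l, k)) ` (U l \<times> {1..count_list P l}))"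
    by (rule card_mono[rotated])
  also have "\<dots> \<le> (\<Sum>l\<in>set P. card ((\<lambda>(u, k). (u, l, k)) ` (U l \<times> {1..count_list P l})))"
    by (rule card_UN_le) simp
  also have "\<dots> \<le> (\<Sum>l\<in>set P. count_list P l * (if l \<in> brace_set X then l else 2 * below X l))"
  proof (rule sum_mono)
    fix l
    have "card (U l) \<le> (if l \<in> brace_set X then l else 2 * below X l)"
    proof (cases "l \<in> brace_set X")
      case False
      have "card ({1..below X l} \<union> {l + 1 - below X l..l}) \<le> card {1..below X l} + card {l + 1 - below X l..l}"
        by (rule card_Un_le)
      also have "\<dots> \<le> 2 * below X l" by simp
      finally show ?thesis using False unfolding U_def by simp
    qed (simp add: U_def)
    then have "card (U l \<times> {1..count_list P l}) \<le> (if l \<in> brace_set X then l else 2 * below X l) * count_list P l"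
      by (simp add: card_cartesian_product)
    moreover have "finite (U l \<times> {1..count_list P l})" unfolding U_def by auto
    ultimately show "card ((\<lambda>(u, k). (u, l, k)) ` (U l \<times> {1..count_list P l})) \<le>
      count_list P l * (if l \<in> brace_set X then l else 2 * below X l)"
      using card_image_le by (metis (no_types, lifting) le_trans mult.commute)
  qed
  finally show ?thesis unfolding chain_bound_def .
qed

lemma below_insert:
  assumes "finite Y" "x \<notin> Y"
  shows "below (insert x Y) l = (if x < l then 1 else 0) + below Y l"
proof (cases "x < l")
  case True
  have "{y \<in> insert x Y. y < l} = insert x {y \<in> Y. y < l}" using True by auto
  then show ?thesis unfolding below_def using True assms by simp
next
  case False
  have "{y \<in> insert x Y. y < l} = {y \<in> Y. y < l}" using False by auto
  then show ?thesis unfolding below_def using False by simp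
qed

lemma brace_set_insert: "brace_set (insert x Y) = {x, x - 1} \<union> brace_set Y"
  unfolding brace_set_def by auto

text \<open>Vertices outside the braces are covered from both ends of their row, to a depth that depends only on the number
  of chain elements below.\<close>

lemma uset_mono:
  assumes "\<And>l. l \<in> set P \<Longrightarrow> l \<in> brace_set X \<Longrightarrow> l \<in> brace_set X'"
    and "\<And>l. l \<in> set P \<Longrightarrow> l \<notin> brace_set X' \<Longrightarrow> below X l \<le> below X' l"
  shows "uset P X \<subseteq> uset P X'"
proof
  fix b assume b: "b \<in> uset P X"
  then obtain u l k where e: "b = (u, l, k)" and v: "(u, l, k) \<in> vertices P"
    and c: "l \<in> brace_set X \<or> u \<le> below X l \<or> l + 1 \<le> u + below X l" unfolding uset_def by auto
  have l: "l \<in> set P" using v by (simp add: vertices_def)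
  have "l \<in> brace_set X' \<or> u \<le> below X' l \<or> l + 1 \<le> u + below X' l"
    using c assms(1)[OF l] assms(2)[OF l] by fastforce
  then show "b \<in> uset P X'" unfolding e uset_def using v by simp
qed

text \<open>Inserting an uncovered part \<open>l\<close>: if \<open>l - 1\<close> is in the way, remove it and repair the loss of \<open>l - 2\<close>
  by inserting \<open>l - 2\<close> in the same manner.  The cardinality grows unless the repair stops at a gap of \<open>S\<close>.\<close>

lemma insert_part:
  assumes "finite X" "0 \<notin> S" "gapped X" "X \<subseteq> S" "l \<in> S" "l \<notin> X" "Suc l \<notin> X"
  shows "\<exists>X'. finite X' \<and> gapped X' \<and> X' \<subseteq> S \<and> l \<in> X' \<and> (\<forall>x>l. x \<in> X' \<longleftrightarrow> x \<in> X) \<and>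
    (card X' = card X \<or> card X' = Suc (card X)) \<and> (\<forall>m\<in>S. m \<in> brace_set X \<longrightarrow> m \<in> brace_set X') \<and>
    (\<forall>m\<in>S. m \<notin> brace_set X' \<longrightarrow> below X m \<le> below X' m)"
  using assms
proof (induction l arbitrary: X rule: less_induct)
  case (less l)
  note fin = less.prems(1) and S0 = less.prems(2) and gp = less.prems(3) and XS = less.prems(4)
    and lS = less.prems(5) and lX = less.prems(6,7)
  show ?case
  proof (cases "l - 1 \<in> X")
    case False
    have g: "gapped (insert l X)" using gp lX False unfolding gapped_def by auto
    show ?thesis
      by (rule exI[of _ "insert l X"])
         (use g fin lX lS XS in \<open>auto simp: brace_set_insert below_insert\<close>)
  next
    case True
    then have l2: "2 \<le> l" using S0 XS lX by (cases l; cases "l - 1") auto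
    define Y where "Y = X - {l - 1}"
    have X: "X = insert (l - 1) Y" and nY: "l - 1 \<notin> Y" using True unfolding Y_def by auto
    have finY: "finite Y" and gY: "gapped Y" and YS: "Y \<subseteq> S" and lY: "l \<notin> Y" "Suc l \<notin> Y"
      using fin gp XS lX unfolding Y_def gapped_def by auto
    have cX: "card X = Suc (card Y)" unfolding X using finY nY by simp
    have brX: "brace_set X = {l - 1, l - 2} \<union> brace_set Y" unfolding X brace_set_insert by (simp add: numeral_2_eq_2)
    have bX: "below X m = (if l - 1 < m then 1 else 0) + below Y m" for m
      unfolding X by (rule below_insert[OF finY nY])
    show ?thesis
    proof (cases "l - 2 \<in> S")
      case False
      have g: "gapped (insert l Y)" using gY lY nY unfolding gapped_def by auto
      have b: "below X m \<le> below (insert l Y) m" if "m \<noteq> l" for m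
        unfolding bX below_insert[OF finY lY(1)] using that by auto
      have "l - Suc (Suc 0) \<notin> S" using False unfolding numeral_2_eq_2 .
      then show ?thesis
        by (intro exI[of _ "insert l Y"])
           (use g finY lY lS YS cX b in \<open>auto simp: brX brace_set_insert X\<close>)
    next
      case l2S: True
      have "l - 2 \<notin> Y" "Suc (l - 2) \<notin> Y"
        using gp True l2 nY unfolding Y_def gapped_def by (auto simp: numeral_2_eq_2 Suc_diff_Suc)
      from less.IH[OF _ finY S0 gY YS l2S this] l2
      obtain Y' where Y': "finite Y'" "gapped Y'" "Y' \<subseteq> S" "l - 2 \<in> Y'"
        and same: "\<And>x. x > l - 2 \<Longrightarrow> x \<in> Y' \<longleftrightarrow> x \<in> Y"
        and card: "card Y' = card Y \<or> card Y' = Suc (card Y)"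
        and br: "\<And>m. m \<in> S \<Longrightarrow> m \<in> brace_set Y \<Longrightarrow> m \<in> brace_set Y'"
        and bl: "\<And>m. m \<in> S \<Longrightarrow> m \<notin> brace_set Y' \<Longrightarrow> below Y m \<le> below Y' m" by auto
      have n: "l \<notin> Y'" "Suc l \<notin> Y'" "l - 1 \<notin> Y'" using same[of l] same[of "Suc l"] same[of "l - 1"] lY nY l2 by auto
      have g: "gapped (insert l Y')" using Y'(2) n unfolding gapped_def by auto
      have c: "card (insert l Y') = card X \<or> card (insert l Y') = Suc (card X)"
        using card n(1) Y'(1) cX by auto
      have "l - 2 \<in> brace_set Y'" using Y'(4) unfolding brace_set_def by blast
      then have b1: "\<forall>m\<in>S. m \<in> brace_set X \<longrightarrow> m \<in> brace_set (insert l Y')"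
        unfolding brX brace_set_insert using br by auto
      have b2: "\<forall>m\<in>S. m \<notin> brace_set (insert l Y') \<longrightarrow> below X m \<le> below (insert l Y') m"
      proof (intro ballI impI)
        fix m assume m: "m \<in> S" "m \<notin> brace_set (insert l Y')"
        then have "m \<noteq> l" "below Y m \<le> below Y' m" using bl[of m] unfolding brace_set_insert by auto
        then show "below X m \<le> below (insert l Y') m" unfolding bX below_insert[OF Y'(1) n(1)] by auto
      qed
      have s: "x \<in> insert l Y' \<longleftrightarrow> x \<in> X" if "x > l" for x using same[of x] that unfolding X by auto
      show ?thesis
        by (rule exI[of _ "insert l Y'"]) (use g c b1 b2 s Y' lS in auto)
    qed
  qed
qed

text \<open>Braces that contain all parts decompose \<open>P\<close> into almost rectangular partitions, one for each chain element.\<close>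

lemma r_num_le_card:
  assumes X: "finite X" "gapped X" and pos: "0 \<notin> set P" and cov: "set P \<subseteq> brace_set X"
  shows "r_num P \<le> card X"
proof -
  obtain xs where xs: "set xs = X" "distinct xs" using finite_distinct_list[OF X(1)] by blast
  define F where "F = (\<lambda>x. filter_mset (\<lambda>p. p = x \<or> Suc p = x) (mset P))"
  have "sum_list (map F xs) = mset P"
  proof (rule multiset_eqI)
    fix p
    have "count (sum_list (map F xs)) p = (\<Sum>x\<in>X. count (F x) p)"
      using sum_list_distinct_conv_sum_set[OF xs(2), of F] xs(1) by (simp add: count_sum)
    also have "\<dots> = count (mset P) p"
    proof (cases "p \<in> set P")
      case True
      then obtain x where x: "x \<in> X" "p = x \<or> p = x - 1" using cov unfolding brace_set_def by auto
      moreover have "p \<noteq> 0" using True pos by metis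
      ultimately have x': "p = x \<or> Suc p = x" by auto
      have uniq: "y = x" if "y \<in> X" "p = y \<or> Suc p = y" for y
        using that x(1) x' X(2) unfolding gapped_def by auto
      have "(\<Sum>y\<in>X. count (F y) p) = (\<Sum>y\<in>X. if y = x then count (mset P) p else 0)"
      proof (intro sum.cong refl)
        fix y assume y: "y \<in> X"
        show "count (F y) p = (if y = x then count (mset P) p else 0)"
        proof (cases "y = x")
          case True
          then show ?thesis using x' unfolding F_def by simp
        next
          case False
          then have "\<not> (p = y \<or> Suc p = y)" using uniq[OF y] by blast
          then show ?thesis using False unfolding F_def by simp
        qed
      qed
      then show ?thesis using x(1) X(1) by simp
    next
      case False
      then have "count (mset P) p = 0" by (simp add: count_eq_zero_iff)
      then show ?thesis unfolding F_def by simp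
    qed
    finally show "count (sum_list (map F xs)) p = count (mset P) p" .
  qed
  moreover have "\<forall>M \<in> set (map F xs). almost_rectangular M"
    unfolding F_def almost_rectangular_def by auto
  moreover have "length (map F xs) = card X" using xs distinct_card by fastforce
  ultimately show ?thesis unfolding r_num_def by (intro Least_le) blast
qed

text \<open>As long as the chain is shorter than \<open>r\<^sub>P\<close>, some part is outside its braces. Inserting it either lengthens the
  chain or enlarges the set of parts covered by the braces, and the latter can happen only finitely often.\<close>

lemma extend_chain:
  assumes pos: "0 \<notin> set P"
  shows "finite X \<Longrightarrow> gapped X \<Longrightarrow> X \<subseteq> set P \<Longrightarrow> card X < r_num P \<Longrightarrow>
    \<exists>X'. finite X' \<and> gapped X' \<and> X' \<subseteq> set P \<and> card X' = Suc (card X) \<and> uset P X \<subseteq> uset P X'"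
proof (induction "card (set P - brace_set X)" arbitrary: X rule: less_induct)
  case less
  have "\<not> set P \<subseteq> brace_set X" using r_num_le_card[OF less.prems(1,2) pos] less.prems(4) by linarith
  then obtain l where l: "l \<in> set P" "l \<notin> brace_set X" by blast
  have "l \<notin> X" "Suc l \<notin> X" using l(2) unfolding brace_set_def by force+
  from insert_part[OF less.prems(1) pos less.prems(2,3) l(1) this]
  obtain X' where X': "finite X'" "gapped X'" "X' \<subseteq> set P" "l \<in> X'"
    and card: "card X' = card X \<or> card X' = Suc (card X)"
    and br: "\<And>m. m \<in> set P \<Longrightarrow> m \<in> brace_set X \<Longrightarrow> m \<in> brace_set X'"
    and bl: "\<And>m. m \<in> set P \<Longrightarrow> m \<notin> brace_set X' \<Longrightarrow> below X m \<le> below X' m" by auto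
  have sub: "uset P X \<subseteq> uset P X'" by (rule uset_mono[OF br bl])
  from card show ?case
  proof
    assume "card X' = Suc (card X)"
    then show ?thesis using X' sub by blast
  next
    assume c: "card X' = card X"
    have "l \<in> brace_set X'" using X'(4) unfolding brace_set_def by blast
    then have "set P - brace_set X' \<subset> set P - brace_set X" using br l by blast
    then have "card (set P - brace_set X') < card (set P - brace_set X)" by (intro psubset_card_mono) auto
    from less.hyps[OF this X'(1-3)] less.prems(4) c
    obtain X'' where X'': "finite X''" "gapped X''" "X'' \<subseteq> set P" "card X'' = Suc (card X)" "uset P X' \<subseteq> uset P X''"
      by auto
    then show ?thesis using sub by blast
  qed
qed

text \<open>Moving a run \<open>a, a + 2, a + 4, \<dots>\<close> of chain elements up by one uncovers at most the part \<open>a - 1\<close>. The last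
  hypothesis says that there is a part to move to, whatever the length of the run.\<close>

lemma shift_run_up:
  assumes "finite X" "gapped X" "X \<subseteq> S" "a \<in> X"
    and "\<And>b. b \<in> S \<Longrightarrow> a \<le> b \<Longrightarrow> {a..b} \<subseteq> S \<Longrightarrow> even (b - a) \<Longrightarrow> Suc b \<in> S"
  shows "\<exists>X'. finite X' \<and> gapped X' \<and> X' \<subseteq> S \<and> card X' = card X \<and> a \<notin> X' \<and> (\<forall>x<a. x \<in> X' \<longleftrightarrow> x \<in> X) \<and>
    (\<forall>x\<in>X' - X. x - 1 \<in> S) \<and> (\<forall>m\<in>S. m \<in> brace_set X \<longrightarrow> m \<noteq> a - 1 \<longrightarrow> m \<in> brace_set X') \<and>
    (\<forall>m\<in>S. m \<notin> brace_set X' \<longrightarrow> below X m \<le> below X' m)"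
  using assms
proof (induction "card {x \<in> X. a \<le> x}" arbitrary: X a rule: less_induct)
  case less
  note fin = less.prems(1) and gp = less.prems(2) and XS = less.prems(3) and aX = less.prems(4) and cnd = less.prems(5)
  define Y where "Y = X - {a}"
  have X: "X = insert a Y" and nY: "a \<notin> Y" using aX unfolding Y_def by auto
  have a1: "Suc a \<notin> X" using gp aX unfolding gapped_def by blast
  have finY: "finite Y" and gY: "gapped Y" and YS: "Y \<subseteq> S"
    using fin gp XS unfolding Y_def gapped_def by auto
  have cX: "card X = Suc (card Y)" unfolding X using finY nY by simp
  have aS: "a \<in> S" using aX XS by blast
  have a1S: "Suc a \<in> S" using cnd[of a] aS by simp
  have bX: "below X m = (if a < m then 1 else 0) + below Y m" for m
    unfolding X by (rule below_insert[OF finY nY])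
  show ?case
  proof (cases "Suc (Suc a) \<in> X")
    case False
    have n: "Suc a \<notin> Y" "Suc (Suc a) \<notin> Y" using a1 False unfolding Y_def by auto
    have g: "gapped (insert (Suc a) Y)" using gY n nY unfolding gapped_def by auto
    have b: "below X m \<le> below (insert (Suc a) Y) m" if "m \<noteq> Suc a" for m
      unfolding bX below_insert[OF finY n(1)] using that by auto
    show ?thesis
      by (rule exI[of _ "insert (Suc a) Y"])
         (use g finY n nY a1S aS YS cX b in \<open>auto simp: brace_set_insert X\<close>)
  next
    case True
    then have a2Y: "Suc (Suc a) \<in> Y" unfolding Y_def by simp
    have "{x \<in> Y. Suc (Suc a) \<le> x} \<subset> {x \<in> X. a \<le> x}" using aX unfolding Y_def by auto
    then have less': "card {x \<in> Y. Suc (Suc a) \<le> x} < card {x \<in> X. a \<le> x}"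
      using fin by (intro psubset_card_mono) auto
    have cnd': "Suc b \<in> S" if b: "b \<in> S" "Suc (Suc a) \<le> b" "{Suc (Suc a)..b} \<subseteq> S" "even (b - Suc (Suc a))" for b
    proof (rule cnd[OF b(1)])
      show "a \<le> b" using b by simp
      have "{a..b} \<subseteq> insert a (insert (Suc a) {Suc (Suc a)..b})" by auto
      then show "{a..b} \<subseteq> S" using aS a1S b(3) by blast
      have "b - a = Suc (Suc (b - Suc (Suc a)))" using b(2) by simp
      then show "even (b - a)" using b(4) by simp
    qed
    from less.hyps[OF less' finY gY YS a2Y cnd']
    obtain Y' where Y': "finite Y'" "gapped Y'" "Y' \<subseteq> S" "card Y' = card Y" "Suc (Suc a) \<notin> Y'"
      and same: "\<And>x. x < Suc (Suc a) \<Longrightarrow> x \<in> Y' \<longleftrightarrow> x \<in> Y"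
      and new: "\<And>x. x \<in> Y' - Y \<Longrightarrow> x - 1 \<in> S"
      and br: "\<And>m. m \<in> S \<Longrightarrow> m \<in> brace_set Y \<Longrightarrow> m \<noteq> Suc a \<Longrightarrow> m \<in> brace_set Y'"
      and bl: "\<And>m. m \<in> S \<Longrightarrow> m \<notin> brace_set Y' \<Longrightarrow> below Y m \<le> below Y' m" by auto
    have n: "a \<notin> Y'" "Suc a \<notin> Y'" using same[of a] same[of "Suc a"] nY a1 unfolding Y_def by auto
    have g: "gapped (insert (Suc a) Y')" using Y'(2,5) n unfolding gapped_def by auto
    have c: "card (insert (Suc a) Y') = card X" using n(2) Y'(1,4) cX by simp
    have b1: "\<forall>m\<in>S. m \<in> brace_set X \<longrightarrow> m \<noteq> a - 1 \<longrightarrow> m \<in> brace_set (insert (Suc a) Y')"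
      unfolding X brace_set_insert using br by auto
    have b2: "\<forall>m\<in>S. m \<notin> brace_set (insert (Suc a) Y') \<longrightarrow> below X m \<le> below (insert (Suc a) Y') m"
    proof (intro ballI impI)
      fix m assume m: "m \<in> S" "m \<notin> brace_set (insert (Suc a) Y')"
      then have "m \<noteq> Suc a" "below Y m \<le> below Y' m" using bl[of m] unfolding brace_set_insert by auto
      then show "below X m \<le> below (insert (Suc a) Y') m" unfolding bX below_insert[OF Y'(1) n(2)] by auto
    qed
    have s: "x \<in> insert (Suc a) Y' \<longleftrightarrow> x \<in> X" if "x < a" for x using same[of x] that unfolding X by auto
    have nw: "x - 1 \<in> S" if "x \<in> insert (Suc a) Y' - X" for x using new[of x] that aS unfolding X by auto
    show ?thesis
      by (rule exI[of _ "insert (Suc a) Y'"]) (use g c b1 b2 s nw Y' n a1S in auto)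
  qed
qed

text \<open>A brace \<open>{a, a - 1}\<close> whose part \<open>a - 1\<close> is missing starts a maximal consecutive subsequence at \<open>a\<close>. If its
  cardinality is even, the run of chain elements that starts at \<open>a\<close> can be moved up without loss.\<close>

lemma normalize_chain:
  assumes pos: "0 \<notin> set P"
  shows "finite X \<Longrightarrow> gapped X \<Longrightarrow> X \<subseteq> set P \<Longrightarrow>
    \<exists>X'. finite X' \<and> gapped X' \<and> X' \<subseteq> set P \<and> card X' = card X \<and> uset P X \<subseteq> uset P X' \<and>
      (\<forall>a\<in>X'. a - 1 \<in> set P \<or> a \<in> odd_mcs_mins P)"
proof (induction "card {a \<in> X. a - 1 \<notin> set P \<and> a \<notin> odd_mcs_mins P}" arbitrary: X rule: less_induct)
  case less
  let ?bad = "\<lambda>X. {a \<in> X. a - 1 \<notin> set P \<and> a \<notin> odd_mcs_mins P}"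
  show ?case
  proof (cases "?bad X = {}")
    case True
    then show ?thesis using less.prems by blast
  next
    case False
    then obtain a where a: "a \<in> X" "a - 1 \<notin> set P" "a \<notin> odd_mcs_mins P" by blast
    have "a \<in> set P" using a(1) less.prems(3) by blast
    then have "a \<noteq> 0" using pos by metis
    have cnd: "Suc b \<in> set P" if b: "b \<in> set P" "a \<le> b" "{a..b} \<subseteq> set P" "even (b - a)" for b
    proof (rule ccontr)
      assume nb: "Suc b \<notin> set P"
      have "is_mcs (set P) {a..b}"
        unfolding is_mcs_def
      proof (intro conjI allI impI)
        fix a' b' assume ab: "{a..b} \<subseteq> {a'..b'} \<and> {a'..b'} \<subseteq> set P"
        then have le: "a' \<le> a" "b \<le> b'" using b(2) by auto
        have "\<not> a' < a"
        proof
          assume "a' < a"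
          then have "a - 1 \<in> {a'..b'}" using le b(2) by auto
          then show False using ab a(2) by blast
        qed
        moreover have "\<not> b < b'"
        proof
          assume "b < b'"
          then have "Suc b \<in> {a'..b'}" using le b(2) by auto
          then show False using ab nb by blast
        qed
        ultimately show "{a'..b'} = {a..b}" using le by simp
      qed (use b in blast)+
      moreover have "odd (card {a..b})" using b(2,4) by (simp add: Suc_diff_le)
      moreover have "Min {a..b} = a" using b(2) by (intro Min_eqI) auto
      ultimately have "a \<in> odd_mcs_mins P" unfolding odd_mcs_mins_def by (metis (mono_tags, lifting) mem_Collect_eq)
      then show False using a(3) by blast
    qed
    obtain X' where X': "finite X'" "gapped X'" "X' \<subseteq> set P" "card X' = card X" "a \<notin> X'"
      and new: "\<And>x. x \<in> X' - X \<Longrightarrow> x - 1 \<in> set P"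
      and br: "\<And>m. m \<in> set P \<Longrightarrow> m \<in> brace_set X \<Longrightarrow> m \<noteq> a - 1 \<Longrightarrow> m \<in> brace_set X'"
      and bl: "\<And>m. m \<in> set P \<Longrightarrow> m \<notin> brace_set X' \<Longrightarrow> below X m \<le> below X' m"
      using shift_run_up[OF less.prems a(1) cnd] by auto
    have sub: "uset P X \<subseteq> uset P X'" by (rule uset_mono[OF br bl]) (use a(2) in auto)
    have "?bad X' \<subset> ?bad X" using new a X'(5) by blast
    then have "card (?bad X') < card (?bad X)" using less.prems(1) by (intro psubset_card_mono) auto
    from less.hyps[OF this X'(1-3)] X'(4)
    obtain X'' where "finite X''" "gapped X''" "X'' \<subseteq> set P" "card X'' = card X" "uset P X' \<subseteq> uset P X''"
      "\<forall>a\<in>X''. a - 1 \<in> set P \<or> a \<in> odd_mcs_mins P" by auto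
    then show ?thesis using sub by blast
  qed
qed

section \<open>The partition \<open>\<lambda>\<^sub>U\<close>\<close>

lemma finite_chain_lengths:
  "finite {card (U_chain P a) | a. chain_index P a \<and> length a = i}"
proof -
  have "{a. chain_index P a \<and> length a = i} \<subseteq> {a. set a \<subseteq> set P \<and> length a = i}"
    unfolding chain_index_def by auto
  then have "finite {a. chain_index P a \<and> length a = i}"
    using finite_lists_length_eq[of "set P" i] finite_subset by auto
  then have "finite ((\<lambda>a. card (U_chain P a)) ` {a. chain_index P a \<and> length a = i})" by simp
  moreover have "(\<lambda>a. card (U_chain P a)) ` {a. chain_index P a \<and> length a = i} =
     {card (U_chain P a) | a. chain_index P a \<and> length a = i}" by auto
  ultimately show ?thesis by simp
qed

lemma card_uset_le_u_max:
  assumes X: "gapped X" "X \<subseteq> set P" "card X \<noteq> 0"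
  shows "card (uset P X) \<le> u_max P (card X)"
proof -
  have fin: "finite X" using X(3) by (rule contrapos_np) (rule card.infinite)
  have c: "chain_index P (levels X)"
    by (rule chain_index_levels[OF X(1,2) levels_props(2)[OF fin] levels_props(1)[OF fin]])
  have s: "set (levels X) = X" by (rule levels_props(1)[OF fin])
  have "card X = length (levels X)"
    using distinct_card[OF chain_index_set(3)[OF c]] unfolding s .
  moreover have "card (U_chain P (levels X)) = card (uset P X)"
    unfolding chain_index_set(4)[OF c] s ..
  ultimately have "card (uset P X) \<in> {card (U_chain P a) | a. chain_index P a \<and> length a = card X}"
    using c by (intro CollectI exI[of _ "levels X"] conjI) simp_all
  then show ?thesis unfolding u_max_def using X(3) finite_chain_lengths by (simp add: Max_ge)
qed

lemma exists_chain:
  assumes pos: "0 \<notin> set P" and i: "i \<le> r_num P"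
  shows "\<exists>X. finite X \<and> gapped X \<and> X \<subseteq> set P \<and> card X = i"
  using i
proof (induction i)
  case 0
  then show ?case by (intro exI[of _ "{}"]) (simp add: gapped_def)
next
  case (Suc i)
  then obtain X where X: "finite X" "gapped X" "X \<subseteq> set P" "card X = i" by auto
  then show ?case using extend_chain[OF pos X(1-3)] Suc.prems by (metis Suc_le_eq)
qed

lemma u_max_attained:
  assumes pos: "0 \<notin> set P" and i: "i \<le> r_num P" "i \<noteq> 0"
  shows "\<exists>X. finite X \<and> gapped X \<and> X \<subseteq> set P \<and> card X = i \<and> u_max P i = card (uset P X)"
proof -
  obtain X where X: "finite X" "gapped X" "X \<subseteq> set P" "card X = i" using exists_chain[OF pos i(1)] by blast
  have c: "chain_index P (levels X)"
    by (rule chain_index_levels[OF X(2,3) levels_props(2)[OF X(1)] levels_props(1)[OF X(1)]])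
  have "length (levels X) = i"
    using distinct_card[OF chain_index_set(3)[OF c]] levels_props(1)[OF X(1)] X(4) by simp
  then have "{card (U_chain P a) | a. chain_index P a \<and> length a = i} \<noteq> {}" using c by blast
  from Max_in[OF finite_chain_lengths this]
  obtain a where a: "chain_index P a" "length a = i" "u_max P i = card (U_chain P a)"
    unfolding u_max_def using i(2) by auto
  then show ?thesis
    using chain_index_set[OF a(1)] by (intro exI[of _ "set a"]) (simp add: distinct_card)
qed

lemma finite_uset: "finite (uset P X)"
  by (rule finite_subset[OF _ finite_vertices[of P]]) (auto simp: uset_def)

text \<open>By extending an optimal chain.\<close>

lemma u_max_mono:
  assumes pos: "0 \<notin> set P" and i: "i < r_num P"
  shows "u_max P i \<le> u_max P (Suc i)"
proof (cases "i = 0")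
  case True
  then show ?thesis by (simp add: u_max_def)
next
  case False
  obtain X where X: "finite X" "gapped X" "X \<subseteq> set P" "card X = i" "u_max P i = card (uset P X)"
    using u_max_attained[OF pos _ False] i by auto
  obtain X' where X': "gapped X'" "X' \<subseteq> set P" "card X' = Suc i" "uset P X \<subseteq> uset P X'"
    using extend_chain[OF pos X(1-3)] X(4) i by auto
  have "u_max P i \<le> card (uset P X')" unfolding X(5) by (rule card_mono[OF finite_uset X'(4)])
  also have "\<dots> \<le> u_max P (Suc i)" using card_uset_le_u_max[OF X'(1,2)] X'(3) by simp
  finally show ?thesis .
qed

text \<open>The differences telescope because they are not truncated.\<close>

lemma sum_list_take_lambda_U:
  assumes pos: "0 \<notin> set P"
  shows "sum_list (take i (lambda_U P)) = u_max P (min i (r_num P))"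
proof -
  have len: "length (lambda_U P) = r_num P" unfolding lambda_U_def by simp
  have main: "sum_list (take i (lambda_U P)) = u_max P i" if "i \<le> r_num P" for i
    using that
  proof (induction i)
    case 0 then show ?case by (simp add: u_max_def)
  next
    case (Suc i)
    have i: "i < length (lambda_U P)" using Suc.prems len by simp
    have "lambda_U P ! i = u_max P (Suc i) - u_max P i"
      unfolding lambda_U_def using i len by (simp del: upt_Suc)
    then have "sum_list (take (Suc i) (lambda_U P)) = u_max P i + (u_max P (Suc i) - u_max P i)"
      using Suc i by (simp add: take_Suc_conv_app_nth)
    then show ?case using u_max_mono[OF pos, of i] Suc.prems by simp
  qed
  show ?thesis
  proof (cases "i \<le> r_num P")
    case False
    then have "take i (lambda_U P) = take (r_num P) (lambda_U P)" using len by simp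
    then show ?thesis using main[of "r_num P"] False by (simp add: min_def)
  qed (simp add: main)
qed

lemma gram_pole_mono: "gram_pole l \<Phi> s L \<Longrightarrow> L' \<le> L \<Longrightarrow> gram_pole l \<Phi> s L'"
  unfolding gram_pole_def by (meson order_trans)

text \<open>For a single length \<open>i\<close> the bound is attained by some, possibly not adequate, member of the family.\<close>

lemma exists_param_mat_u_max:
  assumes inf: "infinite (UNIV :: 'a :: field set)" and P: "sorted_wrt (\<ge>) P" and pos: "0 \<notin> set P"
    and i: "i \<le> r_num P"
  shows "\<exists>(s :: nat \<Rightarrow> 'a) t t' z q. has_jordan_type (param_mat P s t t' z) q \<and> u_max P i \<le> sum_list (take i q)"
proof -
  have type: "\<exists>q. has_jordan_type (param_mat P s t t' z :: 'a mat) q" for s t t' z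
    by (rule N_B_has_jordan_type[OF U_B_subset_N_B[OF param_mat_U_B[OF P]]])
  show ?thesis
  proof (cases "i = 0")
    case True
    then show ?thesis using type by (simp add: u_max_def)
  next
    case False
    obtain X where X: "finite X" "gapped X" "X \<subseteq> set P" "card X = i" "u_max P i = card (uset P X)"
      using u_max_attained[OF pos i False] by blast
    obtain X' where X': "gapped X'" "X' \<subseteq> set P" "card X' = i" "uset P X \<subseteq> uset P X'"
      "\<And>a. a \<in> X' \<Longrightarrow> a - 1 \<in> set P \<or> a \<in> odd_mcs_mins P"
      using normalize_chain[OF pos X(1-3)] X(4) by auto
    have ne: "P \<noteq> []" using X'(2,3) False by auto
    let ?ls = "levels (set P)"
    have set_ls: "set ?ls = set P" by (rule levels_props(1)) simp
    have srt_ls: "sorted_wrt (>) ?ls" by (rule levels_props(2)) simp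
    have "\<exists>(t :: nat \<Rightarrow> 'a) z. (\<forall>l. l \<notin> odd_mcs_mins P \<longrightarrow> z l = 0) \<and>
      gram_pole (top_part ?ls) (phi (count_list P) t z ?ls) (card X') (chain_bound (count_list P) (set ?ls) X')"
      by (rule exists_gram_pole[OF inf srt_ls]) (use pos X' set_ls in auto)
    then obtain t z :: "nat \<Rightarrow> 'a" where z: "\<And>l. l \<notin> odd_mcs_mins P \<Longrightarrow> z l = 0"
      and g: "gram_pole (top_part ?ls) (phi (count_list P) t z ?ls) i (chain_bound (count_list P) (set P) X')"
      unfolding set_ls X'(3) by blast
    have "?ls = Max (set P) # levels (set P - {Max (set P)})"
      using ne by (intro levels_Max) auto
    then have top: "top_part ?ls = Max (set P)" by (metis top_part.simps(2))
    have "u_max P i \<le> card (uset P X')" unfolding X(5) by (rule card_mono[OF finite_uset X'(4)])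
    also have "\<dots> \<le> chain_bound (count_list P) (set P) X'" by (rule card_uset_le)
    finally have g': "gram_pole (Max (set P)) (phi (count_list P) t z ?ls) i (u_max P i)"
      using g gram_pole_mono unfolding top by blast
    obtain q where q: "has_jordan_type (param_mat P (\<lambda>_. 1) t (\<lambda>_ _. 1) z) q" using type by blast
    from gram_pole_jordan_type[OF P ne pos z q g'] q show ?thesis by blast
  qed
qed

lemma param_mat_line:
  fixes x :: "'a :: field"
  shows "line (param_mat P s t t' z) (param_mat P s1 t1 t1' z1) x =
    param_mat P (\<lambda>i. (1 - x) * s i + x * s1 i) (\<lambda>i. (1 - x) * t i + x * t1 i)
      (\<lambda>i k. (1 - x) * t' i k + x * t1' i k) (\<lambda>i. (1 - x) * z i + x * z1 i)"
proof (rule coef_eqI)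
  fix b b' assume b: "b \<in> vertices P" "b' \<in> vertices P"
  have "coef P (line (param_mat P s t t' z) (param_mat P s1 t1 t1' z1) x) b b' =
    (1 - x) * param_coeff P s t t' z b b' + x * param_coeff P s1 t1 t1' z1 b b'"
    unfolding line_def param_mat_def coef_line[OF endo_mat_carrier endo_mat_carrier b] coef_endo_mat[OF b] ..
  also have "\<dots> = param_coeff P (\<lambda>i. (1 - x) * s i + x * s1 i) (\<lambda>i. (1 - x) * t i + x * t1 i)
      (\<lambda>i k. (1 - x) * t' i k + x * t1' i k) (\<lambda>i. (1 - x) * z i + x * z1 i) b b'"
  proof -
    have S: "(1 - x) * sum f A + x * sum g A = sum (\<lambda>i. (1 - x) * f i + x * g i) A" for f g :: "nat \<Rightarrow> 'a" and A
      by (simp only: sum_distrib_left sum.distrib)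
    have "(1 - x) * param_coeff P s t t' z b b' + x * param_coeff P s1 t1 t1' z1 b b' =
      ((1 - x) * (\<Sum>i \<in> set P - {last P}. s i * elem_coeff (beta_map P i) b b' + t i * elem_coeff (alpha_map P i) b b') +
       x * (\<Sum>i \<in> set P - {last P}. s1 i * elem_coeff (beta_map P i) b b' + t1 i * elem_coeff (alpha_map P i) b b')) +
      ((1 - x) * (\<Sum>i \<in> set P. \<Sum>k \<in> {1..<count_list P i}. t' i k * elem_coeff (e_map i k) b b') +
       x * (\<Sum>i \<in> set P. \<Sum>k \<in> {1..<count_list P i}. t1' i k * elem_coeff (e_map i k) b b')) +
      ((1 - x) * (\<Sum>l \<in> odd_mcs_mins P. z l * elem_coeff (w_map P l) b b') +
       x * (\<Sum>l \<in> odd_mcs_mins P. z1 l * elem_coeff (w_map P l) b b'))"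
      unfolding param_coeff_def by (simp only: distrib_left add_ac)
    also have "\<dots> = param_coeff P (\<lambda>i. (1 - x) * s i + x * s1 i) (\<lambda>i. (1 - x) * t i + x * t1 i)
      (\<lambda>i k. (1 - x) * t' i k + x * t1' i k) (\<lambda>i. (1 - x) * z i + x * z1 i) b b'"
      unfolding param_coeff_def S
    proof (rule arg_cong2[where f = "(+)", OF arg_cong2[where f = "(+)"]], goal_cases)
      case 1
      show ?case by (rule sum.cong[OF refl]) (simp add: algebra_simps)
    next
      case 2
      show ?case by (intro sum.cong refl) (simp add: algebra_simps)
    next
      case 3
      show ?case by (rule sum.cong[OF refl]) (simp add: algebra_simps)
    qed
    finally show ?thesis .
  qed
  finally show "coef P (line (param_mat P s t t' z) (param_mat P s1 t1 t1' z1) x) b b' = coef P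
     (param_mat P (\<lambda>i. (1 - x) * s i + x * s1 i) (\<lambda>i. (1 - x) * t i + x * t1 i)
      (\<lambda>i k. (1 - x) * t' i k + x * t1' i k) (\<lambda>i. (1 - x) * z i + x * z1 i)) b b'"
    unfolding param_mat_def coef_endo_mat[OF b] .
next
  show "line (param_mat P s t t' z) (param_mat P s1 t1 t1' z1) x \<in> carrier_mat (sum_list P) (sum_list P)"
    unfolding line_def param_mat_def
    by (rule add_carrier_mat[OF smult_carrier_mat[OF endo_mat_carrier]])
next
  show "param_mat P (\<lambda>i. (1 - x) * s i + x * s1 i) (\<lambda>i. (1 - x) * t i + x * t1 i)
      (\<lambda>i k. (1 - x) * t' i k + x * t1' i k) (\<lambda>i. (1 - x) * z i + x * z1 i) \<in> carrier_mat (sum_list P) (sum_list P)"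
    unfolding param_mat_def by (rule endo_mat_carrier)
qed

text \<open>All lengths at once: on the line to the member that is good for the next length, all conditions met
  so far, including that the parameters are nonzero, fail at only finitely many points.\<close>

lemma exists_adequate_u_max:
  assumes inf: "infinite (UNIV :: 'a :: field set)" and P: "sorted_wrt (\<ge>) P" and pos: "0 \<notin> set P"
    and m: "m \<le> r_num P"
  shows "\<exists>(s :: nat \<Rightarrow> 'a) t t' z q. (\<forall>i \<in> set P. s i \<noteq> 0 \<and> t i \<noteq> 0) \<and>
    (\<forall>i \<in> set P. \<forall>k \<in> {1..<count_list P i}. t' i k \<noteq> 0) \<and> (\<forall>l \<in> odd_mcs_mins P. z l \<noteq> 0) \<and>
    has_jordan_type (param_mat P s t t' z) q \<and> (\<forall>i\<le>m. u_max P i \<le> sum_list (take i q))"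
  using m
proof (induction m)
  case 0
  have "\<exists>q. has_jordan_type (param_mat P (\<lambda>_. 1) (\<lambda>_. 1) (\<lambda>_ _. 1) (\<lambda>_. 1) :: 'a mat) q"
    by (rule N_B_has_jordan_type[OF U_B_subset_N_B[OF param_mat_U_B[OF P]]])
  then obtain q where "has_jordan_type (param_mat P (\<lambda>_. 1) (\<lambda>_. 1) (\<lambda>_ _. 1) (\<lambda>_. 1) :: 'a mat) q" ..
  then show ?case
    by (intro exI[of _ "\<lambda>_. 1"] exI[of _ "\<lambda>_ _. 1"] exI[of _ q] conjI) (simp_all add: u_max_def)
next
  case (Suc m)
  let ?n = "sum_list P"
  have carr: "param_mat P s t t' z \<in> carrier_mat ?n ?n" for s t :: "nat \<Rightarrow> 'a" and t' z
    unfolding param_mat_def by (rule endo_mat_carrier)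
  from Suc obtain s t :: "nat \<Rightarrow> 'a" and t' z q where
    st: "\<And>i. i \<in> set P \<Longrightarrow> s i \<noteq> 0 \<and> t i \<noteq> 0"
    and t': "\<And>i k. i \<in> set P \<Longrightarrow> k \<in> {1..<count_list P i} \<Longrightarrow> t' i k \<noteq> 0"
    and z: "\<And>l. l \<in> odd_mcs_mins P \<Longrightarrow> z l \<noteq> 0"
    and q: "has_jordan_type (param_mat P s t t' z) q"
    and u: "\<And>i. i \<le> m \<Longrightarrow> u_max P i \<le> sum_list (take i q)" by (metis Suc_leD)
  obtain s1 t1 :: "nat \<Rightarrow> 'a" and t1' z1 q1 where
    q1: "has_jordan_type (param_mat P s1 t1 t1' z1) q1" and u1: "u_max P (Suc m) \<le> sum_list (take (Suc m) q1)"
    using exists_param_mat_u_max[OF inf P pos Suc.prems] by blast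
  let ?C = "param_mat P s t t' z" and ?D = "param_mat P s1 t1 t1' z1"
  have "\<forall>i. \<exists>f\<in>poly_funs ?n. f ?C \<noteq> 0 \<and> (\<forall>A' q'. A' \<in> carrier_mat ?n ?n \<longrightarrow> has_jordan_type A' q' \<longrightarrow>
     f A' \<noteq> 0 \<longrightarrow> sum_list (take i q) \<le> sum_list (take i q'))"
    using jordan_type_semicontinuous[OF carr q] by blast
  then obtain f where f: "\<And>i. f i \<in> poly_funs ?n" "\<And>i. f i ?C \<noteq> 0"
    "\<And>i A' q'. A' \<in> carrier_mat ?n ?n \<Longrightarrow> has_jordan_type A' q' \<Longrightarrow> f i A' \<noteq> 0 \<Longrightarrow>
       sum_list (take i q) \<le> sum_list (take i q')" by metis
  obtain f1 where f1: "f1 \<in> poly_funs ?n" "f1 ?D \<noteq> 0"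
    "\<And>A' q'. A' \<in> carrier_mat ?n ?n \<Longrightarrow> has_jordan_type A' q' \<Longrightarrow> f1 A' \<noteq> 0 \<Longrightarrow>
       sum_list (take (Suc m) q1) \<le> sum_list (take (Suc m) q')"
    using jordan_type_semicontinuous[OF carr q1, of "Suc m"] by metis
  \<comment> \<open>At \<open>x = 0\<close> all conditions hold except possibly the one for \<open>f1\<close>, which holds at \<open>x = 1\<close>.\<close>
  define F where "F = insert (\<lambda>x. f1 (line ?C ?D x)) ((\<lambda>i x. f i (line ?C ?D x)) ` {..m}) \<union>
    (\<lambda>i x. (1 - x) * s i + x * s1 i) ` set P \<union> (\<lambda>i x. (1 - x) * t i + x * t1 i) ` set P \<union>
    (\<lambda>(i, k) x. (1 - x) * t' i k + x * t1' i k) ` (SIGMA i : set P. {1..<count_list P i}) \<union>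
    (\<lambda>l x. (1 - x) * z l + x * z1 l) ` odd_mcs_mins P"
  have finF: "finite F" unfolding F_def
    using finite_subset[OF odd_mcs_mins_subset[of P]] by (auto intro!: finite_SigmaI)
  note ends = line_ends[OF carr[of s t t' z] carr[of s1 t1 t1' z1]]
  obtain x where x: "\<And>g. g \<in> F \<Longrightarrow> g x \<noteq> 0"
  proof (rule common_nonzero[OF inf finF])
    fix g assume "g \<in> F"
    then consider (1) "g = (\<lambda>x. f1 (line ?C ?D x))" | (2) i where "g = (\<lambda>x. f i (line ?C ?D x))" |
       (3) a b where "g = (\<lambda>x. (1 - x) * a + x * b)" "a \<noteq> 0"
      unfolding F_def using st t' z by fast
    then show "g \<in> univ_poly_funs \<and> (\<exists>x. g x \<noteq> 0)"
    proof cases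
      case 1
      then have "g 1 \<noteq> 0" using f1(2) ends by simp
      then show ?thesis using poly_funs_line[OF f1(1) carr carr] unfolding 1 by blast
    next
      case 2
      then have "g 0 \<noteq> 0" using f(2) ends by simp
      then show ?thesis using poly_funs_line[OF f(1) carr carr] unfolding 2 by blast
    next
      case 3
      then have "g 0 \<noteq> 0" by simp
      then show ?thesis using affine_univ_poly_funs unfolding 3(1) by blast
    qed
  qed blast
  define E where "E = line ?C ?D x"
  have E: "E = param_mat P (\<lambda>i. (1 - x) * s i + x * s1 i) (\<lambda>i. (1 - x) * t i + x * t1 i)
      (\<lambda>i k. (1 - x) * t' i k + x * t1' i k) (\<lambda>i. (1 - x) * z i + x * z1 i)"
    unfolding E_def by (rule param_mat_line)
  obtain qE where qE: "has_jordan_type E qE"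
    using N_B_has_jordan_type[OF U_B_subset_N_B[OF param_mat_U_B[OF P]]] unfolding E by blast
  have Ec: "E \<in> carrier_mat ?n ?n" unfolding E by (rule carr)
  have uE: "u_max P i \<le> sum_list (take i qE)" if i: "i \<le> Suc m" for i
  proof (cases "i = Suc m")
    case True
    have "f1 E \<noteq> 0" unfolding E_def by (rule x) (simp add: F_def)
    from f1(3)[OF Ec qE this] u1 show ?thesis unfolding True by simp
  next
    case False
    then have im: "i \<le> m" using i by simp
    have "f i E \<noteq> 0" unfolding E_def by (rule x) (use im in \<open>auto simp: F_def\<close>)
    from f(3)[OF Ec qE this] u[OF im] show ?thesis by simp
  qed
  have n1: "(1 - x) * s i + x * s1 i \<noteq> 0" "(1 - x) * t i + x * t1 i \<noteq> 0" if "i \<in> set P" for i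
    using x[of "\<lambda>x. (1 - x) * s i + x * s1 i"] x[of "\<lambda>x. (1 - x) * t i + x * t1 i"] that
    unfolding F_def by blast+
  have n2: "(1 - x) * t' i k + x * t1' i k \<noteq> 0" if "i \<in> set P" "k \<in> {1..<count_list P i}" for i k
  proof (rule x[of "\<lambda>x. (1 - x) * t' i k + x * t1' i k"])
    have "(\<lambda>x. (1 - x) * t' i k + x * t1' i k) = (\<lambda>(i, k) x. (1 - x) * t' i k + x * t1' i k) (i, k)" by simp
    then show "(\<lambda>x. (1 - x) * t' i k + x * t1' i k) \<in> F" unfolding F_def using that by blast
  qed
  have n3: "(1 - x) * z l + x * z1 l \<noteq> 0" if "l \<in> odd_mcs_mins P" for l
    using x[of "\<lambda>x. (1 - x) * z l + x * z1 l"] that unfolding F_def by blast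
  show ?case
    using n1 n2 n3 qE uE unfolding E
    by (intro exI[of _ "\<lambda>i. (1 - x) * s i + x * s1 i"] exI[of _ "\<lambda>i. (1 - x) * t i + x * t1 i"]
      exI[of _ "\<lambda>i k. (1 - x) * t' i k + x * t1' i k"] exI[of _ "\<lambda>i. (1 - x) * z i + x * z1 i"] exI[of _ qE]) blast
qed

theorem theorem3p9:
  fixes P :: "nat list" and n :: nat
  assumes "infinite (UNIV :: 'a :: field set)"
    and "is_partition n P"
  shows "dominates (Q TYPE('a) P) (lambda_U P) \<and>
    (\<exists>A :: 'a mat. A \<in> U_B P \<and> adequate P A \<and> dominates (jordan_type A) (lambda_U P))"
proof -
  have P: "sorted_wrt (\<ge>) P" and pos: "0 \<notin> set P" using assms(2) unfolding is_partition_def by blast+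
  obtain s t :: "nat \<Rightarrow> 'a" and t' z q where
    st: "\<And>i. i \<in> set P \<Longrightarrow> s i \<noteq> 0 \<and> t i \<noteq> 0"
    and t': "\<And>i k. i \<in> set P \<Longrightarrow> k \<in> {1..<count_list P i} \<Longrightarrow> t' i k \<noteq> 0"
    and z: "\<And>l. l \<in> odd_mcs_mins P \<Longrightarrow> z l \<noteq> 0"
    and q: "has_jordan_type (param_mat P s t t' z) q"
    and u: "\<And>i. i \<le> r_num P \<Longrightarrow> u_max P i \<le> sum_list (take i q)"
    using exists_adequate_u_max[OF assms(1) P pos order.refl] by metis
  let ?A = "param_mat P s t t' z"
  have A: "?A \<in> U_B P" by (rule param_mat_U_B[OF P])
  have ad: "adequate P ?A" by (rule adequate_param_mat) (use st t' z in auto)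
  have dom: "dominates q (lambda_U P)"
    unfolding dominates_def sum_list_take_lambda_U[OF pos]
  proof
    fix i
    have "u_max P (min i (r_num P)) \<le> sum_list (take (min i (r_num P)) q)" by (rule u) simp
    also have "take (min i (r_num P)) q = take (r_num P) (take i q)" by (simp add: min.commute)
    also have "sum_list \<dots> \<le> sum_list (take i q)"
      using append_take_drop_id[of "r_num P" "take i q"] by (metis le_add1 sum_list_append)
    finally show "u_max P (min i (r_num P)) \<le> sum_list (take i q)" .
  qed
  have "dominates (Q TYPE('a) P) q"
    by (rule generic_type_dominates[OF assms(1) pos U_B_subset_N_B[OF A] q])
  then have "dominates (Q TYPE('a) P) (lambda_U P)"
    using dom unfolding dominates_def by (meson order_trans)
  moreover have "jordan_type ?A = q" by (rule jordan_type_eqI[OF q])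
  ultimately show ?thesis using A ad dom by metis
qed

end
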